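(* Let $(\theta,\psi,\xi)$ be an orbit map between the data sets $(\Sigma\rtimes H,dh,X,Y)$ and $(\Sigma'\rtimes H',dh',X',Y')$. Let $W:L^2(X',dx')\to L^2(X,dx)$ be the unitary map $Wf'(x)=\sqrt{J\psi(x)}\,f'(\psi(x))$, and for a function $\eta$ on $X$ put $$\eta^*=\sqrt{J\xi\circ\Phi}\;\eta .$$ If $\eta\in L^2(X,dx)$ is admissible for $G=\Sigma\rtimes H$ and if $\eta^*$ is also in $L^2(X,dx)$, then $W^{-1}\eta^*$ is admissible for $G'=\Sigma'\rtimes H'$. If $(\theta,\psi,\xi)$ is an orbit equivalence, then all admissible vectors of $G'$ are of the form $W^{-1}\eta^*$ for some admissible $\eta\in L^2(X,dx)$ of $G$.
   Context: Groups. Let $d\ge1$. A Lie subgroup $G$ of the symplectic group $Sp(d,\mathbb{R})$ is in the class $\mathcal{E}$ if $$G=\left\{\begin{bmatrix}h&0\\ \sigma h&{}^th^{-1}\end{bmatrix}:h\in H,\ \sigma\in\Sigma\right\},$$ with $H$ a connected Lie subgroup of $GL(d,\mathbb{R})$ and $\Sigma$ a linear subspace of the symmetric $d\times d$ real matrices, both non-trivial, such that $h^\dagger[\sigma]:={}^th^{-1}\sigma h^{-1}\in\Sigma$ for all $h\in H,\sigma\in\Sigma$. One writes $G=\Sigma\rtimes H$. Fix a basis $\sigma_1,\dots,\sigma_n$ of $\Sigma$, identifying $\Sigma$ with $\mathbb{R}^n$ and, via the dual basis, the dual $\Sigma^*$ with $\mathbb{R}^n$; $d\sigma$ is the Haar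 measure on $\Sigma$ corresponding to Lebesgue measure on $\mathbb{R}^n$. Let $M_h\in GL(n,\mathbb{R})$ be the matrix of $\sigma\mapsto h^\dagger[\sigma]$ and let $H$ act on $\mathbb{R}^n\simeq\Sigma^*$ by $h[y]={}^tM_h^{-1}y$, and on $\mathbb{R}^d$ by $x\mapsto hx$. Put $\chi(h)=|\det M_h|$, $\beta(h)=|\det h|$. Let $\Phi=(\varphi_1,\dots,\varphi_n):\mathbb{R}^d\to\mathbb{R}^n$, $\varphi_i(x)=-\frac12\langle\sigma_ix,x\rangle$; it satisfies $\Phi(hx)=h[\Phi(x)]$. Let $J\Phi(x)=\sqrt{\det(D\Phi(x)\,{}^tD\Phi(x))}$. Admissible vectors. Given a left Haar measure $dh$ of $H$, $G$ carries the left Haar measure $dg=\chi(h)^{-1}d\sigma\,dh$. The restriction $U$ to $G$ of the metaplectic representation is $U_{(\sigma,h)}f(x)=\beta(h)^{-1/2}e^{\pi i\langle\sigma x,x\rangle}f(h^{-1}x)$ on $L^2(\mathbb{R}^d)$. A vector $\eta\in L^2(\mathbb{R}^d)$ is admissible for $G$ if $\|f\|^2=\int_G|\langle f,U_g\eta\rangle|^2dg$ for all $f\in L^2(\mathbb{R}^d)$. Data sets. A data set $(\Sigma\rtimes H,dh,X,Y)$ consists of a group $\Sigma\rtimes H\in\mathcal{E}$ such that every orbit $H[y]$, $y\in\mathbb{R}^n$, is locally closed in $\mathbb{R}^n$, a chosen left Haar measure $dh$ of $H$, an open $H$-invariant set $X\subset\mathbb{R}^d$ with Lebesgue negligible complement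 on which $J\Phi>0$, and $Y=\Phi(X)$ (an open $H$-invariant subset of $\mathbb{R}^n$). Thus $L^2(X,dx)=L^2(\mathbb{R}^d,dx)$. For a second data set all objects are denoted with primes ($d',n',\chi',\beta',\Phi'$, etc.). Orbit maps. An orbit map between $(\Sigma\rtimes H,dh,X,Y)$ and $(\Sigma'\rtimes H',dh',X',Y')$ is a triple $(\theta,\psi,\xi)$ such that: (OM1) $\theta:H\to H'$ is an isomorphism of Lie groups such that $dh'=\theta_*dh$ (image measure); (OM2) $\psi:X\to X'$ is a diffeomorphism with $\psi(hx)=\theta(h)\psi(x)$ for all $h\in H$, $x\in X$ (hence $d=d'$); (OM3) $\xi:Y\to Y'$ is a diffeomorphism with $\xi(\Phi(x))=\Phi'(\psi(x))$ for all $x\in X$ (hence $n=n'$). $J\psi$ and $J\xi$ denote the absolute values of the Jacobian determinants. The orbit map is an orbit equivalence if $J\xi$ is a positive constant on $Y$. *)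

theory Defs
  imports "HOL-Analysis.Analysis"
begin

section \<open>Smooth maps, manifolds and Lie subgroups\<close>

text \<open>The following two notions are only meant for open \<open>S\<close>.\<close>

primrec Ck_on :: "nat \<Rightarrow> 'a::euclidean_space set \<Rightarrow> ('a \<Rightarrow> 'b::euclidean_space) \<Rightarrow> bool" where
  "Ck_on 0 S f \<longleftrightarrow> continuous_on S f"
| "Ck_on (Suc k) S f \<longleftrightarrow> (\<forall>x\<in>S. f differentiable (at x)) \<and>
     (\<forall>v. Ck_on k S (\<lambda>x. frechet_derivative f (at x) v))"

definition smooth_on :: "'a::euclidean_space set \<Rightarrow> ('a \<Rightarrow> 'b::euclidean_space) \<Rightarrow> bool" where
  "smooth_on S f \<longleftrightarrow> (\<forall>k. Ck_on k S f)"

definition diffeomorphism ::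
  "'a::euclidean_space set \<Rightarrow> 'b::euclidean_space set \<Rightarrow> ('a \<Rightarrow> 'b) \<Rightarrow> bool" where
  "diffeomorphism S S' f \<longleftrightarrow> open S \<and> open S' \<and> bij_betw f S S' \<and>
     smooth_on S f \<and> smooth_on S' (inv_into S f)"

definition jacobian :: "(real^'m \<Rightarrow> real^'m) \<Rightarrow> real^'m \<Rightarrow> real" where
  "jacobian f x = \<bar>det (matrix (frechet_derivative f (at x)))\<bar>"

text \<open>A chart is a pair of a domain and a coordinate map into the model space \<open>'e\<close>; an atlas is a
  (not necessarily maximal) set of charts. Model spaces have positive dimension, which excludes only
  discrete manifolds.\<close>

type_synonym ('a, 'e) atlas = "('a set \<times> ('a \<Rightarrow> 'e)) set"

definition smooth_manifold :: "'a topology \<Rightarrow> ('a, 'e::euclidean_space) atlas \<Rightarrow> bool" where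
  "smooth_manifold T A \<longleftrightarrow> Hausdorff_space T \<and> second_countable T \<and> \<Union> (fst ` A) = topspace T \<and>
     (\<forall>(U, \<phi>)\<in>A. openin T U \<and> open (\<phi> ` U) \<and>
        homeomorphic_map (subtopology T U) (top_of_set (\<phi> ` U)) \<phi>) \<and>
     (\<forall>(U, \<phi>)\<in>A. \<forall>(V, \<psi>)\<in>A. smooth_on (\<phi> ` (U \<inter> V)) (\<psi> \<circ> inv_into U \<phi>))"

definition smooth_map ::
  "'a topology \<Rightarrow> ('a, 'e::euclidean_space) atlas \<Rightarrow> 'b topology \<Rightarrow> ('b, 'f::euclidean_space) atlas \<Rightarrow>
   ('a \<Rightarrow> 'b) \<Rightarrow> bool" where
  "smooth_map T A T' A' f \<longleftrightarrow> continuous_map T T' f \<and>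
     (\<forall>(U, \<phi>)\<in>A. \<forall>(V, \<psi>)\<in>A'. smooth_on (\<phi> ` (U \<inter> f -` V)) (\<psi> \<circ> f \<circ> inv_into U \<phi>))"

definition prod_atlas :: "('a, 'e) atlas \<Rightarrow> ('b, 'f) atlas \<Rightarrow> ('a \<times> 'b, 'e \<times> 'f) atlas" where
  "prod_atlas A B = {(U \<times> V, map_prod \<phi> \<psi>) | U \<phi> V \<psi>. (U, \<phi>) \<in> A \<and> (V, \<psi>) \<in> B}"

text \<open>Lie subgroups of the general linear group are immersed: the topology \<open>T\<close>, with
  \<open>topspace T\<close> the underlying group of matrices, may be finer than the Euclidean one.\<close>

definition lie_subgroup :: "(real^'d^'d) topology \<Rightarrow> (real^'d^'d, 'e::euclidean_space) atlas \<Rightarrow> bool" where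
  "lie_subgroup T A \<longleftrightarrow> smooth_manifold T A \<and>
     (\<forall>h\<in>topspace T. invertible h) \<and> mat 1 \<in> topspace T \<and>
     (\<forall>g\<in>topspace T. \<forall>h\<in>topspace T. g ** h \<in> topspace T) \<and>
     (\<forall>h\<in>topspace T. matrix_inv h \<in> topspace T) \<and>
     smooth_map (prod_topology T T) (prod_atlas A A) T A (\<lambda>(g, h). g ** h) \<and>
     smooth_map T A T A matrix_inv \<and>
     (\<forall>(U, \<phi>)\<in>A. smooth_on (\<phi> ` U) (inv_into U \<phi>) \<and>
        (\<forall>z\<in>\<phi> ` U. inj (frechet_derivative (inv_into U \<phi>) (at z))))"

definition lie_group_iso ::
  "(real^'d^'d) topology \<Rightarrow> (real^'d^'d, 'e::euclidean_space) atlas \<Rightarrow>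
   (real^'m^'m) topology \<Rightarrow> (real^'m^'m, 'f::euclidean_space) atlas \<Rightarrow>
   (real^'d^'d \<Rightarrow> real^'m^'m) \<Rightarrow> bool" where
  "lie_group_iso T A T' A' \<theta> \<longleftrightarrow> bij_betw \<theta> (topspace T) (topspace T') \<and>
     (\<forall>g\<in>topspace T. \<forall>h\<in>topspace T. \<theta> (g ** h) = \<theta> g ** \<theta> h) \<and>
     smooth_map T A T' A' \<theta> \<and> smooth_map T' A' T A (inv_into (topspace T) \<theta>)"

text \<open>Regularity of the measure need not be required, since Lie groups are second countable.\<close>

definition left_haar_measure :: "(real^'d^'d) topology \<Rightarrow> (real^'d^'d) measure \<Rightarrow> bool" where
  "left_haar_measure T \<mu> \<longleftrightarrow> space \<mu> = topspace T \<and>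
     sets \<mu> = sigma_sets (topspace T) {U. openin T U} \<and>
     emeasure \<mu> (topspace T) \<noteq> 0 \<and>
     (\<forall>K. compactin T K \<longrightarrow> emeasure \<mu> K < \<infinity>) \<and>
     (\<forall>h\<in>topspace T. \<forall>A\<in>sets \<mu>. emeasure \<mu> ((\<lambda>g. h ** g) ` A) = emeasure \<mu> A)"

definition locally_closed :: "'a::topological_space set \<Rightarrow> bool" where
  "locally_closed S \<longleftrightarrow> (\<exists>U C. open U \<and> closed C \<and> S = U \<inter> C)"

section \<open>The groups\<close>

definition dagger :: "real^'d^'d \<Rightarrow> real^'d^'d \<Rightarrow> real^'d^'d" where
  "dagger h \<sigma> = transpose (matrix_inv h) ** \<sigma> ** matrix_inv h"

definition sp_block :: "real^'d^'d \<Rightarrow> real^'d^'d \<Rightarrow> real^('d + 'd)^('d + 'd)" where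
  "sp_block \<sigma> h = (\<chi> i j. case (i, j) of
       (Inl a, Inl b) \<Rightarrow> h $ a $ b
     | (Inl a, Inr b) \<Rightarrow> 0
     | (Inr a, Inl b) \<Rightarrow> (\<sigma> ** h) $ a $ b
     | (Inr a, Inr b) \<Rightarrow> transpose (matrix_inv h) $ a $ b)"

definition block_h :: "real^('d + 'd)^('d + 'd) \<Rightarrow> real^'d^'d" where
  "block_h g = (\<chi> a b. g $ Inl a $ Inl b)"

definition block_sigma :: "real^('d + 'd)^('d + 'd) \<Rightarrow> real^'d^'d" where
  "block_sigma g = (\<chi> a b. g $ Inr a $ Inl b) ** matrix_inv (block_h g)"

text \<open>The group \<open>{sp_block \<sigma> h | h \<in> H, \<sigma> \<in> \<Sigma>}\<close> with \<open>H = topspace T\<close> is in the class E. Being a Lie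
  subgroup of the symplectic group is a consequence of the following conditions.\<close>

definition class_E ::
  "(real^'d^'d) set \<Rightarrow> (real^'d^'d) topology \<Rightarrow> (real^'d^'d, 'e::euclidean_space) atlas \<Rightarrow> bool" where
  "class_E S T A \<longleftrightarrow> lie_subgroup T A \<and> connected_space T \<and> topspace T \<noteq> {mat 1} \<and>
     subspace S \<and> S \<noteq> {0} \<and> (\<forall>\<sigma>\<in>S. transpose \<sigma> = \<sigma>) \<and>
     (\<forall>h\<in>topspace T. \<forall>\<sigma>\<in>S. dagger h \<sigma> \<in> S)"

section \<open>Data sets\<close>

text \<open>\<open>H_top\<close> and \<open>H_atlas\<close> carry the Lie group \<open>H\<close>, \<open>H_haar\<close> is \<open>dh\<close>, \<open>Sig\<close> is \<open>\<Sigma>\<close> with the chosen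
  basis \<open>basis\<close>, and \<open>dom_X\<close> is \<open>X\<close>.\<close>

record ('d::finite, 'n::finite, 'e::euclidean_space) data_rec =
  Sig :: "(real^'d^'d) set"
  basis :: "'n \<Rightarrow> real^'d^'d"
  H_top :: "(real^'d^'d) topology"
  H_atlas :: "(real^'d^'d, 'e) atlas"
  H_haar :: "(real^'d^'d) measure"
  dom_X :: "(real^'d) set"

abbreviation H_of :: "('d::finite, 'n::finite, 'e::euclidean_space) data_rec \<Rightarrow> (real^'d^'d) set" where
  "H_of D \<equiv> topspace (H_top D)"

definition M_mat ::
  "('d::finite, 'n::finite, 'e::euclidean_space) data_rec \<Rightarrow> real^'d^'d \<Rightarrow> real^'n^'n" where
  "M_mat D h = (\<chi> i j. representation (range (basis D)) (dagger h (basis D j)) (basis D i))"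

definition act ::
  "('d::finite, 'n::finite, 'e::euclidean_space) data_rec \<Rightarrow> real^'d^'d \<Rightarrow> real^'n \<Rightarrow> real^'n" where
  "act D h y = transpose (matrix_inv (M_mat D h)) *v y"

definition chi_mod ::
  "('d::finite, 'n::finite, 'e::euclidean_space) data_rec \<Rightarrow> real^'d^'d \<Rightarrow> real" where
  "chi_mod D h = \<bar>det (M_mat D h)\<bar>"

definition beta_mod :: "real^'d^'d \<Rightarrow> real" where
  "beta_mod h = \<bar>det h\<bar>"

definition Phi ::
  "('d::finite, 'n::finite, 'e::euclidean_space) data_rec \<Rightarrow> real^'d \<Rightarrow> real^'n" where
  "Phi D x = (\<chi> i. - (1/2) * ((basis D i *v x) \<bullet> x))"

definition J_Phi ::
  "('d::finite, 'n::finite, 'e::euclidean_space) data_rec \<Rightarrow> real^'d \<Rightarrow> real" where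
  "J_Phi D x =
     (let P = matrix (frechet_derivative (Phi D) (at x)) in sqrt (det (P ** transpose P)))"

definition im_Y ::
  "('d::finite, 'n::finite, 'e::euclidean_space) data_rec \<Rightarrow> (real^'n) set" where
  "im_Y D = Phi D ` dom_X D"

definition data_set :: "('d::finite, 'n::finite, 'e::euclidean_space) data_rec \<Rightarrow> bool" where
  "data_set D \<longleftrightarrow> class_E (Sig D) (H_top D) (H_atlas D) \<and>
     inj (basis D) \<and> independent (range (basis D)) \<and> span (range (basis D)) = Sig D \<and>
     (\<forall>y. locally_closed ((\<lambda>h. act D h y) ` H_of D)) \<and>
     left_haar_measure (H_top D) (H_haar D) \<and>
     open (dom_X D) \<and> (\<forall>h\<in>H_of D. \<forall>x\<in>dom_X D. h *v x \<in> dom_X D) \<and>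
     negligible (- dom_X D) \<and> (\<forall>x\<in>dom_X D. J_Phi D x > 0)"

section \<open>Admissible vectors\<close>

definition haar_Sig ::
  "('d::finite, 'n::finite, 'e::euclidean_space) data_rec \<Rightarrow> (real^'d^'d) measure" where
  "haar_Sig D = distr lborel (restrict_space borel (Sig D)) (\<lambda>c. \<Sum>i\<in>UNIV. (c $ i) *\<^sub>R basis D i)"

text \<open>The measure \<open>dg = \<chi>(h)\<^sup>-\<^sup>1 d\<sigma> dh\<close> on \<open>\<Sigma> \<times> H\<close>, carried over to the group of block matrices.\<close>

definition haar_G ::
  "('d::finite, 'n::finite, 'e::euclidean_space) data_rec \<Rightarrow> (real^('d + 'd)^('d + 'd)) measure" where
  "haar_G D = embed_measure
     (density (haar_Sig D \<Otimes>\<^sub>M H_haar D) (\<lambda>(\<sigma>, h). ennreal (1 / chi_mod D h)))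
     (\<lambda>(\<sigma>, h). sp_block \<sigma> h)"

text \<open>Square integrable functions on \<open>S\<close> are represented by Borel functions on the whole space that
  vanish off \<open>S\<close>; every class modulo null sets has such a representative.\<close>

definition L2_on :: "(real^'d) set \<Rightarrow> (real^'d \<Rightarrow> complex) set" where
  "L2_on S = {f. f \<in> borel_measurable borel \<and> integrable lborel (\<lambda>x. (cmod (f x))\<^sup>2) \<and>
     (\<forall>x. x \<notin> S \<longrightarrow> f x = 0)}"

definition inner_L2 :: "(real^'d \<Rightarrow> complex) \<Rightarrow> (real^'d \<Rightarrow> complex) \<Rightarrow> complex" where
  "inner_L2 f g = (LINT x|lborel. f x * cnj (g x))"

definition metaplectic ::
  "real^('d + 'd)^('d + 'd) \<Rightarrow> (real^'d \<Rightarrow> complex) \<Rightarrow> real^'d \<Rightarrow> complex" where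
  "metaplectic g f x = (let h = block_h g; \<sigma> = block_sigma g in
     complex_of_real (beta_mod h powr (- (1/2))) *
     exp (\<i> * complex_of_real (pi * ((\<sigma> *v x) \<bullet> x))) * f (matrix_inv h *v x))"

definition admissible ::
  "('d::finite, 'n::finite, 'e::euclidean_space) data_rec \<Rightarrow> (real^'d \<Rightarrow> complex) \<Rightarrow> bool" where
  "admissible D \<eta> \<longleftrightarrow> \<eta> \<in> L2_on UNIV \<and>
     (\<forall>f\<in>L2_on UNIV. ennreal (LINT x|lborel. (cmod (f x))\<^sup>2) =
        (\<integral>\<^sup>+ g. ennreal ((cmod (inner_L2 f (metaplectic g \<eta>)))\<^sup>2) \<partial>haar_G D))"

section \<open>Orbit maps\<close>

definition orbit_map ::
  "('d::finite, 'n::finite, 'e::euclidean_space) data_rec \<Rightarrow>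
   ('d, 'n, 'f::euclidean_space) data_rec \<Rightarrow>
   (real^'d^'d \<Rightarrow> real^'d^'d) \<Rightarrow> (real^'d \<Rightarrow> real^'d) \<Rightarrow> (real^'n \<Rightarrow> real^'n) \<Rightarrow> bool" where
  "orbit_map D D' \<theta> \<psi> \<xi> \<longleftrightarrow>
     lie_group_iso (H_top D) (H_atlas D) (H_top D') (H_atlas D') \<theta> \<and>
     H_haar D' = distr (H_haar D) (H_haar D') \<theta> \<and>
     diffeomorphism (dom_X D) (dom_X D') \<psi> \<and>
     (\<forall>h\<in>H_of D. \<forall>x\<in>dom_X D. \<psi> (h *v x) = \<theta> h *v \<psi> x) \<and>
     diffeomorphism (im_Y D) (im_Y D') \<xi> \<and>
     (\<forall>x\<in>dom_X D. \<xi> (Phi D x) = Phi D' (\<psi> x))"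

definition orbit_equivalence ::
  "('d::finite, 'n::finite, 'e::euclidean_space) data_rec \<Rightarrow>
   ('d, 'n, 'f::euclidean_space) data_rec \<Rightarrow>
   (real^'d^'d \<Rightarrow> real^'d^'d) \<Rightarrow> (real^'d \<Rightarrow> real^'d) \<Rightarrow> (real^'n \<Rightarrow> real^'n) \<Rightarrow> bool" where
  "orbit_equivalence D D' \<theta> \<psi> \<xi> \<longleftrightarrow> orbit_map D D' \<theta> \<psi> \<xi> \<and>
     (\<exists>c>0. \<forall>y\<in>im_Y D. jacobian \<xi> y = c)"

definition W_op ::
  "('d::finite, 'n::finite, 'e::euclidean_space) data_rec \<Rightarrow> (real^'d \<Rightarrow> real^'d) \<Rightarrow>
   (real^'d \<Rightarrow> complex) \<Rightarrow> real^'d \<Rightarrow> complex" where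
  "W_op D \<psi> f' x =
     (if x \<in> dom_X D then complex_of_real (sqrt (jacobian \<psi> x)) * f' (\<psi> x) else 0)"

text \<open>For an orbit map, \<open>W_op D \<psi>\<close> is a bijection from \<open>L2_on (dom_X D')\<close> onto \<open>L2_on (dom_X D)\<close>.\<close>

definition W_inv ::
  "('d::finite, 'n::finite, 'e::euclidean_space) data_rec \<Rightarrow>
   ('d, 'n, 'f::euclidean_space) data_rec \<Rightarrow> (real^'d \<Rightarrow> real^'d) \<Rightarrow>
   (real^'d \<Rightarrow> complex) \<Rightarrow> real^'d \<Rightarrow> complex" where
  "W_inv D D' \<psi> = inv_into (L2_on (dom_X D')) (W_op D \<psi>)"

definition star ::
  "('d::finite, 'n::finite, 'e::euclidean_space) data_rec \<Rightarrow> (real^'n \<Rightarrow> real^'n) \<Rightarrow>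
   (real^'d \<Rightarrow> complex) \<Rightarrow> real^'d \<Rightarrow> complex" where
  "star D \<xi> \<eta> x =
     (if x \<in> dom_X D then complex_of_real (sqrt (jacobian \<xi> (Phi D x))) * \<eta> x else 0)"

end

theory Submission
  imports Defs "HOL-Probability.Characteristic_Functions"
begin

text \<open>
  Why the theorem holds. Write \<open>e(t) = exp (2 \<pi> i t)\<close>. Since \<open>\<langle>\<sigma> x, x\<rangle>\<close> is \<open>- 2 c \<bullet> \<Phi> x\<close> when \<open>\<sigma>\<close> has coordinates
  \<open>c\<close>, the number \<open>\<langle>f, U\<^bsub>(\<sigma>,h)\<^esub> \<eta>\<rangle>\<close> is, up to the factor \<open>\<beta>(h)\<^bsup>-1/2\<^esup>\<close>, the integral over \<open>x\<close> of
  \<open>F(x) e(c \<bullet> \<Phi> x)\<close> with \<open>F(x) = f(x) cnj (\<eta> (h\<^bsup>-1\<^esup> x))\<close>: for fixed \<open>h\<close> it is the Fourier transform, at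
  \<open>c\<close>, of the image under \<open>\<Phi>\<close> of the complex measure \<open>F dx\<close>. Admissibility therefore says that \<open>\<parallel>f\<parallel>\<^sup>2\<close>
  is the integral over \<open>H\<close> of \<open>1 / (\<chi>(h) \<beta>(h))\<close> times the squared \<open>L\<^sup>2\<close> norm of this Fourier transform
  (\<open>nn_integral_haar_G\<close>, \<open>admissible_iff\<close>).

  An orbit map preserves the integrand for every single \<open>h\<close>. The \<open>L\<^sup>2\<close> norm of the Fourier transform of a
  finite complex measure \<open>\<nu>\<close> on an open set \<open>Y\<close> is, by Plancherel, the norm of the functional
  \<open>\<phi> \<mapsto> \<integral> \<phi> d\<nu>\<close> on the continuous functions with compact support in \<open>Y\<close>, for the \<open>L\<^sup>2\<close> norm on these
  (\<open>fourier_L2_dual\<close>). In this dual form Plancherel speaks of integrals of \<open>F(x) \<phi>(\<Phi> x)\<close> only, to which the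
  change of variables \<open>x' = \<psi> x\<close> applies. The assignment of \<open>sqrt (J\<xi>) (\<phi> \<circ> \<xi>)\<close> to \<open>\<phi>\<close> is an isometric bijection
  from the test functions on \<open>Y'\<close> to those on \<open>Y\<close> (\<open>test_pullback\<close>, \<open>test_pullback_surj\<close>), so it
  suffices to see that it exchanges the two functionals. After the substitution this is a pointwise
  identity between weights (\<open>matrix_coefficient_transfer\<close>), which follows from the transformation laws
  \<open>J\<psi>(h z) \<beta>(h) = \<beta>'(\<theta> h) J\<psi>(z)\<close> and \<open>J\<xi>(\<Phi>(h z)) \<chi>'(\<theta> h) = J\<xi>(\<Phi> z) \<chi>(h)\<close>; these come from
  differentiating the equivariance of \<open>\<psi>\<close> and \<open>\<xi>\<close>. The factor \<open>sqrt (J\<xi> \<circ> \<Phi>)\<close> in the definition of \<open>\<eta>\<^sup>*\<close>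
  is what makes the weights agree.

  Thus, whenever \<open>W \<eta>' = \<eta>\<^sup>*\<close>, the vector \<open>\<eta>\<close> is admissible for \<open>G\<close> if and only if \<open>\<eta>'\<close> is admissible for
  \<open>G'\<close> (\<open>admissible_transfer\<close>). Both parts of the theorem follow: in the second one, \<open>J\<xi> = c\<close>
  is constant and \<open>\<eta> = c\<^bsup>-1/2\<^esup> W \<eta>'\<close> is square integrable together with \<open>\<eta>\<^sup>* = W \<eta>'\<close>.
\<close>

section \<open>Change of variables in Euclidean space\<close>

text \<open>The change of variables theorem for \<open>real^'m\<close> supposes that the index type \<open>'m\<close> is a finite
  well-order. This type is one, and it has as many elements as \<open>'d\<close>; reindexing the coordinates
  carries the theorem over to \<open>real^'d\<close>.\<close>

typedef 'd windex = "{..<CARD('d::finite)} :: nat set"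
  by (rule exI[of _ 0]) simp

instantiation windex :: (finite) "{finite, wellorder}"
begin

definition less_eq_windex :: "'a windex \<Rightarrow> 'a windex \<Rightarrow> bool" where
  "less_eq_windex i j \<longleftrightarrow> Rep_windex i \<le> Rep_windex j"

definition less_windex :: "'a windex \<Rightarrow> 'a windex \<Rightarrow> bool" where
  "less_windex i j \<longleftrightarrow> Rep_windex i < Rep_windex j"

instance
proof
  show "finite (UNIV :: 'a windex set)"
    by (metis finite_imageI finite_lessThan type_definition.univ type_definition_windex)
  show "P i" if "\<And>i. (\<And>j. j < i \<Longrightarrow> P j) \<Longrightarrow> P i" for P and i :: "'a windex"
    by (rule measure_induct_rule[of Rep_windex]) (use that in \<open>auto simp: less_windex_def\<close>)
qed (auto simp: less_eq_windex_def less_windex_def Rep_windex_inject)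

end

lemma ex_bij_windex: "\<exists>\<beta> :: 'd::finite windex \<Rightarrow> 'd. bij \<beta>"
proof -
  have "CARD('d windex) = CARD('d)"
    using type_definition.card[OF type_definition_windex] by simp
  then show ?thesis
    by (metis finite_same_card_bij finite_class.finite_UNIV)
qed

definition reindex :: "('a \<Rightarrow> 'b) \<Rightarrow> real^'b \<Rightarrow> real^'a" where
  "reindex \<beta> x = (\<chi> i. x $ \<beta> i)"

lemma reindex_inv:
  assumes "bij \<beta>"
  shows "reindex \<beta> (reindex (inv \<beta>) x) = x" "reindex (inv \<beta>) (reindex \<beta> y) = y"
  using assms by (simp_all add: reindex_def vec_eq_iff bij_is_inj bij_is_surj surj_f_inv_f)

lemma linear_reindex: "linear (reindex \<beta>)"
  by (rule linearI) (simp_all add: reindex_def vec_eq_iff)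

text \<open>Reindexing the coordinates maps boxes to boxes with the same side lengths.\<close>

lemma lborel_distr_reindex:
  fixes \<beta> :: "'a::finite \<Rightarrow> 'b::finite"
  assumes "bij \<beta>"
  shows "distr lborel borel (reindex \<beta>) = lborel"
proof (rule lborel_eqI[symmetric])
  have meas [measurable]: "reindex \<beta> \<in> borel_measurable borel"
    by (intro borel_measurable_continuous_onI linear_continuous_on linear_conv_bounded_linear[THEN iffD1] linear_reindex)
  fix l u :: "real^'a"
  assume le: "\<And>b. b \<in> Basis \<Longrightarrow> l \<bullet> b \<le> u \<bullet> b"
  let ?l = "reindex (inv \<beta>) l" and ?u = "reindex (inv \<beta>) u"
  have "reindex \<beta> -` box l u = box ?l ?u"
    using assms unfolding mem_box_cart set_eq_iff vimage_def mem_Collect_eq reindex_def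
    by simp (metis bij_inv_eq_iff)
  then have "emeasure (distr lborel borel (reindex \<beta>)) (box l u) = emeasure lborel (box ?l ?u)"
    by (simp add: emeasure_distr)
  also have "\<dots> = (\<Prod>b\<in>Basis. (?u - ?l) \<bullet> b)"
  proof (rule emeasure_lborel_box)
    fix b :: "real^'b" assume "b \<in> Basis"
    then obtain i where "b = axis i 1" by (auto simp: Basis_vec_def)
    then show "?l \<bullet> b \<le> ?u \<bullet> b"
      using le[of "axis (inv \<beta> i) 1"] by (auto simp: reindex_def inner_axis axis_in_Basis_iff)
  qed
  also have "(\<Prod>b\<in>Basis. (?u - ?l) \<bullet> b) = (\<Prod>i\<in>UNIV. ?u $ i - ?l $ i)"
    unfolding Basis_vec_def by (simp add: inner_axis UNION_singleton_eq_range prod.reindex inj_on_def axis_eq_axis)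
  also have "\<dots> = (\<Prod>i\<in>UNIV. u $ i - l $ i)"
    unfolding reindex_def
    by (rule prod.reindex_bij_witness[of _ "\<beta>" "inv \<beta>"]) (use assms in \<open>auto simp: bij_is_inj bij_is_surj surj_f_inv_f\<close>)
  also have "\<dots> = (\<Prod>b\<in>Basis. (u - l) \<bullet> b)"
    unfolding Basis_vec_def by (simp add: inner_axis UNION_singleton_eq_range prod.reindex inj_on_def axis_eq_axis)
  finally show "emeasure (distr lborel borel (reindex \<beta>)) (box l u) = (\<Prod>b\<in>Basis. (u - l) \<bullet> b)" .
qed simp

text \<open>Conjugation by \<open>\<beta>\<close> matches the permutations of the two index sets and preserves their signs, so
  the two Leibniz sums agree term by term.\<close>

lemma det_reindex:
  fixes A :: "real^'b::finite^'b" and \<beta> :: "'a::finite \<Rightarrow> 'b"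
  assumes \<beta>: "bij \<beta>"
  shows "det (\<chi> i j. A $ \<beta> i $ \<beta> j) = det A"
proof -
  have conj: "map_permutation UNIV \<beta> p = \<beta> \<circ> p \<circ> inv \<beta>" for p
    using \<beta> by (simp add: map_permutation_def restrict_id_def bij_is_surj fun_eq_iff)
  have conj': "map_permutation UNIV (inv \<beta>) p = inv \<beta> \<circ> p \<circ> \<beta>" for p
    using \<beta> by (simp add: map_permutation_def restrict_id_def bij_is_surj fun_eq_iff bij_imp_bij_inv inv_inv_eq)
  have reidx: "bij_betw (map_permutation UNIV \<beta>) {p. p permutes UNIV} {p. p permutes UNIV}"
  proof (rule bij_betw_byWitness[where f' = "map_permutation UNIV (inv \<beta>)"])
    show "map_permutation UNIV \<beta> ` {p. p permutes UNIV} \<subseteq> {p. p permutes UNIV}"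
      using map_permutation_permutes[OF \<beta>] by auto
    show "map_permutation UNIV (inv \<beta>) ` {p. p permutes UNIV} \<subseteq> {p. p permutes UNIV}"
      using map_permutation_permutes[OF bij_imp_bij_inv[OF \<beta>]] by auto
  qed (use \<beta> in \<open>auto simp: conj conj' fun_eq_iff bij_is_inj bij_is_surj surj_f_inv_f\<close>)
  have "det (\<chi> i j. A $ \<beta> i $ \<beta> j) = (\<Sum>p | p permutes UNIV. of_int (sign (map_permutation UNIV \<beta> p)) *
        (\<Prod>i\<in>UNIV. A $ i $ map_permutation UNIV \<beta> p i))"
    unfolding det_def
  proof (intro sum.cong refl)
    fix p :: "'a \<Rightarrow> 'a" assume "p \<in> {p. p permutes UNIV}"
    then have "sign (map_permutation UNIV \<beta> p) = sign p"
      using \<beta> by (intro sign_map_permutation) (auto simp: bij_is_inj)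
    moreover have "(\<Prod>i\<in>UNIV. (\<chi> i j. A $ \<beta> i $ \<beta> j) $ i $ p i) = (\<Prod>i\<in>UNIV. A $ i $ map_permutation UNIV \<beta> p i)"
      unfolding conj
      by (rule prod.reindex_bij_witness[of _ "inv \<beta>" "\<beta>"]) (use \<beta> in \<open>auto simp: bij_is_inj bij_is_surj surj_f_inv_f\<close>)
    ultimately show "of_int (sign p) * (\<Prod>i\<in>UNIV. (\<chi> i j. A $ \<beta> i $ \<beta> j) $ i $ p i) =
      of_int (sign (map_permutation UNIV \<beta> p)) * (\<Prod>i\<in>UNIV. A $ i $ map_permutation UNIV \<beta> p i)"
      by simp
  qed
  also have "\<dots> = det A"
    unfolding det_def by (rule sum.reindex_bij_betw[OF reidx])
  finally show ?thesis .
qed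

text \<open>The change of variables formula for the constant function 1, stated for extended
  nonnegative values. The version for absolutely integrable functions says in particular that one
  side is finite if and only if the other is, which settles the infinite case as well.\<close>

lemma emeasure_image_wellorder:
  fixes g :: "real^'m::{finite,wellorder} \<Rightarrow> real^'m::_"
  assumes S [measurable]: "S \<in> sets borel" and gS [measurable]: "g ` S \<in> sets borel"
    and der: "\<And>x. x \<in> S \<Longrightarrow> (g has_derivative g' x) (at x within S)"
    and inj: "inj_on g S"
    and [measurable]: "(\<lambda>x. indicator S x * \<bar>det (matrix (g' x))\<bar>) \<in> borel_measurable borel"
  shows "emeasure lborel (g ` S) = (\<integral>\<^sup>+x. ennreal (indicator S x * \<bar>det (matrix (g' x))\<bar>) \<partial>lborel)"
proof -
  define u where "u = (\<lambda>x. \<bar>det (matrix (g' x))\<bar>)"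
  have S': "S \<in> sets lebesgue" by (rule sets_completionI_sets) simp
  \<comment> \<open>The constant 1 is taken in \<open>real^1\<close>, as the theorem is about functions with values in \<open>real^'n\<close>.\<close>
  have "(\<lambda>x. \<bar>det (matrix (g' x))\<bar> *\<^sub>R (1::real^1)) absolutely_integrable_on S \<and>
         integral S (\<lambda>x. \<bar>det (matrix (g' x))\<bar> *\<^sub>R (1::real^1)) = vec b
     \<longleftrightarrow> (\<lambda>_. 1::real^1) absolutely_integrable_on (g ` S) \<and> integral (g ` S) (\<lambda>_. 1::real^1) = vec b" for b
    by (rule has_absolute_integral_change_of_variables[OF S' der inj])
  then have cov: "(u has_integral b) S \<longleftrightarrow> ((\<lambda>_. 1) has_integral b) (g ` S)" for b
    unfolding absolutely_integrable_on_1_iff integral_on_1_eq has_integral_iff u_def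
    by (subst (asm) (1 2) absolutely_integrable_on_iff_nonneg) (simp_all add: vec_eq_iff)
  show ?thesis
  proof (cases "emeasure lborel (g ` S)")
    case (real r)
    then have "((\<lambda>_. 1::real) has_integral r) (g ` S)"
      by (subst has_integral_iff_emeasure_lborel) auto
    then have "(u has_integral r) S" by (simp add: cov)
    then have "(\<integral>\<^sup>+x. ennreal (u x) * indicator S x \<partial>lborel) = ennreal r"
      by (intro nn_integral_has_integral_lebesgue') (auto simp: u_def)
    then show ?thesis using real
      by (simp add: u_def ennreal_mult' mult.commute ennreal_indicator)
  next
    case top
    show ?thesis
    proof (cases "\<integral>\<^sup>+x. ennreal (indicator S x * \<bar>det (matrix (g' x))\<bar>) \<partial>lborel")
      case (real r)
      then have "((\<lambda>x. indicator S x * u x) has_integral r) UNIV"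
        by (intro nn_integral_has_integral) (auto simp: u_def)
      moreover have "(\<lambda>x. indicator S x * u x) = (\<lambda>x. if x \<in> S then u x else 0)"
        by auto
      ultimately have "(u has_integral r) S"
        by (simp add: has_integral_restrict_UNIV)
      then have "((\<lambda>_. 1::real) has_integral r) (g ` S)" by (simp add: cov)
      then have "emeasure lborel (g ` S) = ennreal r"
        using real by (subst (asm) has_integral_iff_emeasure_lborel) auto
      with top show ?thesis by simp
    qed (use top in simp)
  qed
qed

lemma emeasure_image_jacobian:
  fixes g :: "real^'d::finite \<Rightarrow> real^'d"
  assumes S [measurable]: "S \<in> sets borel" and gS [measurable]: "g ` S \<in> sets borel"
    and der: "\<And>x. x \<in> S \<Longrightarrow> (g has_derivative g' x) (at x within S)"
    and inj: "inj_on g S"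
    and m [measurable]: "(\<lambda>x. indicator S x * \<bar>det (matrix (g' x))\<bar>) \<in> borel_measurable borel"
  shows "emeasure lborel (g ` S) = (\<integral>\<^sup>+x. ennreal (indicator S x * \<bar>det (matrix (g' x))\<bar>) \<partial>lborel)"
proof -
  obtain \<beta> :: "'d windex \<Rightarrow> 'd" where \<beta>: "bij \<beta>" using ex_bij_windex by blast
  let ?P = "reindex \<beta>" and ?Q = "reindex (inv \<beta>)"
  note PQ [simp] = reindex_inv[OF \<beta>]
  have linQ: "linear ?Q" and linP: "linear ?P" by (rule linear_reindex)+
  have mQ [measurable]: "?Q \<in> borel_measurable borel" and mP [measurable]: "?P \<in> borel_measurable borel"
    by (intro borel_measurable_continuous_onI linear_continuous_on linear_conv_bounded_linear[THEN iffD1] linear_reindex)+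
  have imP: "?P ` B = ?Q -` B" for B
    by (metis (no_types, lifting) PQ bij_betw_imageI bij_vimage_eq_inv_image inj_def inv_equality surj_def)
  have dP: "distr lborel borel ?P = (lborel :: (real^'d windex) measure)"
    and dQ: "distr lborel borel ?Q = (lborel :: (real^'d) measure)"
    using lborel_distr_reindex[OF \<beta>] lborel_distr_reindex[OF bij_imp_bij_inv[OF \<beta>]] by auto
  have eP: "emeasure lborel (?P ` B) = emeasure lborel B" if [measurable]: "B \<in> sets borel" for B
  proof -
    have "emeasure lborel (?P ` B) = emeasure (distr lborel borel ?Q) B"
      by (subst emeasure_distr) (auto simp: imP)
    then show ?thesis by (simp add: dQ)
  qed
  let ?g = "?P \<circ> g \<circ> ?Q" and ?g' = "\<lambda>x. ?P \<circ> g' (?Q x) \<circ> ?Q"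
  have im: "?g ` (?P ` S) = ?P ` (g ` S)"
    by (auto simp: image_image)
  have mat: "det (matrix (?g' x)) = det (matrix (g' (?Q x)))" for x
  proof -
    have "?Q (axis j 1) = axis (\<beta> j) 1" for j
      using \<beta> by (auto simp: reindex_def vec_eq_iff axis_def bij_inv_eq_iff bij_is_inj)
    then have "matrix (?g' x) = (\<chi> i j. matrix (g' (?Q x)) $ \<beta> i $ \<beta> j)"
      by (simp add: matrix_def vec_eq_iff reindex_def)
    then show ?thesis using det_reindex[OF \<beta>] by metis
  qed
  have ind: "indicator (?P ` S) x = (indicator S (?Q x) :: real)" for x
    by (simp add: imP indicator_def)
  have "emeasure lborel (g ` S) = emeasure lborel (?g ` (?P ` S))"
    using eP[OF gS] im by simp
  also have "\<dots> = (\<integral>\<^sup>+x. ennreal (indicator (?P ` S) x * \<bar>det (matrix (?g' x))\<bar>) \<partial>lborel)"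
  proof (rule emeasure_image_wellorder)
    show "?P ` S \<in> sets borel"
      using measurable_sets[OF mQ S] by (simp add: imP)
    show "?g ` ?P ` S \<in> sets borel"
      unfolding im using measurable_sets[OF mQ gS] by (simp add: imP)
    show "inj_on ?g (?P ` S)"
      using inj by (auto simp: inj_on_def) (metis PQ(2))
    show "(?g has_derivative ?g' x) (at x within ?P ` S)" if "x \<in> ?P ` S" for x
    proof -
      have QS: "?Q ` (?P ` S) = S" by (simp add: image_image)
      have "(?Q has_derivative ?Q) (at x within ?P ` S)"
        by (rule linear_imp_has_derivative[OF linQ])
      moreover have "(g has_derivative g' (?Q x)) (at (?Q x) within ?Q ` ?P ` S)"
        using der[of "?Q x"] that unfolding QS by auto
      moreover have "(?P has_derivative ?P) (at (g (?Q x)) within g ` ?Q ` ?P ` S)"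
        by (rule linear_imp_has_derivative[OF linP])
      ultimately show ?thesis
        by (metis (no_types, lifting) diff_chain_within image_comp comp_assoc)
    qed
    show "(\<lambda>x. indicator (?P ` S) x * \<bar>det (matrix (?g' x))\<bar>) \<in> borel_measurable borel"
      unfolding mat ind using measurable_compose[OF mQ m] by simp
  qed
  also have "\<dots> = (\<integral>\<^sup>+x. ennreal (indicator S x * \<bar>det (matrix (g' x))\<bar>) \<partial>distr lborel borel ?Q)"
    by (subst nn_integral_distr) (simp_all add: mat ind)
  finally show ?thesis by (simp add: dQ)
qed

lemma smooth_on_derivative:
  assumes "smooth_on S f" "x \<in> S"
  shows "(f has_derivative frechet_derivative f (at x)) (at x)"
proof -
  have "Ck_on (Suc 0) S f" using assms unfolding smooth_on_def by blast
  then show ?thesis using assms(2) by (simp add: frechet_derivative_works)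
qed

lemma smooth_on_continuous: "smooth_on S f \<Longrightarrow> continuous_on S f"
  unfolding smooth_on_def by (metis Ck_on.simps(1))

lemma smooth_on_continuous_derivative:
  assumes "smooth_on S f"
  shows "continuous_on S (\<lambda>x. frechet_derivative f (at x) v)"
proof -
  have "Ck_on (Suc 0) S f" using assms unfolding smooth_on_def by blast
  then show ?thesis by simp
qed

lemma continuous_on_jacobian:
  assumes "smooth_on S f"
  shows "continuous_on S (jacobian f)"
    unfolding jacobian_def det_def matrix_def 
    by (auto intro!: continuous_intros smooth_on_continuous_derivative[OF assms])

lemma has_derivative_imp_jacobian:
  "(f has_derivative f') (at x) \<Longrightarrow> jacobian f x = \<bar>det (matrix f')\<bar>"
  unfolding jacobian_def by (metis frechet_derivative_at)

lemma jacobian_chain: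
  fixes f g :: "real^'d::finite \<Rightarrow> real^'d"
  assumes f: "(f has_derivative f') (at x)" and g: "(g has_derivative g') (at (f x))"
  shows "jacobian (\<lambda>x. g (f x)) x = jacobian g (f x) * jacobian f x"
proof -
  have "jacobian (\<lambda>x. g (f x)) x = \<bar>det (matrix (g' \<circ> f'))\<bar>"
    using diff_chain_at[OF f g] by (intro has_derivative_imp_jacobian) (simp add: o_def)
  also have "matrix (g' \<circ> f') = matrix g' ** matrix f'"
    using f g by (intro matrix_compose) (auto dest: has_derivative_bounded_linear bounded_linear.linear)
  finally show ?thesis
    using f g by (simp add: has_derivative_imp_jacobian det_mul abs_mult)
qed

lemma jacobian_cong_open:
  assumes "open S" "x \<in> S" "\<And>y. y \<in> S \<Longrightarrow> f y = g y" "f differentiable at x"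
  shows "jacobian f x = jacobian g x"
  unfolding jacobian_def using frechet_derivative_transform_within_open[OF assms(4,1,2,3)] by simp

lemma jacobian_matrix: "jacobian (\<lambda>x. A *v x) x = \<bar>det A\<bar>"
proof -
  have "((\<lambda>x. A *v x) has_derivative (\<lambda>x. A *v x)) (at x)"
    by (rule linear_imp_has_derivative) simp
  from has_derivative_imp_jacobian[OF this] show ?thesis by simp
qed

lemma diffeomorphism_inv:
  assumes "diffeomorphism S S' f"
  shows "x \<in> S \<Longrightarrow> f x \<in> S'" "x \<in> S \<Longrightarrow> inv_into S f (f x) = x"
    "y \<in> S' \<Longrightarrow> inv_into S f y \<in> S" "y \<in> S' \<Longrightarrow> f (inv_into S f y) = y"
    "inj_on f S" "f ` S = S'" "open S" "open S'" "smooth_on S f" "smooth_on S' (inv_into S f)"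
  using assms unfolding diffeomorphism_def
  by (auto simp: bij_betw_def inv_into_into f_inv_into_f inv_into_f_f)

text \<open>The chain rule for \<open>inv_into S f \<circ> f\<close>, which is the identity on the open set \<open>S\<close>.\<close>

lemma jacobian_pos:
  fixes f :: "real^'d::finite \<Rightarrow> real^'d"
  assumes f: "diffeomorphism S S' f" and x: "x \<in> S"
  shows "jacobian f x > 0"
proof -
  note F = diffeomorphism_inv[OF f]
  let ?g = "inv_into S f"
  have df: "(f has_derivative frechet_derivative f (at x)) (at x)"
    by (rule smooth_on_derivative[OF F(9) x])
  have dg: "(?g has_derivative frechet_derivative ?g (at (f x))) (at (f x))"
    by (rule smooth_on_derivative[OF F(10) F(1)[OF x]])
  have "jacobian ?g (f x) * jacobian f x = jacobian (\<lambda>x. ?g (f x)) x"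
    using jacobian_chain[OF df dg] by simp
  also have "\<dots> = jacobian (\<lambda>x. x) x"
    using F by (intro jacobian_cong_open[OF F(7) x]) (auto intro: differentiableI diff_chain_at[OF df dg, unfolded o_def])
  also have "\<dots> = 1"
    using jacobian_matrix[of "mat 1" x] by simp
  finally show ?thesis
    using abs_ge_zero[of "det (matrix (frechet_derivative f (at x)))"]
    unfolding jacobian_def by (metis less_eq_real_def mult_zero_right zero_neq_one)
qed

lemma borel_measurable_indicator_jacobian:
  assumes "diffeomorphism S S' f"
  shows "(\<lambda>x. indicator S x * jacobian f x) \<in> borel_measurable borel"
  using borel_measurable_continuous_on_indicator[OF _ continuous_on_jacobian[OF diffeomorphism_inv(9)[OF assms]]]
    diffeomorphism_inv(7)[OF assms] by simp

lemma borel_measurable_indicator_diffeomorphism: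
  assumes "diffeomorphism S S' f"
  shows "(\<lambda>x. indicator S x *\<^sub>R f x) \<in> borel_measurable borel"
  using borel_measurable_continuous_on_indicator[OF _ smooth_on_continuous[OF diffeomorphism_inv(9)[OF assms]]]
    diffeomorphism_inv(7)[OF assms] by simp

text \<open>The change of variables formula as an equality of measures, from which integrals of
  functions with values in any Banach space can be transformed. The factors \<open>indicator S\<close> extend
  \<open>f\<close> and its Jacobian by 0 to Borel functions on the whole space.\<close>

lemma distr_jacobian:
  fixes f :: "real^'d::finite \<Rightarrow> real^'d"
  assumes f: "diffeomorphism S S' f"
  shows "distr (density lborel (\<lambda>x. ennreal (indicator S x * jacobian f x))) borel (\<lambda>x. indicator S x *\<^sub>R f x)
    = density lborel (indicator S')"
proof (rule measure_eqI)
  note F = diffeomorphism_inv[OF f]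
  note [measurable] = borel_measurable_indicator_jacobian[OF f] borel_measurable_indicator_diffeomorphism[OF f]
    borel_open[OF F(7)] borel_open[OF F(8)]
  let ?f = "\<lambda>x. indicator S x *\<^sub>R f x"
  fix A assume "A \<in> sets (distr (density lborel (\<lambda>x. ennreal (indicator S x * jacobian f x))) borel ?f)"
  then have A [measurable]: "A \<in> sets borel" by simp
  let ?T = "S \<inter> ?f -` A"
  have T [measurable]: "?T \<in> sets borel"
    using measurable_sets[OF borel_measurable_indicator_diffeomorphism[OF f] A] borel_open[OF F(7)] by auto
  have T': "?T = {x \<in> S. f x \<in> A}" by auto
  have im: "f ` ?T = A \<inter> S'"
    using F by (auto simp: T')
  have "emeasure (distr (density lborel (\<lambda>x. ennreal (indicator S x * jacobian f x))) borel ?f) A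
    = (\<integral>\<^sup>+x. ennreal (indicator S x * jacobian f x) * indicator (?f -` A) x \<partial>lborel)"
    using measurable_sets[OF borel_measurable_indicator_diffeomorphism[OF f] A]
    by (simp add: emeasure_distr emeasure_density)
  also have "\<dots> = (\<integral>\<^sup>+x. ennreal (indicator ?T x * jacobian f x) \<partial>lborel)"
    by (intro nn_integral_cong) (auto simp: indicator_def)
  also have "\<dots> = emeasure lborel (f ` ?T)"
    unfolding jacobian_def
  proof (rule emeasure_image_jacobian[symmetric])
    show "f ` ?T \<in> sets borel" unfolding im by simp
    show "inj_on f ?T" using F(5) by (rule inj_on_subset) auto
    show "(f has_derivative frechet_derivative f (at x)) (at x within ?T)" if "x \<in> ?T" for x
      using smooth_on_derivative[OF F(9)] that by (auto intro: has_derivative_at_withinI)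
    have "(\<lambda>x. indicator ?T x * (indicator S x * jacobian f x)) \<in> borel_measurable borel"
      by measurable
    also have "(\<lambda>x. indicator ?T x * (indicator S x * jacobian f x)) = (\<lambda>x. indicator ?T x * jacobian f x)"
      by (auto simp: indicator_def)
    finally show "(\<lambda>x. indicator ?T x * \<bar>det (matrix (frechet_derivative f (at x)))\<bar>) \<in> borel_measurable borel"
      unfolding jacobian_def .
  qed simp
  also have "\<dots> = emeasure (density lborel (indicator S')) A"
  proof -
    have "emeasure (density lborel (indicator S')) A = (\<integral>\<^sup>+x. indicator S' x * indicator A x \<partial>lborel)"
      by (rule emeasure_density) simp_all
    also have "\<dots> = (\<integral>\<^sup>+x. indicator (A \<inter> S') x \<partial>lborel)"
      by (intro nn_integral_cong) (auto simp: indicator_def)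
    finally show ?thesis unfolding im by simp
  qed
  finally show "emeasure (distr (density lborel (\<lambda>x. ennreal (indicator S x * jacobian f x))) borel ?f) A
    = emeasure (density lborel (indicator S')) A" .
qed simp

lemma integral_jacobian:
  fixes f :: "real^'d::finite \<Rightarrow> real^'d" and g :: "real^'d \<Rightarrow> 'b::{banach, second_countable_topology}"
  assumes f: "diffeomorphism S S' f" and g [measurable]: "g \<in> borel_measurable borel"
    and g0: "\<And>y. y \<notin> S' \<Longrightarrow> g y = 0"
  shows "integrable lborel g \<longleftrightarrow> integrable lborel (\<lambda>x. (indicator S x * jacobian f x) *\<^sub>R g (f x))"
    and "integral\<^sup>L lborel g = (LINT x|lborel. (indicator S x * jacobian f x) *\<^sub>R g (f x))"
proof -
  note F = diffeomorphism_inv[OF f]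
  note [measurable] = borel_measurable_indicator_jacobian[OF f] borel_measurable_indicator_diffeomorphism[OF f]
    borel_open[OF F(7)] borel_open[OF F(8)]
  let ?f = "\<lambda>x. indicator S x *\<^sub>R f x"
  let ?M = "density lborel (\<lambda>x. ennreal (indicator S x * jacobian f x))"
  have J0: "0 \<le> indicator S x * jacobian f x" for x by (simp add: jacobian_def)
  have 1: "g = (\<lambda>y. indicator S' y *\<^sub>R g y)"
    using g0 by (auto simp: indicator_def fun_eq_iff)
  have d: "density lborel (indicator S') = density lborel (\<lambda>x. ennreal (indicator S' x))"
    by (simp add: ennreal_indicator)
  have 2: "(indicator S x * jacobian f x) *\<^sub>R g (f x) = (indicator S x * jacobian f x) *\<^sub>R g (?f x)" for x
    by (auto simp: indicator_def)
  have "integrable lborel g \<longleftrightarrow> integrable (density lborel (indicator S')) g"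
    unfolding d by (subst integrable_density) (simp_all, subst 1, rule refl)
  also have "\<dots> \<longleftrightarrow> integrable (distr ?M borel ?f) g"
    by (simp add: distr_jacobian[OF f])
  also have "\<dots> \<longleftrightarrow> integrable lborel (\<lambda>x. (indicator S x * jacobian f x) *\<^sub>R g (?f x))"
    using J0 by (subst integrable_distr_eq) (simp_all add: integrable_density)
  finally show "integrable lborel g \<longleftrightarrow> integrable lborel (\<lambda>x. (indicator S x * jacobian f x) *\<^sub>R g (f x))"
    unfolding 2 .
  have "integral\<^sup>L lborel g = integral\<^sup>L (density lborel (indicator S')) g"
    unfolding d by (subst integral_density) (simp_all, subst 1, rule refl)
  also have "\<dots> = integral\<^sup>L (distr ?M borel ?f) g"
    by (simp add: distr_jacobian[OF f])
  also have "\<dots> = (LINT x|lborel. (indicator S x * jacobian f x) *\<^sub>R g (?f x))"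
    using J0 by (subst integral_distr) (simp_all add: integral_density)
  finally show "integral\<^sup>L lborel g = (LINT x|lborel. (indicator S x * jacobian f x) *\<^sub>R g (f x))"
    unfolding 2 .
qed

section \<open>Fourier transforms and Gaussians\<close>

text \<open>The width is parametrised so that the transform of \<open>gauss s\<close> is a multiple of \<open>gauss (1 / s)\<close> and
  no roots of the parameter occur.\<close>

definition gauss :: "real \<Rightarrow> 'a::euclidean_space \<Rightarrow> real" where
  "gauss s x = exp (- pi * (s * norm x)\<^sup>2)"

lemma gauss_pos: "0 < gauss s x" and gauss_le_1: "gauss s x \<le> 1"
  by (simp_all add: gauss_def)

lemma gauss_nonneg [simp]: "0 \<le> gauss s x" and abs_gauss [simp]: "\<bar>gauss s x\<bar> = gauss s x"
  by (simp_all add: gauss_def)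

lemma gauss_minus: "gauss s (- x) = gauss s x"
  by (simp add: gauss_def)

lemma borel_measurable_gauss [measurable]: "gauss s \<in> borel_measurable borel"
  unfolding gauss_def[abs_def] by measurable

lemma borel_measurable_cnj [measurable]: "cnj \<in> borel_measurable borel"
  by (intro borel_measurable_continuous_onI linear_continuous_on bounded_linear_cnj)

text \<open>The characteristic function of the standard normal distribution, after rescaling.\<close>

lemma gauss_fourier_1:
  fixes s t :: real
  assumes "s > 0"
  shows "integrable lborel (\<lambda>x. exp (- pi * (s * x)\<^sup>2))"
    and "(LINT x|lborel. exp (- pi * (s * x)\<^sup>2) *\<^sub>R iexp (2 * pi * (x * t)))
      = complex_of_real (exp (- pi * (t / s)\<^sup>2) / s)"
proof -
  define k where "k = sqrt (2 * pi) * s"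
  have k: "k > 0" using assms by (simp add: k_def)
  have dens: "std_normal_density (k * x) = exp (- pi * (s * x)\<^sup>2) / sqrt (2 * pi)" for x
    by (simp add: std_normal_density_def k_def power_mult_distrib)
  have "integrable lborel (\<lambda>x. std_normal_density (0 + k * x))"
    using k by (intro lborel_integrable_real_affine) auto
  then have "integrable lborel (\<lambda>x. sqrt (2 * pi) * std_normal_density (0 + k * x))"
    by (rule integrable_mult_right)
  then show "integrable lborel (\<lambda>x. exp (- pi * (s * x)\<^sup>2))"
    by (simp add: dens)
  define \<tau> where "\<tau> = 2 * pi * t / k"
  have "char std_normal_distribution \<tau> = (LINT x|lborel. std_normal_density x *\<^sub>R iexp (\<tau> * x))"
    unfolding char_def by (subst integral_density) auto
  also have "\<dots> = k *\<^sub>R (LINT x|lborel. std_normal_density (0 + k * x) *\<^sub>R iexp (\<tau> * (0 + k * x)))"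
    using k by (subst lborel_integral_real_affine[of k _ 0]) auto
  also have "\<dots> = k *\<^sub>R (LINT x|lborel. (1 / sqrt (2 * pi)) *\<^sub>R (exp (- pi * (s * x)\<^sup>2) *\<^sub>R iexp (2 * pi * (x * t))))"
  proof -
    have "\<tau> * (0 + k * x) = 2 * pi * (x * t)" for x using k by (simp add: \<tau>_def)
    moreover have "std_normal_density (0 + k * x) = (1 / sqrt (2 * pi)) * exp (- pi * (s * x)\<^sup>2)" for x
      using dens[of x] by simp
    ultimately show ?thesis by (simp only: scaleR_scaleR)
  qed
  also have "\<dots> = s *\<^sub>R (LINT x|lborel. exp (- pi * (s * x)\<^sup>2) *\<^sub>R iexp (2 * pi * (x * t)))"
    by (subst integral_scaleR_right) (simp add: k_def)
  finally have "s *\<^sub>R (LINT x|lborel. exp (- pi * (s * x)\<^sup>2) *\<^sub>R iexp (2 * pi * (x * t)))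
    = complex_of_real (exp (- \<tau>\<^sup>2 / 2))"
    by (simp add: char_std_normal_distribution)
  moreover have "\<tau>\<^sup>2 / 2 = pi * (t / s)\<^sup>2"
    using assms unfolding \<tau>_def k_def by (simp add: field_simps power2_eq_square)
  ultimately show "(LINT x|lborel. exp (- pi * (s * x)\<^sup>2) *\<^sub>R iexp (2 * pi * (x * t)))
      = complex_of_real (exp (- pi * (t / s)\<^sup>2) / s)"
    using assms by (simp add: scaleR_conv_of_real field_simps)
qed

text \<open>The Gaussian is a product of functions of single coordinates, and so is Lebesgue measure.\<close>

lemma gauss_fourier:
  fixes u :: "'a::euclidean_space"
  assumes s: "s > 0"
  shows "integrable lborel (gauss s :: 'a \<Rightarrow> real)"
    and "(LINT x|lborel. gauss s x *\<^sub>R iexp (2 * pi * (x \<bullet> u)))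
      = complex_of_real (gauss (1 / s) u / s ^ DIM('a))"
proof -
  interpret product_sigma_finite "\<lambda>_::'a. lborel :: real measure" ..
  let ?P = "\<lambda>f. \<Sum>b\<in>Basis. f b *\<^sub>R b :: 'a"
  have nrm: "(norm x)\<^sup>2 = (\<Sum>b\<in>Basis. (x \<bullet> b)\<^sup>2)" for x :: 'a
    unfolding power2_norm_eq_inner by (subst euclidean_inner) (simp add: power2_eq_square)
  have gs: "gauss r x = (\<Prod>b\<in>Basis. exp (- pi * (r * (x \<bullet> b))\<^sup>2))" for r and x :: 'a
    unfolding gauss_def power_mult_distrib nrm by (simp add: exp_sum[symmetric] sum_negf sum_distrib_left)
  have gP: "gauss s (?P f) = (\<Prod>b\<in>Basis. exp (- pi * (s * f b)\<^sup>2))" for f :: "'a \<Rightarrow> real"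
    unfolding gs by (intro prod.cong refl) simp
  have iP: "iexp (2 * pi * (?P f \<bullet> u)) = (\<Prod>b\<in>Basis. iexp (2 * pi * (f b * (u \<bullet> b))))" for f :: "'a \<Rightarrow> real"
    by (simp add: exp_sum[symmetric] inner_sum_left sum_distrib_left inner_commute[of u])
  have int1: "integrable lborel (\<lambda>x. exp (- pi * (s * x)\<^sup>2) *\<^sub>R iexp (2 * pi * (x * t)))" for t
    by (rule Bochner_Integration.integrable_bound[OF gauss_fourier_1(1)[OF s]]) auto
  show "integrable lborel (gauss s :: 'a \<Rightarrow> real)"
  proof -
    have "integrable (Pi\<^sub>M Basis (\<lambda>_. lborel)) (\<lambda>f. gauss s (?P f))"
      unfolding gP by (rule product_integrable_prod) (simp, rule gauss_fourier_1(1)[OF s])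
    then show ?thesis
      unfolding lborel_eq[where 'a='a] by (subst integrable_distr_eq) simp_all
  qed
  have "(LINT x|lborel. gauss s x *\<^sub>R iexp (2 * pi * (x \<bullet> u)))
    = (LINT f|(\<Pi>\<^sub>M b\<in>Basis. lborel). (\<Prod>b\<in>Basis. exp (- pi * (s * f b)\<^sup>2) *\<^sub>R iexp (2 * pi * (f b * (u \<bullet> b)))))"
    unfolding lborel_eq[where 'a='a]
  proof (subst integral_distr)
    have "gauss s (?P f) *\<^sub>R iexp (2 * pi * (?P f \<bullet> u))
      = (\<Prod>b\<in>Basis. exp (- pi * (s * f b)\<^sup>2) *\<^sub>R iexp (2 * pi * (f b * (u \<bullet> b))))" for f
      unfolding gP iP by (simp only: scaleR_conv_of_real prod.distrib of_real_prod)
    then show "(LINT f|(\<Pi>\<^sub>M b\<in>Basis. lborel). gauss s (?P f) *\<^sub>R iexp (2 * pi * (?P f \<bullet> u)))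
      = (LINT f|(\<Pi>\<^sub>M b\<in>Basis. lborel). (\<Prod>b\<in>Basis. exp (- pi * (s * f b)\<^sup>2) *\<^sub>R iexp (2 * pi * (f b * (u \<bullet> b)))))"
      by simp
  qed simp_all
  also have "\<dots> = (\<Prod>b\<in>Basis. complex_of_real (exp (- pi * ((u \<bullet> b) / s)\<^sup>2) / s))"
    using int1 gauss_fourier_1(2)[OF s] by (subst product_integral_prod) auto
  also have "\<dots> = complex_of_real (gauss (1 / s) u / s ^ DIM('a))"
    unfolding gs by (simp add: prod_dividef)
  finally show "(LINT x|lborel. gauss s x *\<^sub>R iexp (2 * pi * (x \<bullet> u)))
      = complex_of_real (gauss (1 / s) u / s ^ DIM('a))" .
qed

lemma integral_gauss:
  assumes "s > 0"
  shows "(LINT x|lborel. gauss s (x :: 'a::euclidean_space)) = 1 / s ^ DIM('a)"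
proof -
  have "complex_of_real (LINT x|lborel. gauss s (x :: 'a)) = complex_of_real (1 / s ^ DIM('a))"
    using gauss_fourier(2)[OF assms, of "0 :: 'a"]
    by (simp add: gauss_def scaleR_conv_of_real integral_complex_of_real)
  then show ?thesis by (simp only: of_real_eq_iff)
qed

text \<open>The Fourier transform, at \<open>c\<close>, of the image under \<open>\<Phi>\<close> of the complex measure with density \<open>F\<close>
  with respect to \<open>M\<close>. For \<open>M = lborel\<close> and \<open>\<Phi>\<close> the identity it is the ordinary transform of \<open>F\<close>.\<close>

definition fourier :: "'a measure \<Rightarrow> ('a \<Rightarrow> 'c::euclidean_space) \<Rightarrow> ('a \<Rightarrow> complex) \<Rightarrow> 'c \<Rightarrow> complex" where
  "fourier M \<Phi> F c = (LINT x|M. F x * iexp (2 * pi * (c \<bullet> \<Phi> x)))"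

lemma integrable_fourier_integrand:
  fixes \<Phi> :: "'a \<Rightarrow> 'c::euclidean_space"
  assumes [measurable]: "\<Phi> \<in> borel_measurable M" and F: "integrable M F"
  shows "integrable M (\<lambda>x. F x * iexp (2 * pi * (c \<bullet> \<Phi> x)))"
proof -
  note [measurable] = borel_measurable_integrable[OF F]
  show ?thesis
    by (rule Bochner_Integration.integrable_bound[OF F]) (auto simp: norm_mult)
qed

lemma fourier_bound:
  assumes [measurable]: "\<Phi> \<in> borel_measurable M" and F: "integrable M F"
  shows "cmod (fourier M \<Phi> F c) \<le> (LINT x|M. cmod (F x))"
proof -
  have "cmod (fourier M \<Phi> F c) \<le> (LINT x|M. cmod (F x * iexp (2 * pi * (c \<bullet> \<Phi> x))))"
    unfolding fourier_def by (rule integral_norm_bound)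
  then show ?thesis by (simp add: norm_mult)
qed

lemma continuous_fourier:
  assumes \<Phi> [measurable]: "\<Phi> \<in> borel_measurable M" and F: "integrable M F"
  shows "continuous_on UNIV (fourier M \<Phi> F)"
  unfolding continuous_on_sequentially
proof (intro allI ballI impI)
  note [measurable] = borel_measurable_integrable[OF F]
  fix u :: "nat \<Rightarrow> 'b" and c assume "(\<forall>n. u n \<in> UNIV) \<and> u \<longlonglongrightarrow> c"
  then have u: "u \<longlonglongrightarrow> c" by simp
  show "(fourier M \<Phi> F \<circ> u) \<longlonglongrightarrow> fourier M \<Phi> F c"
    unfolding fourier_def o_def
  proof (rule integral_dominated_convergence[where w = "\<lambda>x. cmod (F x)"])
    show "AE x in M. (\<lambda>n. F x * iexp (2 * pi * (u n \<bullet> \<Phi> x))) \<longlonglongrightarrow> F x * iexp (2 * pi * (c \<bullet> \<Phi> x))"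
      by (intro AE_I2 tendsto_intros u)
  qed (use F in \<open>auto simp: norm_mult\<close>)
qed

lemma borel_measurable_fourier [measurable]:
  assumes "\<Phi> \<in> borel_measurable M" "integrable M F"
  shows "fourier M \<Phi> F \<in> borel_measurable borel"
  by (rule borel_measurable_continuous_onI continuous_fourier assms)+

lemma iexp_mult_cnj: "iexp a * cnj (iexp b) = iexp (a - b)"
  by (simp add: exp_cnj exp_add[symmetric] right_diff_distrib)

lemma integrable_gauss_bounded:
  fixes g :: "'a::euclidean_space \<Rightarrow> 'b::{banach, second_countable_topology}"
  assumes "s > 0" and [measurable]: "g \<in> borel_measurable borel" and b: "\<And>x. norm (g x) \<le> K"
  shows "integrable lborel (\<lambda>x. gauss s x *\<^sub>R g x)"
proof (rule Bochner_Integration.integrable_bound[of _ "\<lambda>x. K * gauss s x"])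
  show "integrable lborel (\<lambda>x. K * gauss s (x::'a))"
    by (intro integrable_mult_right gauss_fourier(1) assms)
  show "AE x in lborel. norm (gauss s x *\<^sub>R g x) \<le> norm (K * gauss s x)"
    by (intro AE_I2) (auto simp: abs_mult mult.commute[of K] intro!: mult_left_mono order.trans[OF b])
qed simp

lemma (in pair_sigma_finite) integrable_tensor:
  fixes f :: "'a \<Rightarrow> complex" and g :: "'b \<Rightarrow> complex"
  assumes f: "integrable M1 f" and g: "integrable M2 g"
  shows "integrable (M1 \<Otimes>\<^sub>M M2) (\<lambda>p. f (fst p) * g (snd p))"
proof (rule Fubini_integrable)
  note [measurable] = borel_measurable_integrable[OF f] borel_measurable_integrable[OF g]
  show "(\<lambda>p. f (fst p) * g (snd p)) \<in> borel_measurable (M1 \<Otimes>\<^sub>M M2)" by measurable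
qed (use f g in \<open>auto simp: norm_mult\<close>)

lemma (in pair_sigma_finite) integral_tensor:
  fixes f :: "'a \<Rightarrow> complex" and g :: "'b \<Rightarrow> complex"
  assumes f: "integrable M1 f" and g: "integrable M2 g"
  shows "(LINT p|(M1 \<Otimes>\<^sub>M M2). f (fst p) * g (snd p)) = (LINT x|M1. f x) * (LINT y|M2. g y)"
  using integral_fst'[OF integrable_tensor[OF f g]] by simp

text \<open>The multiplication formula for Fourier transforms, an instance of Fubini. It turns integrals against the image
  measure of \<open>F\<close> into integrals of its Fourier transform.\<close>

lemma fourier_multiplication:
  fixes G :: "'c::euclidean_space \<Rightarrow> complex"
  assumes M: "sigma_finite_measure M" and \<Phi> [measurable]: "\<Phi> \<in> borel_measurable M"
    and F: "integrable M F" and G: "integrable lborel G"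
  shows "(LINT x|M. F x * fourier lborel (\<lambda>c. c) G (\<Phi> x)) = (LINT c|lborel. G c * fourier M \<Phi> F c)"
proof -
  interpret sigma_finite_measure M by fact
  interpret pair_sigma_finite M "lborel :: 'c measure" ..
  note [measurable] = borel_measurable_integrable[OF F] borel_measurable_integrable[OF G]
  have int: "integrable (M \<Otimes>\<^sub>M lborel) (\<lambda>(x, c). F x * G c * iexp (2 * pi * (c \<bullet> \<Phi> x)))"
    by (rule Bochner_Integration.integrable_bound[OF integrable_tensor[OF F G]]) (auto simp: norm_mult)
  have "(LINT x|M. F x * fourier lborel (\<lambda>c. c) G (\<Phi> x)) = (LINT x|M. LINT c|lborel. F x * G c * iexp (2 * pi * (c \<bullet> \<Phi> x)))"
    unfolding fourier_def
    by (subst integral_mult_right_zero[symmetric]) (simp add: mult.assoc inner_commute)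
  also have "\<dots> = (LINT c|lborel. LINT x|M. F x * G c * iexp (2 * pi * (c \<bullet> \<Phi> x)))"
    by (rule Fubini_integral[OF int, symmetric])
  also have "\<dots> = (LINT c|lborel. G c * fourier M \<Phi> F c)"
    unfolding fourier_def
    by (subst integral_mult_right_zero[symmetric]) (simp add: ac_simps)
  finally show ?thesis .
qed

lemma nn_integral_gauss_translate:
  fixes x :: "'c::euclidean_space"
  assumes s: "s > 0"
  shows "(\<integral>\<^sup>+y. ennreal (gauss (1 / s) (x - y) / s ^ DIM('c)) \<partial>lborel) = 1"
proof -
  \<comment> \<open>Reflection at \<open>x / 2\<close>, which exchanges \<open>y\<close> and \<open>x - y\<close>.\<close>
  have aff: "lborel = density (distr lborel borel (\<lambda>y. x + (-1) *\<^sub>R (y :: 'c))) (\<lambda>_. 1)"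
    using lborel_affine[of "-1" x] by simp
  have "(\<integral>\<^sup>+y. ennreal (gauss (1 / s) (x - y) / s ^ DIM('c)) \<partial>lborel)
    = (\<integral>\<^sup>+y. ennreal (gauss (1 / s) (y :: 'c) / s ^ DIM('c)) \<partial>lborel)"
    by (subst (2) aff) (simp add: nn_integral_density nn_integral_distr)
  also have "\<dots> = ennreal (LINT y|lborel. gauss (1 / s) (y :: 'c) / s ^ DIM('c))"
    using s gauss_fourier(1)[of "1 / s", where 'a = 'c]
    by (intro nn_integral_eq_integral) (auto intro!: AE_I2 divide_nonneg_nonneg)
  also have "\<dots> = 1"
    using s integral_gauss[of "1 / s", where 'a = 'c] by (simp add: power_one_over)
  finally show ?thesis .
qed

text \<open>Damping by a Gaussian makes Fubini applicable: the left-hand side equals the double integral of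
  \<open>g x * cnj (g y)\<close> against the Gaussian kernel \<open>k (x - y)\<close> of total mass 1, and this is at most
  \<open>\<parallel>g\<parallel>\<^sup>2\<close> because \<open>2 \<bar>a b\<bar> \<le> \<bar>a\<bar>\<^sup>2 + \<bar>b\<bar>\<^sup>2\<close>.\<close>

lemma fourier_gauss_L2_bound:
  fixes g :: "'c::euclidean_space \<Rightarrow> complex"
  assumes g: "integrable lborel g" and g2: "integrable lborel (\<lambda>x. (cmod (g x))\<^sup>2)" and s: "s > 0"
  shows "(LINT c|lborel. gauss s c * (cmod (fourier lborel (\<lambda>x. x) g c))\<^sup>2) \<le> (LINT x|lborel. (cmod (g x))\<^sup>2)"
proof -
  let ?N = "lborel \<Otimes>\<^sub>M lborel :: ('c \<times> 'c) measure"
  interpret N: sigma_finite_measure ?N ..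
  interpret C: pair_sigma_finite "lborel :: 'c measure" ?N ..
  note [measurable] = borel_measurable_integrable[OF g]
  let ?H = "\<lambda>p. g (fst p) * cnj (g (snd p))"
  let ?k = "\<lambda>p :: 'c \<times> 'c. gauss (1 / s) (fst p - snd p) / s ^ DIM('c)"
  let ?G = "fourier lborel (\<lambda>x. x) g"
  have k0: "0 \<le> ?k p" for p using s gauss_pos[of "1/s" "fst p - snd p"] by auto
  have cg: "integrable lborel (\<lambda>x. cnj (g x))" using g by simp
  have H: "integrable ?N ?H" by (rule lborel_pair.integrable_tensor[OF g cg])
  have G2: "complex_of_real ((cmod (?G c))\<^sup>2) = (LINT p|?N. ?H p * iexp (2 * pi * (c \<bullet> (fst p - snd p))))" for c
  proof -
    have i: "integrable lborel (\<lambda>x. g x * iexp (2 * pi * (c \<bullet> x)))"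
      by (rule integrable_fourier_integrand[OF _ g]) simp
    have "complex_of_real ((cmod (?G c))\<^sup>2) = ?G c * cnj (?G c)"
      by (rule complex_norm_square)
    also have "cnj (?G c) = (LINT y|lborel. cnj (g y * iexp (2 * pi * (c \<bullet> y))))"
      unfolding fourier_def by (rule Bochner_Integration.integral_cnj[symmetric])
    also have "?G c * \<dots> = (LINT p|?N. (g (fst p) * iexp (2 * pi * (c \<bullet> fst p))) * cnj (g (snd p) * iexp (2 * pi * (c \<bullet> snd p))))"
      unfolding fourier_def
      by (rule lborel_pair.integral_tensor[OF i, symmetric]) (rule integrable_cnj[OF i])
    also have "\<dots> = (LINT p|?N. ?H p * iexp (2 * pi * (c \<bullet> (fst p - snd p))))"
    proof (intro Bochner_Integration.integral_cong refl)
      fix p :: "'c \<times> 'c"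
      have regroup: "(a * e) * cnj (b * f) = (a * cnj b) * (e * cnj f)" for a b e f :: complex
        by simp
      have "iexp (2 * pi * (c \<bullet> fst p)) * cnj (iexp (2 * pi * (c \<bullet> snd p))) = iexp (2 * pi * (c \<bullet> (fst p - snd p)))"
        unfolding iexp_mult_cnj by (simp only: inner_diff_right right_diff_distrib)
      then show "(g (fst p) * iexp (2 * pi * (c \<bullet> fst p))) * cnj (g (snd p) * iexp (2 * pi * (c \<bullet> snd p)))
        = ?H p * iexp (2 * pi * (c \<bullet> (fst p - snd p)))"
        by (simp only: regroup)
    qed
    finally show ?thesis .
  qed
  have int: "integrable (lborel \<Otimes>\<^sub>M ?N) (\<lambda>(c, p). gauss s c *\<^sub>R (?H p * iexp (2 * pi * (c \<bullet> (fst p - snd p)))))"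
  proof (rule Bochner_Integration.integrable_bound)
    show "integrable (lborel \<Otimes>\<^sub>M ?N) (\<lambda>q. complex_of_real (gauss s (fst q :: 'c)) * ?H (snd q))"
      using gauss_fourier(1)[OF s, where 'a = 'c] H by (intro C.integrable_tensor) auto
  qed (auto simp: norm_mult)
  have "complex_of_real (LINT c|lborel. gauss s c * (cmod (?G c))\<^sup>2)
    = (LINT c|lborel. LINT p|?N. gauss s c *\<^sub>R (?H p * iexp (2 * pi * (c \<bullet> (fst p - snd p)))))"
    by (simp only: integral_complex_of_real[symmetric] of_real_mult G2 scaleR_conv_of_real integral_mult_right_zero)
  also have "\<dots> = (LINT p|?N. LINT c|lborel. gauss s c *\<^sub>R (?H p * iexp (2 * pi * (c \<bullet> (fst p - snd p)))))"
    by (rule C.Fubini_integral[OF int, symmetric])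
  also have "\<dots> = (LINT p|?N. ?H p * ?k p)"
  proof (intro Bochner_Integration.integral_cong refl)
    fix p :: "'c \<times> 'c"
    have "(LINT c|lborel. gauss s c *\<^sub>R (?H p * iexp (2 * pi * (c \<bullet> (fst p - snd p)))))
      = ?H p * (LINT c|lborel. gauss s c *\<^sub>R iexp (2 * pi * (c \<bullet> (fst p - snd p))))"
      by (subst integral_mult_right_zero[symmetric]) (simp add: scaleR_conv_of_real ac_simps)
    then show "(LINT c|lborel. gauss s c *\<^sub>R (?H p * iexp (2 * pi * (c \<bullet> (fst p - snd p))))) = ?H p * ?k p"
      unfolding gauss_fourier(2)[OF s] .
  qed
  finally have eq: "complex_of_real (LINT c|lborel. gauss s c * (cmod (?G c))\<^sup>2) = (LINT p|?N. ?H p * ?k p)" .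
  have "ennreal (LINT c|lborel. gauss s c * (cmod (?G c))\<^sup>2) \<le> ennreal (cmod (LINT p|?N. ?H p * ?k p))"
    unfolding eq[symmetric] by (intro ennreal_leI) simp
  also have "\<dots> \<le> (\<integral>\<^sup>+p. ennreal (cmod (?H p * ?k p)) \<partial>?N)"
  proof (cases "integrable ?N (\<lambda>p. ?H p * ?k p)")
    case True then show ?thesis by (rule integral_norm_bound_ennreal)
  next
    case False
    from not_integrable_integral_eq[OF this] show ?thesis by (simp only: norm_zero ennreal_0 zero_le)
  qed
  also have "\<dots> \<le> (\<integral>\<^sup>+p. ennreal (1 / 2) * (ennreal ((cmod (g (fst p)))\<^sup>2) * ennreal (?k p) + ennreal ((cmod (g (snd p)))\<^sup>2) * ennreal (?k p)) \<partial>?N)"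
  proof (rule nn_integral_mono)
    fix p :: "'c \<times> 'c"
    have amgm: "ennreal (a * b * k) \<le> ennreal (1 / 2) * (ennreal (a\<^sup>2) * ennreal k + ennreal (b\<^sup>2) * ennreal k)"
      if k: "0 \<le> k" for a b k :: real
    proof -
      have "2 * a * b * k \<le> (a\<^sup>2 + b\<^sup>2) * k"
        by (rule mult_right_mono[OF sum_squares_bound k])
      then have "a * b * k \<le> 1 / 2 * (a\<^sup>2 * k + b\<^sup>2 * k)"
        by (simp add: distrib_right)
      moreover have "ennreal (1 / 2) * (ennreal (a\<^sup>2) * ennreal k + ennreal (b\<^sup>2) * ennreal k)
        = ennreal (1 / 2 * (a\<^sup>2 * k + b\<^sup>2 * k))"
      proof -
        have "ennreal (1 / 2 * (a\<^sup>2 * k + b\<^sup>2 * k)) = ennreal (1 / 2) * ennreal (a\<^sup>2 * k + b\<^sup>2 * k)"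
          by (rule ennreal_mult) (use k in auto)
        also have "ennreal (a\<^sup>2 * k + b\<^sup>2 * k) = ennreal (a\<^sup>2 * k) + ennreal (b\<^sup>2 * k)"
          by (rule ennreal_plus) (use k in auto)
        also have "ennreal (a\<^sup>2 * k) = ennreal (a\<^sup>2) * ennreal k"
          by (rule ennreal_mult) (use k in auto)
        also have "ennreal (b\<^sup>2 * k) = ennreal (b\<^sup>2) * ennreal k"
          by (rule ennreal_mult) (use k in auto)
        finally show ?thesis by (rule sym)
      qed
      ultimately show ?thesis by (simp only: ennreal_leI)
    qed
    have "cmod (?H p * ?k p) = cmod (g (fst p)) * cmod (g (snd p)) * ?k p"
      by (simp only: norm_mult norm_of_real complex_mod_cnj abs_of_nonneg[OF k0])
    then show "ennreal (cmod (?H p * ?k p)) \<le> ennreal (1 / 2) * (ennreal ((cmod (g (fst p)))\<^sup>2) * ennreal (?k p) + ennreal ((cmod (g (snd p)))\<^sup>2) * ennreal (?k p))"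
      by (simp only: amgm[OF k0])
  qed
  also have "\<dots> = ennreal (1 / 2) * ((\<integral>\<^sup>+p. ennreal ((cmod (g (fst p)))\<^sup>2) * ennreal (?k p) \<partial>?N) + (\<integral>\<^sup>+p. ennreal ((cmod (g (snd p)))\<^sup>2) * ennreal (?k p) \<partial>?N))"
    by (subst nn_integral_cmult) (simp_all add: nn_integral_add)
  also have "(\<integral>\<^sup>+p. ennreal ((cmod (g (fst p)))\<^sup>2) * ennreal (?k p) \<partial>?N) = ennreal (LINT x|lborel. (cmod (g x))\<^sup>2)"
  proof -
    have "(\<integral>\<^sup>+p. ennreal ((cmod (g (fst p)))\<^sup>2) * ennreal (?k p) \<partial>?N)
      = (\<integral>\<^sup>+x. (\<integral>\<^sup>+y. ennreal ((cmod (g x))\<^sup>2) * ennreal (?k (x, y)) \<partial>lborel) \<partial>lborel)"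
      by (subst lborel.nn_integral_fst[symmetric]) simp_all
    also have "\<dots> = (\<integral>\<^sup>+x. ennreal ((cmod (g x))\<^sup>2) \<partial>lborel)"
      using nn_integral_gauss_translate[OF s, where 'c = 'c] by (subst nn_integral_cmult) simp_all
    also have "\<dots> = ennreal (LINT x|lborel. (cmod (g x))\<^sup>2)"
      by (intro nn_integral_eq_integral g2) simp
    finally show ?thesis .
  qed
  also have "(\<integral>\<^sup>+p. ennreal ((cmod (g (snd p)))\<^sup>2) * ennreal (?k p) \<partial>?N) = ennreal (LINT x|lborel. (cmod (g x))\<^sup>2)"
  proof -
    have sym: "?k (x, y) = ?k (y, x)" for x y
      using gauss_minus[of "1 / s" "x - y"] by simp
    have "(\<integral>\<^sup>+p. ennreal ((cmod (g (snd p)))\<^sup>2) * ennreal (?k p) \<partial>?N)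
      = (\<integral>\<^sup>+y. (\<integral>\<^sup>+x. ennreal ((cmod (g y))\<^sup>2) * ennreal (?k (x, y)) \<partial>lborel) \<partial>lborel)"
      by (subst lborel_pair.nn_integral_snd[symmetric]) simp_all
    also have "\<dots> = (\<integral>\<^sup>+x. ennreal ((cmod (g x))\<^sup>2) \<partial>lborel)"
      unfolding sym using nn_integral_gauss_translate[OF s, where 'c = 'c] by (subst nn_integral_cmult) simp_all
    also have "\<dots> = ennreal (LINT x|lborel. (cmod (g x))\<^sup>2)"
      by (intro nn_integral_eq_integral g2) simp
    finally show ?thesis .
  qed
  also have "ennreal (1 / 2) * (ennreal (LINT x|lborel. (cmod (g x))\<^sup>2) + ennreal (LINT x|lborel. (cmod (g x))\<^sup>2)) = ennreal (LINT x|lborel. (cmod (g x))\<^sup>2)"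
  proof -
    have "ennreal (1 / 2) * (ennreal r + ennreal r) = ennreal (1 / 2 * (r + r))" if "0 \<le> r" for r :: real
    proof -
      have "ennreal (1 / 2 * (r + r)) = ennreal (1 / 2) * ennreal (r + r)"
        by (rule ennreal_mult) (use that in auto)
      also have "ennreal (r + r) = ennreal r + ennreal r"
        by (rule ennreal_plus) (use that in auto)
      finally show ?thesis by (rule sym)
    qed
    from this[of "LINT x|lborel. (cmod (g x))\<^sup>2"] show ?thesis by simp
  qed
  finally show ?thesis
    by (rule ennreal_le_iff[THEN iffD1, rotated]) simp
qed

text \<open>The Cauchy-Schwarz inequality from the weighted inequality
  \<open>2 a b \<le> t a\<^sup>2 + b\<^sup>2 / t\<close> with \<open>t = B / A\<close>; both bounds are first enlarged by \<open>e > 0\<close> so that \<open>t\<close> is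
  defined and positive.\<close>

lemma cauchy_schwarz_integral:
  fixes f g :: "'a \<Rightarrow> complex"
  assumes [measurable]: "f \<in> borel_measurable M" "g \<in> borel_measurable M"
    and f: "integrable M (\<lambda>x. (cmod (f x))\<^sup>2)" and g: "integrable M (\<lambda>x. (cmod (g x))\<^sup>2)"
    and A: "(LINT x|M. (cmod (f x))\<^sup>2) \<le> A\<^sup>2" and B: "(LINT x|M. (cmod (g x))\<^sup>2) \<le> B\<^sup>2"
    and "0 \<le> A" "0 \<le> B"
  shows "integrable M (\<lambda>x. f x * g x)" "cmod (LINT x|M. f x * g x) \<le> A * B"
proof -
  have amgm: "cmod (f x * g x) \<le> (t * (cmod (f x))\<^sup>2 + (cmod (g x))\<^sup>2 / t) / 2" if "t > 0" for t x
  proof -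
    have "0 \<le> (t * cmod (f x) - cmod (g x))\<^sup>2 / t" using that by simp
    also have "\<dots> = t * (cmod (f x))\<^sup>2 + (cmod (g x))\<^sup>2 / t - 2 * cmod (f x * g x)"
      using that by (simp add: field_simps power2_eq_square norm_mult)
    finally show ?thesis by simp
  qed
  show int: "integrable M (\<lambda>x. f x * g x)"
  proof (rule Bochner_Integration.integrable_bound)
    show "integrable M (\<lambda>x. (1 * (cmod (f x))\<^sup>2 + (cmod (g x))\<^sup>2 / 1) / 2)"
      using f g by simp
    show "AE x in M. norm (f x * g x) \<le> norm ((1 * (cmod (f x))\<^sup>2 + (cmod (g x))\<^sup>2 / 1) / 2)"
      using amgm[of 1] by (intro AE_I2) (auto simp: abs_of_nonneg)
  qed simp
  have bound: "cmod (LINT x|M. f x * g x) \<le> (t * a\<^sup>2 + b\<^sup>2 / t) / 2"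
    if t: "t > 0" and a: "(LINT x|M. (cmod (f x))\<^sup>2) \<le> a\<^sup>2" and b: "(LINT x|M. (cmod (g x))\<^sup>2) \<le> b\<^sup>2" for t a b
  proof -
    have "cmod (LINT x|M. f x * g x) \<le> (LINT x|M. cmod (f x * g x))"
      by (rule integral_norm_bound)
    also have "\<dots> \<le> (LINT x|M. (t * (cmod (f x))\<^sup>2 + (cmod (g x))\<^sup>2 / t) / 2)"
      using f g int amgm[OF t] by (intro integral_mono) auto
    also have "\<dots> = (t * (LINT x|M. (cmod (f x))\<^sup>2) + (LINT x|M. (cmod (g x))\<^sup>2) / t) / 2"
      using f g by simp
    also have "\<dots> \<le> (t * a\<^sup>2 + b\<^sup>2 / t) / 2"
      using t a b by (intro divide_right_mono add_mono mult_left_mono) auto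
    finally show ?thesis .
  qed
  have lim: "cmod (LINT x|M. f x * g x) \<le> (A + e) * (B + e)" if e: "e > 0" for e
  proof -
    have "A\<^sup>2 \<le> (A + e)\<^sup>2" "B\<^sup>2 \<le> (B + e)\<^sup>2" using assms(7,8) e by (auto intro!: power_mono)
    then have "cmod (LINT x|M. f x * g x) \<le> ((B + e) / (A + e) * (A + e)\<^sup>2 + (B + e)\<^sup>2 / ((B + e) / (A + e))) / 2"
      using assms(7,8) e A B by (intro bound) (auto intro: order.trans)
    also have "\<dots> = (A + e) * (B + e)"
    proof -
      have "(y / x * x\<^sup>2 + y\<^sup>2 / (y / x)) / 2 = x * y" if "x > 0" "y > 0" for x y :: real
        using that by (simp add: power2_eq_square)
      then show ?thesis using assms(7,8) e by simp
    qed
    finally show ?thesis .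
  qed
  have "((\<lambda>e. (A + e) * (B + e)) \<longlongrightarrow> (A + 0) * (B + 0)) (at_right 0)"
    by (intro tendsto_intros)
  then show "cmod (LINT x|M. f x * g x) \<le> A * B"
    by (intro tendsto_lowerbound[of _ _ "at_right 0"]) (auto simp: eventually_at_right_less lim intro: eventually_mono[OF eventually_at_right_less])
qed

lemma gauss_tendsto_1: "(\<lambda>n. gauss (1 / real (Suc n)) x) \<longlonglongrightarrow> 1"
proof -
  have "(\<lambda>n. exp (- pi * (1 / real (Suc n) * norm x)\<^sup>2)) \<longlonglongrightarrow> exp (- pi * (0 * norm x)\<^sup>2)"
    by (intro tendsto_intros LIMSEQ_Suc[OF lim_1_over_n])
  then show ?thesis by (simp add: gauss_def)
qed

text \<open>Fatou, as the Gaussian factor tends to 1: a bound for all damped integrals removes the damping.\<close>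

lemma nn_integral_le_of_gauss:
  fixes h :: "'c::euclidean_space \<Rightarrow> complex"
  assumes [measurable]: "h \<in> borel_measurable borel" and K: "\<And>c. cmod (h c) \<le> K"
    and B: "\<And>s. s > 0 \<Longrightarrow> (LINT c|lborel. gauss s c * (cmod (h c))\<^sup>2) \<le> B"
  shows "(\<integral>\<^sup>+c. ennreal ((cmod (h c))\<^sup>2) \<partial>lborel) \<le> ennreal B"
proof -
  let ?s = "\<lambda>n. 1 / real (Suc n)"
  have "(\<integral>\<^sup>+c. ennreal ((cmod (h c))\<^sup>2) \<partial>lborel)
    = (\<integral>\<^sup>+c. liminf (\<lambda>n. ennreal (gauss (?s n) c * (cmod (h c))\<^sup>2)) \<partial>lborel)"
  proof (rule nn_integral_cong)
    fix c :: 'c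
    have "(\<lambda>n. ennreal (gauss (?s n) c * (cmod (h c))\<^sup>2)) \<longlonglongrightarrow> ennreal (1 * (cmod (h c))\<^sup>2)"
      by (intro tendsto_ennrealI tendsto_mult gauss_tendsto_1 tendsto_const)
    from lim_imp_Liminf[OF _ this] show "ennreal ((cmod (h c))\<^sup>2) = liminf (\<lambda>n. ennreal (gauss (?s n) c * (cmod (h c))\<^sup>2))"
      by simp
  qed
  also have "\<dots> \<le> liminf (\<lambda>n. \<integral>\<^sup>+c. ennreal (gauss (?s n) c * (cmod (h c))\<^sup>2) \<partial>lborel)"
    by (rule nn_integral_liminf) simp
  also have "\<dots> \<le> liminf (\<lambda>n. ennreal B)"
  proof (intro Liminf_mono always_eventually allI)
    fix n
    have s: "?s n > 0" by simp
    have "integrable lborel (\<lambda>c. gauss (?s n) c *\<^sub>R (cmod (h c))\<^sup>2)"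
      by (rule integrable_gauss_bounded[OF s, of _ "K\<^sup>2"]) (use K in \<open>auto intro!: power_mono\<close>)
    then have "(\<integral>\<^sup>+c. ennreal (gauss (?s n) c * (cmod (h c))\<^sup>2) \<partial>lborel)
      = ennreal (LINT c|lborel. gauss (?s n) c * (cmod (h c))\<^sup>2)"
      by (intro nn_integral_eq_integral) auto
    also have "\<dots> \<le> ennreal B" by (rule ennreal_leI[OF B[OF s]])
    finally show "(\<integral>\<^sup>+c. ennreal (gauss (?s n) c * (cmod (h c))\<^sup>2) \<partial>lborel) \<le> ennreal B" .
  qed
  also have "\<dots> = ennreal B" by (simp add: Liminf_const)
  finally show ?thesis .
qed

text \<open>The inequality in Plancherel that the duality argument rests on.\<close>

lemma fourier_L2_bound:
  fixes g :: "'c::euclidean_space \<Rightarrow> complex"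
  assumes g: "integrable lborel g" and g2: "integrable lborel (\<lambda>x. (cmod (g x))\<^sup>2)"
  shows "(\<integral>\<^sup>+c. ennreal ((cmod (fourier lborel (\<lambda>x. x) g c))\<^sup>2) \<partial>lborel) \<le> ennreal (LINT x|lborel. (cmod (g x))\<^sup>2)"
  by (rule nn_integral_le_of_gauss) (use g in \<open>auto intro!: borel_measurable_fourier fourier_gauss_L2_bound[OF g g2] fourier_bound\<close>)

section \<open>The L2 norm of a Fourier transform by duality\<close>

text \<open>Urysohn functions along an exhaustion of \<open>Y\<close> by compact sets.\<close>

lemma compact_cutoffs:
  fixes Y :: "'c::euclidean_space set"
  assumes "open Y"
  obtains k :: "nat \<Rightarrow> 'c \<Rightarrow> real" and C where
    "\<And>j. continuous_on UNIV (k j)" "\<And>j y. 0 \<le> k j y" "\<And>j y. k j y \<le> 1"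
    "\<And>j. compact (C j)" "\<And>j. C j \<subseteq> Y" "\<And>j y. y \<notin> C j \<Longrightarrow> k j y = 0"
    "\<And>y. y \<in> Y \<Longrightarrow> (\<lambda>j. k j y) \<longlonglongrightarrow> 1"
proof -
  obtain C where C: "\<And>n::nat. compact (C n)" "\<And>n. C n \<subseteq> Y" "\<And>n. C n \<subseteq> interior (C (Suc n))"
    "\<Union>(range C) = Y"
    using open_Union_compact_subsets[OF assms] by (metis (no_types, lifting))
  have "\<exists>k :: 'c \<Rightarrow> real. continuous_on UNIV k \<and> (\<forall>y. k y \<in> closed_segment 1 0) \<and> (\<forall>y\<in>C j. k y = 1) \<and>
      (\<forall>y\<in>- interior (C (Suc j)). k y = 0)" for j
    by (rule Urysohn[of "C j" "- interior (C (Suc j))" "1::real" 0])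
      (use C(1) subsetD[OF C(3)] in \<open>auto intro: compact_imp_closed\<close>)
  then obtain k :: "nat \<Rightarrow> 'c \<Rightarrow> real" where k: "\<And>j. continuous_on UNIV (k j)" "\<And>j y. k j y \<in> closed_segment 1 0"
    "\<And>j y. y \<in> C j \<Longrightarrow> k j y = 1" "\<And>j y. y \<notin> interior (C (Suc j)) \<Longrightarrow> k j y = 0"
    by (metis ComplI)
  show ?thesis
  proof (rule that[of k "\<lambda>j. C (Suc j)"])
    show "0 \<le> k j y" "k j y \<le> 1" for j y
      using k(2)[of j y] by (auto simp: closed_segment_eq_real_ivl)
    show "k j y = 0" if "y \<notin> C (Suc j)" for j y
      using k(4) that interior_subset by blast
    show "(\<lambda>j. k j y) \<longlonglongrightarrow> 1" if y: "y \<in> Y" for y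
    proof -
      have mono: "C n \<subseteq> C (Suc n)" for n using C(3) interior_subset by blast
      obtain n where "y \<in> C n" using y C(4) by blast
      then have "y \<in> C m" if "n \<le> m" for m
        using that lift_Suc_mono_le[of C, OF mono] by blast
      then show ?thesis
        by (intro tendsto_eventually eventually_sequentiallyI[of n]) (simp add: k(3))
    qed
  qed (use k C in auto)
qed

definition compact_test :: "'c::euclidean_space set \<Rightarrow> ('c \<Rightarrow> complex) \<Rightarrow> bool" where
  "compact_test Y \<phi> \<longleftrightarrow> continuous_on UNIV \<phi> \<and> (\<exists>K. compact K \<and> K \<subseteq> Y \<and> (\<forall>y. y \<notin> K \<longrightarrow> \<phi> y = 0))"

lemma compact_test_integrable:
  fixes \<phi> :: "'c::euclidean_space \<Rightarrow> complex"
  assumes "compact_test Y \<phi>"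
  shows "\<phi> \<in> borel_measurable borel" "integrable lborel \<phi>" "integrable lborel (\<lambda>y. (cmod (\<phi> y))\<^sup>2)"
    "\<exists>K. \<forall>y. cmod (\<phi> y) \<le> K"
proof -
  obtain K where cont: "continuous_on UNIV \<phi>" and K: "compact K" and 0: "\<And>y. y \<notin> K \<Longrightarrow> \<phi> y = 0"
    using assms unfolding compact_test_def by blast
  show [measurable]: "\<phi> \<in> borel_measurable borel"
    by (rule borel_measurable_continuous_onI[OF cont])
  have "bounded (\<phi> ` K)"
    by (intro compact_imp_bounded compact_continuous_image K continuous_on_subset[OF cont]) simp
  then obtain B where B: "B > 0" "\<And>y. y \<in> K \<Longrightarrow> cmod (\<phi> y) \<le> B"
    unfolding bounded_pos by auto
  then have bound: "cmod (\<phi> y) \<le> B" for y using 0 by (cases "y \<in> K") auto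
  then show "\<exists>K. \<forall>y. cmod (\<phi> y) \<le> K" by blast
  have fin: "integrable lborel (\<lambda>y. indicator K y *\<^sub>R c)" for c :: real
  proof -
    have "K \<in> sets lborel" "emeasure lborel K < \<infinity>"
      using borel_compact[OF K] emeasure_bounded_finite[OF compact_imp_bounded[OF K]] by auto
    then have "integrable lborel (indicator K :: 'c \<Rightarrow> real)"
      by (rule integrable_real_indicator)
    then show ?thesis by simp
  qed
  show "integrable lborel \<phi>"
  proof (rule Bochner_Integration.integrable_bound[OF fin[of B]])
    show "AE y in lborel. norm (\<phi> y) \<le> norm (indicator K y *\<^sub>R B)"
      using B 0 by (intro AE_I2) (auto simp: indicator_def)
  qed simp
  show "integrable lborel (\<lambda>y. (cmod (\<phi> y))\<^sup>2)"
  proof (rule Bochner_Integration.integrable_bound[OF fin[of "B\<^sup>2"]])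
    show "AE y in lborel. norm ((cmod (\<phi> y))\<^sup>2) \<le> norm (indicator K y *\<^sub>R B\<^sup>2)"
      using B 0 by (intro AE_I2) (auto simp: indicator_def power_mono)
  qed simp
qed

lemma integral_affine:
  fixes f :: "'c::euclidean_space \<Rightarrow> complex"
  assumes s: "s > 0" and [measurable]: "f \<in> borel_measurable borel"
  shows "(LINT z|lborel. f z) = complex_of_real (s ^ DIM('c)) * (LINT w|lborel. f (u + s *\<^sub>R w))"
proof -
  have "ennreal \<bar>s\<bar> ^ DIM('c) = ennreal (s ^ DIM('c))" using s by (simp add: ennreal_power)
  then have "(LINT z|lborel. f z) = (LINT z|density (distr lborel borel (\<lambda>w :: 'c. u + s *\<^sub>R w)) (\<lambda>_. ennreal (s ^ DIM('c))). f z)"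
    using lborel_affine[of s u] s by simp
  also have "\<dots> = s ^ DIM('c) *\<^sub>R (LINT w|lborel. f (u + s *\<^sub>R w))"
    using s by (simp add: integral_density integral_distr)
  finally show ?thesis by (simp add: scaleR_conv_of_real)
qed

text \<open>Fourier inversion, damped: the left-hand side is the inverse transform of the damped transform
  of \<open>\<phi>\<close>. It is the average of \<open>\<phi>\<close> around \<open>u\<close> with respect to a Gaussian of width \<open>s\<close> and thus converges
  to \<open>\<phi> u\<close> as \<open>s\<close> tends to 0. The two conjugations change the sign in the exponent.\<close>

lemma gauss_mollifier:
  fixes \<phi> :: "'c::euclidean_space \<Rightarrow> complex"
  assumes \<phi>: "integrable lborel \<phi>" and s: "s > 0"
  shows "fourier lborel (\<lambda>c. c) (\<lambda>c. gauss s c *\<^sub>R cnj (fourier lborel (\<lambda>z. z) (\<lambda>z. cnj (\<phi> z)) c)) u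
    = (LINT w|lborel. gauss 1 w *\<^sub>R \<phi> (u + s *\<^sub>R w))"
proof -
  note [measurable] = borel_measurable_integrable[OF \<phi>]
  let ?p = "fourier lborel (\<lambda>z :: 'c. z) (\<lambda>z. cnj (\<phi> z))"
  let ?G = "\<lambda>c. gauss s c *\<^sub>R iexp (2 * pi * (c \<bullet> - u))"
  have cphi: "integrable lborel (\<lambda>z. cnj (\<phi> z))" using \<phi> by (rule integrable_cnj)
  have G: "integrable lborel ?G"
    by (rule Bochner_Integration.integrable_bound[OF gauss_fourier(1)[OF s, where 'a = 'c]]) (auto simp: gauss_nonneg)
  have "cnj (fourier lborel (\<lambda>c. c) (\<lambda>c. gauss s c *\<^sub>R cnj (?p c)) u)
    = (LINT c|lborel. cnj (gauss s c *\<^sub>R cnj (?p c) * iexp (2 * pi * (u \<bullet> c))))"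
    unfolding fourier_def[of lborel "\<lambda>c. c" "\<lambda>c. gauss s c *\<^sub>R cnj (?p c)"]
    by (rule Bochner_Integration.integral_cnj[symmetric])
  also have "\<dots> = (LINT c|lborel. ?G c * ?p c)"
    by (intro Bochner_Integration.integral_cong refl) (simp add: exp_cnj scaleR_conv_of_real inner_commute ac_simps)
  also have "\<dots> = (LINT z|lborel. cnj (\<phi> z) * fourier lborel (\<lambda>c. c) ?G z)"
    by (rule fourier_multiplication[symmetric]) (use cphi G in \<open>auto intro: lborel.sigma_finite_measure_axioms\<close>)
  also have "\<dots> = (LINT z|lborel. cnj (\<phi> z) * (gauss (1 / s) (z - u) / s ^ DIM('c)))"
  proof (intro Bochner_Integration.integral_cong refl)
    fix z
    have "fourier lborel (\<lambda>c. c) ?G z = (LINT c|lborel. gauss s c *\<^sub>R iexp (2 * pi * (c \<bullet> (z - u))))"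
      unfolding fourier_def
      by (intro Bochner_Integration.integral_cong refl)
        (simp add: mult_exp_exp inner_diff_right inner_commute algebra_simps)
    then have "fourier lborel (\<lambda>c. c) ?G z = complex_of_real (gauss (1 / s) (z - u) / s ^ DIM('c))"
      unfolding gauss_fourier(2)[OF s] .
    then show "cnj (\<phi> z) * fourier lborel (\<lambda>c. c) ?G z = cnj (\<phi> z) * (gauss (1 / s) (z - u) / s ^ DIM('c))"
      by (simp only:)
  qed
  also have "\<dots> = complex_of_real (s ^ DIM('c)) * (LINT w|lborel. cnj (\<phi> (u + s *\<^sub>R w)) * (gauss (1 / s) (u + s *\<^sub>R w - u) / s ^ DIM('c)))"
    by (rule integral_affine[OF s]) simp
  also have "\<dots> = (LINT w|lborel. cnj (gauss 1 w *\<^sub>R \<phi> (u + s *\<^sub>R w)))"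
    using s by (subst integral_mult_right_zero[symmetric], intro Bochner_Integration.integral_cong refl)
      (simp add: gauss_def scaleR_conv_of_real)
  also have "\<dots> = cnj (LINT w|lborel. gauss 1 w *\<^sub>R \<phi> (u + s *\<^sub>R w))"
    by (rule Bochner_Integration.integral_cnj)
  finally show ?thesis by (simp only: complex_cnj_cancel_iff)
qed

text \<open>Plancherel by duality: with \<open>\<nu>\<close> the image of \<open>F dM\<close> under \<open>\<Phi>\<close>, the \<open>L\<^sup>2\<close> norm of the Fourier transform of
  \<open>\<nu>\<close> is at most \<open>B\<close> if and only if \<open>\<phi> \<mapsto> \<integral> \<phi> d\<nu>\<close> is bounded by \<open>B\<close> in the \<open>L\<^sup>2\<close> norm of \<open>\<phi>\<close>, for test
  functions \<open>\<phi>\<close> supported in the open set \<open>Y\<close> that carries \<open>\<nu>\<close>.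

  If the functional is bounded, test it with \<open>\<phi>\<close> the transform of \<open>gauss s\<close> times the conjugate of
  the transform of \<open>\<nu>\<close>: then \<open>\<integral> \<phi> d\<nu>\<close> is the damped squared norm \<open>A\<close> of the transform, and
  \<open>\<parallel>\<phi>\<parallel>\<^sup>2 \<le> A\<close>, so that \<open>A \<le> B sqrt A\<close>. Conversely, \<open>\<integral> \<phi> d\<nu>\<close> is the limit of the integrals of
  mollified \<open>\<phi>\<close>, each of which is an inner product of the transforms of \<open>\<phi>\<close> and \<open>\<nu>\<close> with a damping
  factor.\<close>

lemma fourier_L2_dual:
  fixes \<Phi> :: "'a \<Rightarrow> 'c::euclidean_space"
  assumes M: "sigma_finite_measure M" and \<Phi> [measurable]: "\<Phi> \<in> borel_measurable M" and F: "integrable M F"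
    and Y: "open Y" and F0: "\<And>x. x \<in> space M \<Longrightarrow> \<Phi> x \<notin> Y \<Longrightarrow> F x = 0" and B: "B \<ge> 0"
  shows "(\<integral>\<^sup>+c. ennreal ((cmod (fourier M \<Phi> F c))\<^sup>2) \<partial>lborel) \<le> ennreal (B\<^sup>2) \<longleftrightarrow>
    (\<forall>\<phi>. compact_test Y \<phi> \<longrightarrow>
      cmod (LINT x|M. F x * \<phi> (\<Phi> x)) \<le> B * sqrt (LINT y|lborel. (cmod (\<phi> y))\<^sup>2))"
    (is "?lhs \<longleftrightarrow> ?rhs")
proof -
  note [measurable] = borel_measurable_integrable[OF F]
  let ?F = "fourier M \<Phi> F"
  have mF [measurable]: "?F \<in> borel_measurable borel" by (rule borel_measurable_fourier[OF \<Phi> F])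
  note bF = fourier_bound[OF \<Phi> F]
  define K where "K = (LINT x|M. cmod (F x))"
  have K0: "K \<ge> 0" by (simp add: K_def)
  have bFK: "cmod (?F c) \<le> K" for c using bF by (simp add: K_def)
  show ?thesis
  proof
    assume R: ?rhs
    show ?lhs
    proof (rule nn_integral_le_of_gauss[OF mF bFK])
      fix s :: real assume s: "s > 0"
      define A where "A = (LINT c|lborel. gauss s c * (cmod (?F c))\<^sup>2)"
      define G where "G = (\<lambda>c. gauss s c *\<^sub>R cnj (?F c))"
      have G: "integrable lborel G"
        unfolding G_def by (rule integrable_gauss_bounded[OF s, of _ K]) (use bFK in auto)
      have [measurable]: "G \<in> borel_measurable borel" using G by simp
      have iA: "integrable lborel (\<lambda>c. gauss s c * (cmod (?F c))\<^sup>2)"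
      proof -
        have "norm ((cmod (?F c))\<^sup>2) \<le> K\<^sup>2" for c using bFK[of c] by (simp add: power_mono)
        from integrable_gauss_bounded[of s "\<lambda>c. (cmod (?F c))\<^sup>2", OF s _ this] show ?thesis by simp
      qed
      have G2le: "(cmod (G c))\<^sup>2 \<le> gauss s c * (cmod (?F c))\<^sup>2" for c
      proof -
        have "(gauss s c)\<^sup>2 \<le> gauss s c"
          using gauss_le_1[of s c] by (simp add: power2_eq_square mult_left_le)
        then show ?thesis by (simp add: G_def power_mult_distrib mult_right_mono)
      qed
      have G2: "integrable lborel (\<lambda>c. (cmod (G c))\<^sup>2)"
        by (rule Bochner_Integration.integrable_bound[OF iA]) (use G2le in \<open>auto intro!: AE_I2 simp: abs_mult\<close>)
      have A0: "A \<ge> 0" unfolding A_def by (rule Bochner_Integration.integral_nonneg) simp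
      let ?\<phi> = "fourier lborel (\<lambda>c :: 'c. c) G"
      have c\<phi>: "continuous_on UNIV ?\<phi>" by (rule continuous_fourier) (use G in auto)
      then have [measurable]: "?\<phi> \<in> borel_measurable borel" by (rule borel_measurable_continuous_onI)
      have b\<phi>: "cmod (?\<phi> u) \<le> (LINT c|lborel. cmod (G c))" for u by (rule fourier_bound) (use G in auto)
      have "(\<integral>\<^sup>+u. ennreal ((cmod (?\<phi> u))\<^sup>2) \<partial>lborel) \<le> ennreal (LINT c|lborel. (cmod (G c))\<^sup>2)"
        by (rule fourier_L2_bound[OF G G2])
      also have "\<dots> \<le> ennreal A"
        unfolding A_def by (intro ennreal_leI integral_mono G2 iA G2le)
      finally have n\<phi>: "(\<integral>\<^sup>+u. ennreal ((cmod (?\<phi> u))\<^sup>2) \<partial>lborel) \<le> ennreal A" .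
      then have i\<phi>: "integrable lborel (\<lambda>u. (cmod (?\<phi> u))\<^sup>2)"
        by (intro integrableI_bounded) (auto simp: le_less_trans[OF _ ennreal_less_top])
      have I\<phi>: "(LINT u|lborel. (cmod (?\<phi> u))\<^sup>2) \<le> A"
        using n\<phi> A0 by (subst (asm) nn_integral_eq_integral[OF i\<phi>]) auto
      have dual: "(LINT x|M. F x * ?\<phi> (\<Phi> x)) = complex_of_real A"
      proof -
        have "(LINT x|M. F x * ?\<phi> (\<Phi> x)) = (LINT c|lborel. G c * ?F c)"
          by (rule fourier_multiplication[OF M \<Phi> F G])
        also have "\<dots> = (LINT c|lborel. complex_of_real (gauss s c * (cmod (?F c))\<^sup>2))"
          by (intro Bochner_Integration.integral_cong refl)
            (simp add: G_def scaleR_conv_of_real complex_norm_square mult.commute[of "cnj _"] del: of_real_power)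
        finally show ?thesis by (simp only: A_def integral_complex_of_real)
      qed
      \<comment> \<open>\<open>?\<phi>\<close> need not have compact support in \<open>Y\<close>; cut-offs repair this in the limit, as \<open>F\<close> vanishes where \<open>\<Phi>\<close> leaves \<open>Y\<close>.\<close>
      obtain k :: "nat \<Rightarrow> 'c \<Rightarrow> real" and C where
        k: "\<And>j. continuous_on UNIV (k j)" "\<And>j y. 0 \<le> k j y" "\<And>j y. k j y \<le> 1"
        "\<And>j. compact (C j)" "\<And>j. C j \<subseteq> Y" "\<And>j y. y \<notin> C j \<Longrightarrow> k j y = 0"
        "\<And>y. y \<in> Y \<Longrightarrow> (\<lambda>j. k j y) \<longlonglongrightarrow> 1"
        using compact_cutoffs[OF Y] by blast
      have [measurable]: "k j \<in> borel_measurable borel" for j by (rule borel_measurable_continuous_onI[OF k(1)])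
      have step: "cmod (LINT x|M. F x * (k j (\<Phi> x) *\<^sub>R ?\<phi> (\<Phi> x))) \<le> B * sqrt A" for j
      proof -
        have ct: "compact_test Y (\<lambda>u. k j u *\<^sub>R ?\<phi> u)"
          unfolding compact_test_def
        proof (intro conjI exI[of _ "C j"] allI impI)
          show "continuous_on UNIV (\<lambda>u. k j u *\<^sub>R ?\<phi> u)"
            by (intro continuous_intros k(1) c\<phi>)
        qed (use k(4,5,6) in auto)
        then have "cmod (LINT x|M. F x * (k j (\<Phi> x) *\<^sub>R ?\<phi> (\<Phi> x))) \<le> B * sqrt (LINT u|lborel. (cmod (k j u *\<^sub>R ?\<phi> u))\<^sup>2)"
          using R by blast
        also have "(LINT u|lborel. (cmod (k j u *\<^sub>R ?\<phi> u))\<^sup>2) \<le> (LINT u|lborel. (cmod (?\<phi> u))\<^sup>2)"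
        proof (rule integral_mono[OF compact_test_integrable(3)[OF ct] i\<phi>])
          fix u show "(cmod (k j u *\<^sub>R ?\<phi> u))\<^sup>2 \<le> (cmod (?\<phi> u))\<^sup>2"
            using k(2,3)[of j u] by (auto intro!: power_mono simp: mult_left_le_one_le)
        qed
        also note I\<phi>
        finally show ?thesis using B by (simp add: mult_left_mono)
      qed
      have "(\<lambda>j. LINT x|M. F x * (k j (\<Phi> x) *\<^sub>R ?\<phi> (\<Phi> x))) \<longlonglongrightarrow> (LINT x|M. F x * ?\<phi> (\<Phi> x))"
      proof (rule integral_dominated_convergence[where w = "\<lambda>x. cmod (F x) * (LINT c|lborel. cmod (G c))"])
        show "AE x in M. (\<lambda>j. F x * (k j (\<Phi> x) *\<^sub>R ?\<phi> (\<Phi> x))) \<longlonglongrightarrow> F x * ?\<phi> (\<Phi> x)"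
        proof (rule AE_I2)
          fix x assume x: "x \<in> space M"
          show "(\<lambda>j. F x * (k j (\<Phi> x) *\<^sub>R ?\<phi> (\<Phi> x))) \<longlonglongrightarrow> F x * ?\<phi> (\<Phi> x)"
          proof (cases "\<Phi> x \<in> Y")
            case True
            have "(\<lambda>j. F x * (k j (\<Phi> x) *\<^sub>R ?\<phi> (\<Phi> x))) \<longlonglongrightarrow> F x * (1 *\<^sub>R ?\<phi> (\<Phi> x))"
              by (intro tendsto_intros k(7) True)
            then show ?thesis by simp
          qed (use F0[OF x] in simp)
        qed
        show "AE x in M. norm (F x * (k j (\<Phi> x) *\<^sub>R ?\<phi> (\<Phi> x))) \<le> cmod (F x) * (LINT c|lborel. cmod (G c))" for j
        proof (rule AE_I2)
          fix x
          have "k j (\<Phi> x) * cmod (?\<phi> (\<Phi> x)) \<le> 1 * (LINT c|lborel. cmod (G c))"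
            using k(2,3)[of j "\<Phi> x"] b\<phi> by (intro mult_mono) auto
          from mult_left_mono[OF this norm_ge_zero[of "F x"]]
          show "norm (F x * (k j (\<Phi> x) *\<^sub>R ?\<phi> (\<Phi> x))) \<le> cmod (F x) * (LINT c|lborel. cmod (G c))"
            using k(2)[of j "\<Phi> x"] by (simp add: norm_mult mult.left_commute[of "cmod (F x)"])
        qed
      qed (use F in auto)
      then have "cmod (complex_of_real A) \<le> B * sqrt A"
        unfolding dual using step by (intro LIMSEQ_le_const2[OF tendsto_norm]) blast+
      then have le: "sqrt A * sqrt A \<le> B * sqrt A" using A0 by simp
      show "A \<le> B\<^sup>2"
      proof (cases "A = 0")
        case False
        then have "sqrt A > 0" using A0 by simp
        with le have "sqrt A \<le> B" by (rule mult_right_le_imp_le)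
        then show ?thesis using A0 by (metis power_mono real_sqrt_ge_zero real_sqrt_pow2)
      qed simp
    qed
  next
    assume L: ?lhs
    have iF2: "integrable lborel (\<lambda>c. (cmod (?F c))\<^sup>2)"
      using L by (intro integrableI_bounded) (auto simp: le_less_trans[OF _ ennreal_less_top])
    have IF2: "(LINT c|lborel. (cmod (?F c))\<^sup>2) \<le> B\<^sup>2"
      using L B by (subst (asm) nn_integral_eq_integral[OF iF2]) auto
    show ?rhs
    proof (intro allI impI)
      fix \<phi> assume test: "compact_test Y \<phi>"
      note \<phi> = compact_test_integrable[OF test]
      note [measurable] = \<phi>(1)
      obtain Q where Q: "\<And>y. cmod (\<phi> y) \<le> Q" using \<phi>(4) by blast
      have cont: "continuous_on UNIV \<phi>" using test by (simp add: compact_test_def)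
      let ?s = "\<lambda>n. 1 / real (Suc n)"
      let ?p = "fourier lborel (\<lambda>z. z) (\<lambda>z. cnj (\<phi> z))"
      define G where "G = (\<lambda>n c. gauss (?s n) c *\<^sub>R cnj (?p c))"
      define A where "A = sqrt (LINT y|lborel. (cmod (\<phi> y))\<^sup>2)"
      have A: "A \<ge> 0" "A\<^sup>2 = (LINT y|lborel. (cmod (\<phi> y))\<^sup>2)" by (simp_all add: A_def)
      have c1: "integrable lborel (\<lambda>z. cnj (\<phi> z))" using \<phi>(2) by (rule integrable_cnj)
      have [measurable]: "?p \<in> borel_measurable borel" by (rule borel_measurable_fourier) (use c1 in auto)
      have bp: "cmod (?p c) \<le> (LINT z|lborel. cmod (cnj (\<phi> z)))" for c by (rule fourier_bound) (use c1 in auto)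
      have iG: "integrable lborel (G n)" for n
        unfolding G_def by (rule integrable_gauss_bounded) (use bp in auto)
      have [measurable]: "G n \<in> borel_measurable borel" for n using iG by simp
      have ip: "integrable lborel (\<lambda>c. gauss (?s n) c * (cmod (?p c))\<^sup>2)" for n
      proof -
        have "norm ((cmod (?p c))\<^sup>2) \<le> (LINT z|lborel. cmod (cnj (\<phi> z)))\<^sup>2" for c
          using bp[of c] by (simp add: power_mono)
        from integrable_gauss_bounded[of "?s n" "\<lambda>c. (cmod (?p c))\<^sup>2", OF _ _ this] show ?thesis by simp
      qed
      have G2le: "(cmod (G n c))\<^sup>2 \<le> gauss (?s n) c * (cmod (?p c))\<^sup>2" for n c
      proof -
        have "(gauss (?s n) c)\<^sup>2 \<le> gauss (?s n) c"
          using gauss_le_1[of "?s n" c] by (simp add: power2_eq_square mult_left_le)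
        then show ?thesis by (simp add: G_def power_mult_distrib mult_right_mono)
      qed
      have iG2: "integrable lborel (\<lambda>c. (cmod (G n c))\<^sup>2)" for n
        by (rule Bochner_Integration.integrable_bound[OF ip[of n]]) (use G2le in \<open>auto intro!: AE_I2 simp: abs_mult\<close>)
      have IG2: "(LINT c|lborel. (cmod (G n c))\<^sup>2) \<le> A\<^sup>2" for n
      proof -
        have "(LINT c|lborel. (cmod (G n c))\<^sup>2) \<le> (LINT c|lborel. gauss (?s n) c * (cmod (?p c))\<^sup>2)"
          by (intro integral_mono iG2 ip G2le)
        also have "\<dots> \<le> (LINT z|lborel. (cmod (cnj (\<phi> z)))\<^sup>2)"
          by (rule fourier_gauss_L2_bound[OF c1]) (use \<phi>(3) in auto)
        finally show ?thesis by (simp add: A(2))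
      qed
      have moll: "fourier lborel (\<lambda>c. c) (G n) u = (LINT w|lborel. gauss 1 w *\<^sub>R \<phi> (u + ?s n *\<^sub>R w))" for n u
        unfolding G_def by (rule gauss_mollifier[OF \<phi>(2)]) simp
      have i1: "integrable lborel (\<lambda>w :: 'c. gauss 1 w * Q)"
        using gauss_fourier(1)[of 1, where 'a = 'c] by (intro integrable_mult_left) simp
      have I1: "(LINT w|lborel. gauss 1 (w :: 'c)) = 1"
        using integral_gauss[of 1, where 'a = 'c] by simp
      have mb: "cmod (fourier lborel (\<lambda>c. c) (G n) u) \<le> Q" for n u
      proof -
        have "cmod (fourier lborel (\<lambda>c. c) (G n) u) \<le> (LINT w|lborel. cmod (gauss 1 w *\<^sub>R \<phi> (u + ?s n *\<^sub>R w)))"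
          unfolding moll by (rule integral_norm_bound)
        also have "\<dots> \<le> (LINT w|lborel. gauss 1 (w :: 'c) * Q)"
          using Q by (intro integral_mono integrable_norm integrable_gauss_bounded i1) (auto intro!: mult_left_mono)
        also have "\<dots> = Q" using I1 by simp
        finally show ?thesis .
      qed
      have ml: "(\<lambda>n. fourier lborel (\<lambda>c. c) (G n) u) \<longlonglongrightarrow> \<phi> u" for u
      proof -
        have "(\<lambda>n. LINT w|lborel. gauss 1 w *\<^sub>R \<phi> (u + ?s n *\<^sub>R w)) \<longlonglongrightarrow> (LINT w|lborel. gauss 1 (w :: 'c) *\<^sub>R \<phi> u)"
        proof (rule integral_dominated_convergence[where w = "\<lambda>w. gauss 1 w * Q"])
          show "AE w in lborel. (\<lambda>n. gauss 1 w *\<^sub>R \<phi> (u + ?s n *\<^sub>R w)) \<longlonglongrightarrow> gauss 1 w *\<^sub>R \<phi> u"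
          proof (rule AE_I2)
            fix w :: 'c
            have "(\<lambda>n. u + ?s n *\<^sub>R w) \<longlonglongrightarrow> u + 0 *\<^sub>R w"
              by (intro tendsto_intros LIMSEQ_Suc[OF lim_1_over_n])
            then have "(\<lambda>n. \<phi> (u + ?s n *\<^sub>R w)) \<longlonglongrightarrow> \<phi> (u + 0 *\<^sub>R w)"
              using cont by (intro continuous_on_tendsto_compose[OF cont]) auto
            then show "(\<lambda>n. gauss 1 w *\<^sub>R \<phi> (u + ?s n *\<^sub>R w)) \<longlonglongrightarrow> gauss 1 w *\<^sub>R \<phi> u"
              by (intro tendsto_intros) simp
          qed
        qed (use Q i1 in \<open>auto intro!: mult_left_mono\<close>)
        then show ?thesis
          unfolding moll using I1 by (simp add: integral_scaleR_left gauss_fourier(1))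
      qed
      have bound: "cmod (LINT x|M. F x * fourier lborel (\<lambda>c. c) (G n) (\<Phi> x)) \<le> A * B" for n
        unfolding fourier_multiplication[OF M \<Phi> F iG]
        by (rule cauchy_schwarz_integral(2)) (use iG2 IG2 iF2 IF2 A B in auto)
      have "(\<lambda>n. LINT x|M. F x * fourier lborel (\<lambda>c. c) (G n) (\<Phi> x)) \<longlonglongrightarrow> (LINT x|M. F x * \<phi> (\<Phi> x))"
      proof (rule integral_dominated_convergence[where w = "\<lambda>x. cmod (F x) * Q"])
        have [measurable]: "fourier lborel (\<lambda>c. c) (G n) \<in> borel_measurable borel" for n
          by (rule borel_measurable_fourier) (use iG in auto)
        show "(\<lambda>x. F x * fourier lborel (\<lambda>c. c) (G n) (\<Phi> x)) \<in> borel_measurable M" for n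
          by measurable
        show "AE x in M. (\<lambda>n. F x * fourier lborel (\<lambda>c. c) (G n) (\<Phi> x)) \<longlonglongrightarrow> F x * \<phi> (\<Phi> x)"
          by (intro AE_I2 tendsto_intros ml)
      qed (use F mb in \<open>auto simp: norm_mult intro!: mult_left_mono\<close>)
      then have "cmod (LINT x|M. F x * \<phi> (\<Phi> x)) \<le> A * B"
        using bound by (intro LIMSEQ_le_const2[OF tendsto_norm]) blast+
      then show "cmod (LINT x|M. F x * \<phi> (\<Phi> x)) \<le> B * sqrt (LINT y|lborel. (cmod (\<phi> y))\<^sup>2)"
        by (simp add: A_def mult.commute)
    qed
  qed
qed

text \<open>Both \<open>T\<close> and the complement of the compact set \<open>k ` K\<close> are open, they cover the space, and
  the extension by 0 is continuous on each of them.\<close>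

lemma compact_test_pullback:
  fixes T T' :: "'c::euclidean_space set"
  assumes T: "open T" and g: "continuous_on T g" "\<And>y. y \<in> T \<Longrightarrow> g y \<in> T'" "\<And>y. y \<in> T \<Longrightarrow> k (g y) = y"
    and k: "continuous_on T' k" "\<And>y. y \<in> T' \<Longrightarrow> k y \<in> T"
    and m: "continuous_on T m" and \<phi>: "compact_test T' \<phi>"
  shows "compact_test T (\<lambda>y. if y \<in> T then complex_of_real (m y) * \<phi> (g y) else 0)"
    (is "compact_test T ?\<psi>")
proof -
  obtain K where K: "compact K" "K \<subseteq> T'" "\<And>y. y \<notin> K \<Longrightarrow> \<phi> y = 0" and c: "continuous_on UNIV \<phi>"
    using \<phi> unfolding compact_test_def by blast
  have kK: "compact (k ` K)" by (intro compact_continuous_image continuous_on_subset[OF k(1)] K)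
  have sub: "k ` K \<subseteq> T" using K(2) k(2) by blast
  have zero: "?\<psi> y = 0" if "y \<notin> k ` K" for y
    using that g(3) K(3) by (metis imageI mult_zero_right)
  have "continuous_on T (\<lambda>y. complex_of_real (m y) * \<phi> (g y))"
    by (intro continuous_intros m continuous_on_compose2[OF c g(1)]) simp
  then have cT: "continuous_on T ?\<psi>" by (rule continuous_on_eq) simp
  have "continuous_on (- (k ` K)) ?\<psi>"
    by (rule continuous_on_eq[OF continuous_on_const[of _ 0]]) (simp add: zero)
  then have "continuous_on (T \<union> - (k ` K)) ?\<psi>"
    using T cT kK by (intro continuous_on_open_Un) (auto simp: compact_imp_closed open_Compl)
  moreover have "T \<union> - (k ` K) = UNIV" using sub by blast
  ultimately show ?thesis
    unfolding compact_test_def using kK sub zero by metis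
qed

section \<open>Matrices and block matrices\<close>

lemma matrix_inv_cancel:
  assumes "invertible (h :: real^'d^'d)"
  shows "h ** matrix_inv h = mat 1" "matrix_inv h ** h = mat 1"
    "h *v (matrix_inv h *v x) = x" "matrix_inv h *v (h *v x) = x"
proof -
  show 1: "h ** matrix_inv h = mat 1" and 2: "matrix_inv h ** h = mat 1"
    using someI_ex[OF assms[unfolded invertible_def]] unfolding matrix_inv_def by auto
  show "h *v (matrix_inv h *v x) = x" "matrix_inv h *v (h *v x) = x"
    using 1 2 by (simp_all add: matrix_vector_mul_assoc)
qed

lemma matrix_inv_unique:
  assumes "A ** B = mat 1" "B ** A = mat (1::real)"
  shows "matrix_inv A = (B :: real^'d^'d)"
proof -
  have "invertible A" using assms unfolding invertible_def by blast
  have "matrix_inv A = matrix_inv A ** (A ** B)"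
    by (simp add: assms(1))
  also have "\<dots> = (matrix_inv A ** A) ** B"
    by (simp only: matrix_mul_assoc)
  also have "\<dots> = B"
    by (simp add: matrix_inv_cancel(2)[OF \<open>invertible A\<close>])
  finally show ?thesis .
qed

lemma matrix_inv_inv:
  assumes "invertible (h :: real^'d^'d)"
  shows "matrix_inv (matrix_inv h) = h"
  by (rule matrix_inv_unique) (simp_all add: matrix_inv_cancel assms)

text \<open>The derivative of a linear map is the map itself, hence constant as a function of the base point.\<close>

lemma smooth_on_matrix:
  fixes A :: "real^'n^'m"
  shows "smooth_on S (\<lambda>x. A *v x)"
proof -
  have lin: "((\<lambda>x. A *v x) has_derivative (\<lambda>x. A *v x)) (at x)" for x
    by (rule linear_imp_has_derivative) simp
  have const: "Ck_on k S (\<lambda>x. c)" for k and c :: "real^'m"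
    by (induction k arbitrary: c) auto
  have "Ck_on k S (\<lambda>x. A *v x)" for k
  proof (cases k)
    case 0 then show ?thesis by (simp add: matrix_vector_mult_linear_continuous_on)
  next
    case (Suc m)
    have "frechet_derivative (\<lambda>x. A *v x) (at x) = (\<lambda>x. A *v x)" for x
      using frechet_derivative_at[OF lin] by metis
    moreover have "(\<lambda>x. A *v x) differentiable (at x)" for x
      using lin by (rule differentiableI)
    ultimately show ?thesis
      using const by (simp add: Suc)
  qed
  then show ?thesis by (simp add: smooth_on_def)
qed

lemma diffeomorphism_matrix:
  assumes "invertible (h :: real^'d^'d)"
  shows "diffeomorphism UNIV UNIV (\<lambda>x. h *v x)"
proof -
  note inv = matrix_inv_cancel[OF assms]
  have bij: "bij (\<lambda>x. h *v x)"
    by (rule bij_betw_byWitness[where f' = "\<lambda>x. matrix_inv h *v x"]) (use inv in auto)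
  have "inv_into UNIV (\<lambda>x. h *v x) = (\<lambda>x. matrix_inv h *v x)"
    by (rule inv_equality) (use inv in auto)
  then show ?thesis
    unfolding diffeomorphism_def using bij smooth_on_matrix by auto
qed

lemma linear_dagger: "linear (dagger h)"
  unfolding dagger_def
  by (rule linearI)
    (simp_all add: vec_eq_iff matrix_matrix_mult_def sum_distrib_left sum_distrib_right sum.distrib[symmetric] algebra_simps)

lemma linear_quadratic_form: "linear (\<lambda>\<sigma> :: real^'m^'m. (\<sigma> *v x) \<bullet> x)"
  by (rule linearI) (simp_all add: matrix_vector_mult_add_rdistrib inner_add_left scaleR_matrix_vector_assoc[symmetric])

lemma borel_measurable_vec_nth [measurable (raw)]:
  assumes "f \<in> borel_measurable M"
  shows "(\<lambda>x. f x $ i) \<in> borel_measurable M"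
  by (rule measurable_compose[OF assms]) (intro borel_measurable_continuous_onI continuous_intros)

lemma borel_measurable_matrix_vector_mult [measurable (raw)]:
  fixes A :: "'a \<Rightarrow> real^'n^'m" and v :: "'a \<Rightarrow> real^'n"
  assumes "A \<in> borel_measurable M" "v \<in> borel_measurable M"
  shows "(\<lambda>x. A x *v v x) \<in> borel_measurable M"
  using assms
  by (rule borel_measurable_continuous_Pair)
    (auto simp: matrix_vector_mult_def intro!: continuous_intros continuous_on_vec_lambda)

lemma borel_measurable_det [measurable (raw)]:
  fixes A :: "'a \<Rightarrow> real^'n^'n"
  assumes "A \<in> borel_measurable M"
  shows "(\<lambda>x. det (A x)) \<in> borel_measurable M"
  by (rule measurable_compose[OF assms])
    (auto simp: det_def intro!: borel_measurable_continuous_onI continuous_intros)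

lemma block_sp_block:
  assumes "invertible (h :: real^'d^'d)"
  shows "block_h (sp_block \<sigma> h) = h" "block_sigma (sp_block \<sigma> h) = \<sigma>"
proof -
  show 1: "block_h (sp_block \<sigma> h) = h"
    by (simp add: block_h_def sp_block_def vec_eq_iff)
  have "(\<chi> a b. sp_block \<sigma> h $ Inr a $ Inl b) = \<sigma> ** h"
    by (simp add: sp_block_def vec_eq_iff)
  then show "block_sigma (sp_block \<sigma> h) = \<sigma>"
    unfolding block_sigma_def 1 by (simp add: matrix_mul_assoc[symmetric] matrix_inv_cancel[OF assms])
qed

lemma metaplectic_sp_block:
  assumes "invertible h"
  shows "metaplectic (sp_block \<sigma> h) f x = complex_of_real (beta_mod h powr (- (1/2))) *
    iexp (pi * ((\<sigma> *v x) \<bullet> x)) * f (matrix_inv h *v x)"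
  by (simp only: metaplectic_def Let_def block_sp_block[OF assms])

section \<open>Linear algebra of a data set\<close>

locale symplectic_data =
  fixes D :: "('d::finite, 'n::finite, 'e::euclidean_space) data_rec"
  assumes data_set: "data_set D"
begin

abbreviation "H \<equiv> H_of D"
abbreviation "X \<equiv> dom_X D"

lemma class_E: "class_E (Sig D) (H_top D) (H_atlas D)" using data_set unfolding data_set_def by blast
lemma lie: "lie_subgroup (H_top D) (H_atlas D)" using class_E unfolding class_E_def by blast
lemma haar: "left_haar_measure (H_top D) (H_haar D)" using data_set unfolding data_set_def by blast

lemma H_invertible: "h \<in> H \<Longrightarrow> invertible h" using lie unfolding lie_subgroup_def by blast
lemma H_inv: "h \<in> H \<Longrightarrow> matrix_inv h \<in> H" using lie unfolding lie_subgroup_def by blast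
lemmas H_cancel = matrix_inv_cancel[OF H_invertible]

lemma open_X: "open X" and null_X: "negligible (- X)" and X_inv: "h \<in> H \<Longrightarrow> x \<in> X \<Longrightarrow> h *v x \<in> X"
  using data_set unfolding data_set_def by blast+

text \<open>Negligibility is a statement about Lebesgue measure; on the Borel set \<open>- X\<close> it passes to \<open>lborel\<close>.\<close>

lemma AE_X: "AE x in lborel. x \<in> X"
proof -
  have "- X \<in> null_sets lebesgue" using null_X by (simp add: negligible_iff_null_sets)
  moreover have "- X \<in> sets lborel"
    using open_X by (simp add: borel_closed closed_Compl)
  ultimately have "- X \<in> null_sets lborel"
    using null_sets_completion_iff by blast
  then have "AE x in lborel. x \<notin> - X" by (rule AE_not_in)
  then show ?thesis by simp
qed

lemma basis_facts: "inj (basis D)" "independent (range (basis D))" "span (range (basis D)) = Sig D"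
  using data_set unfolding data_set_def by blast+

lemma basis_in: "basis D i \<in> Sig D"
  using span_base[of "basis D i" "range (basis D)"] unfolding basis_facts(3) by simp

lemma dagger_in: "h \<in> H \<Longrightarrow> \<sigma> \<in> Sig D \<Longrightarrow> dagger h \<sigma> \<in> Sig D"
  using class_E unfolding class_E_def by blast

lemma basis_unique:
  assumes "(\<Sum>i\<in>UNIV. a i *\<^sub>R basis D i) = (\<Sum>i\<in>UNIV. b i *\<^sub>R basis D i)"
  shows "a i = b i"
proof -
  define u where "u = (\<lambda>v. a (inv (basis D) v) - b (inv (basis D) v))"
  have "(\<Sum>v\<in>range (basis D). u v *\<^sub>R v) = (\<Sum>i\<in>UNIV. (a i - b i) *\<^sub>R basis D i)"
    using basis_facts(1) by (simp add: sum.reindex u_def)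
  also have "\<dots> = 0"
    using assms by (simp add: scaleR_left_diff_distrib sum_subtractf)
  finally have "u (basis D i) = 0"
    using basis_facts(2) by (intro independentD[of "range (basis D)" "range (basis D)"]) auto
  then show ?thesis using basis_facts(1) by (simp add: u_def)
qed

lemma basis_expand:
  assumes "\<sigma> \<in> Sig D"
  shows "\<sigma> = (\<Sum>i\<in>UNIV. representation (range (basis D)) \<sigma> (basis D i) *\<^sub>R basis D i)"
proof -
  have "(\<Sum>v\<in>range (basis D). representation (range (basis D)) \<sigma> v *\<^sub>R v) = \<sigma>"
    using basis_facts assms by (intro real_vector.sum_representation_eq) auto
  then show ?thesis
    using basis_facts(1) by (simp add: sum.reindex)
qed

lemma dagger_basis:
  assumes "h \<in> H"
  shows "dagger h (basis D j) = (\<Sum>i\<in>UNIV. M_mat D h $ i $ j *\<^sub>R basis D i)"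
  using basis_expand[OF dagger_in[OF assms basis_in[of j]]] by (simp add: M_mat_def)

lemma dagger_inverse:
  assumes "h \<in> H"
  shows "dagger (matrix_inv h) \<sigma> = transpose h ** \<sigma> ** h" "dagger (matrix_inv h) (dagger h \<sigma>) = \<sigma>"
proof -
  show 1: "dagger (matrix_inv h) \<sigma> = transpose h ** \<sigma> ** h" for \<sigma>
    by (simp add: dagger_def matrix_inv_inv H_invertible assms)
  have "transpose h ** transpose (matrix_inv h) = mat 1"
    by (simp add: matrix_transpose_mul[symmetric] H_cancel assms)
  then show "dagger (matrix_inv h) (dagger h \<sigma>) = \<sigma>"
    unfolding 1 unfolding dagger_def using H_cancel(2)[OF assms]
    by (metis matrix_mul_assoc matrix_mul_lid matrix_mul_rid)
qed

text \<open>\<open>M_mat D h\<close> is the matrix of \<open>dagger h\<close> on \<open>Sig D\<close>, so this compares coordinates in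
  \<open>dagger (matrix_inv h) (dagger h \<sigma>) = \<sigma>\<close>.\<close>

lemma M_mat_inverse:
  assumes h: "h \<in> H"
  shows "M_mat D (matrix_inv h) ** M_mat D h = mat 1"
proof -
  have "(M_mat D (matrix_inv h) ** M_mat D h) $ i $ j = (if i = j then 1 else 0)" for i j
  proof (rule basis_unique[of "\<lambda>i. (M_mat D (matrix_inv h) ** M_mat D h) $ i $ j" "\<lambda>i. if i = j then 1 else 0"])
    have "basis D j = dagger (matrix_inv h) (dagger h (basis D j))"
      by (simp add: dagger_inverse(2) h)
    also have "\<dots> = (\<Sum>k\<in>UNIV. M_mat D h $ k $ j *\<^sub>R dagger (matrix_inv h) (basis D k))"
      by (simp add: dagger_basis[OF h] linear_sum[OF linear_dagger] linear_scale[OF linear_dagger])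
    also have "\<dots> = (\<Sum>k\<in>UNIV. \<Sum>i\<in>UNIV. (M_mat D (matrix_inv h) $ i $ k * M_mat D h $ k $ j) *\<^sub>R basis D i)"
      by (simp add: dagger_basis[OF H_inv[OF h]] scaleR_sum_right mult.commute)
    also have "\<dots> = (\<Sum>i\<in>UNIV. \<Sum>k\<in>UNIV. (M_mat D (matrix_inv h) $ i $ k * M_mat D h $ k $ j) *\<^sub>R basis D i)"
      by (rule sum.swap)
    also have "\<dots> = (\<Sum>i\<in>UNIV. (M_mat D (matrix_inv h) ** M_mat D h) $ i $ j *\<^sub>R basis D i)"
      by (simp add: matrix_matrix_mult_def scaleR_sum_left)
    finally show "(\<Sum>i\<in>UNIV. (M_mat D (matrix_inv h) ** M_mat D h) $ i $ j *\<^sub>R basis D i)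
      = (\<Sum>i\<in>UNIV. (if i = j then 1 else 0) *\<^sub>R basis D i)"
      by (simp add: if_distrib[of "\<lambda>c. c *\<^sub>R _"] cong: if_cong)
  qed
  then show ?thesis by (simp add: vec_eq_iff mat_def)
qed

lemma chi_mod_inverse:
  assumes "h \<in> H"
  shows "chi_mod D (matrix_inv h) * chi_mod D h = 1" "chi_mod D h > 0"
proof -
  show "chi_mod D (matrix_inv h) * chi_mod D h = 1"
    using M_mat_inverse[OF assms] unfolding chi_mod_def abs_mult[symmetric]
    by (metis abs_one det_I det_mul)
  then show "chi_mod D h > 0"
    unfolding chi_mod_def by (metis abs_ge_zero less_eq_real_def mult_zero_right zero_neq_one)
qed

lemma beta_mod_pos: "h \<in> H \<Longrightarrow> beta_mod h > 0"
  using H_invertible by (auto simp: beta_mod_def invertible_det_nz)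

text \<open>The rule \<open>\<Phi>(h x) = h[\<Phi>(x)]\<close>, with the matrix of the action in the form whose determinant is at hand:
  \<open>\<langle>\<sigma> h x, h x\<rangle> = \<langle>(h\<^sup>T \<sigma> h) x, x\<rangle>\<close>, and \<open>h\<^sup>T \<sigma> h\<close> is the action of the inverse of \<open>h\<close> on \<open>\<sigma>\<close>.\<close>

lemma Phi_equivariant:
  assumes h: "h \<in> H"
  shows "Phi D (h *v x) = transpose (M_mat D (matrix_inv h)) *v Phi D x"
proof -
  have "(basis D i *v (h *v x)) \<bullet> (h *v x) = (\<Sum>j\<in>UNIV. M_mat D (matrix_inv h) $ j $ i * ((basis D j *v x) \<bullet> x))" for i
  proof -
    have "(basis D i *v (h *v x)) \<bullet> (h *v x) = (dagger (matrix_inv h) (basis D i) *v x) \<bullet> x"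
      unfolding dagger_inverse(1)[OF h]
      by (metis dot_lmul_matrix inner_commute matrix_vector_mul_assoc vector_transpose_matrix transpose_transpose)
    also have "\<dots> = (\<Sum>j\<in>UNIV. M_mat D (matrix_inv h) $ j $ i * ((basis D j *v x) \<bullet> x))"
      unfolding dagger_basis[OF H_inv[OF h]]
      by (simp add: linear_sum[OF linear_quadratic_form] linear_scale[OF linear_quadratic_form])
    finally show ?thesis .
  qed
  note q = this
  show ?thesis
    unfolding vec_eq_iff Phi_def vec_lambda_beta q
    by (simp add: matrix_vector_mult_def transpose_def sum_negf sum_divide_distrib mult.commute)
qed

end

section \<open>Haar measure of the groups\<close>

context symplectic_data begin

lemma manifold: "smooth_manifold (H_top D) (H_atlas D)"
  using lie unfolding lie_subgroup_def by blast

lemma chart: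
  assumes "(U, \<phi>) \<in> H_atlas D"
  shows "openin (H_top D) U" "open (\<phi> ` U)" "homeomorphic_map (subtopology (H_top D) U) (top_of_set (\<phi> ` U)) \<phi>"
    "continuous_on (\<phi> ` U) (inv_into U \<phi>)"
proof -
  have "\<forall>(U, \<phi>)\<in>H_atlas D. openin (H_top D) U \<and> open (\<phi> ` U) \<and>
        homeomorphic_map (subtopology (H_top D) U) (top_of_set (\<phi> ` U)) \<phi>"
    using manifold unfolding smooth_manifold_def by (elim conjE)
  from bspec[OF this assms]
  show "openin (H_top D) U" "open (\<phi> ` U)" "homeomorphic_map (subtopology (H_top D) U) (top_of_set (\<phi> ` U)) \<phi>"
    by simp_all
  have "\<forall>(U, \<phi>)\<in>H_atlas D. smooth_on (\<phi> ` U) (inv_into U \<phi>) \<and>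
        (\<forall>z\<in>\<phi> ` U. inj (frechet_derivative (inv_into U \<phi>) (at z)))"
    using lie unfolding lie_subgroup_def by (elim conjE)
  from bspec[OF this assms] show "continuous_on (\<phi> ` U) (inv_into U \<phi>)"
    by (simp add: smooth_on_continuous)
qed

lemma chart_cover:
  assumes "h \<in> H"
  obtains U \<phi> where "(U, \<phi>) \<in> H_atlas D" "h \<in> U"
proof -
  have "\<Union> (fst ` H_atlas D) = H" using manifold unfolding smooth_manifold_def by blast
  with assms obtain p where "p \<in> H_atlas D" "h \<in> fst p" by blast
  then show thesis using that[of "fst p" "snd p"] by simp
qed

text \<open>The topology of an immersed Lie subgroup is at least as fine as the Euclidean one, because the
  inverses of the charts are continuous maps into the space of matrices. Hence Borel functions of
  matrices are measurable for Haar measure.\<close>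

lemma continuous_inclusion: "continuous_map (H_top D) euclidean (\<lambda>h. h)"
proof -
  have "openin (H_top D) (H \<inter> V)" if V: "open V" for V
  proof (subst openin_subopen, intro ballI)
    fix h assume h: "h \<in> H \<inter> V"
    then obtain U \<phi> where c: "(U, \<phi>) \<in> H_atlas D" "h \<in> U" using chart_cover by blast
    note ch = chart[OF c(1)]
    have UH: "U \<subseteq> H" using openin_subset[OF ch(1)] .
    then have top: "topspace (subtopology (H_top D) U) = U" by auto
    have inj: "inj_on \<phi> U"
      using homeomorphic_imp_injective_map[OF ch(3)] unfolding top .
    from ch(4) have W: "openin (top_of_set (\<phi> ` U)) (\<phi> ` U \<inter> inv_into U \<phi> -` V)"
      using V by (rule continuous_openin_preimage_gen)
    have "openin (subtopology (H_top D) U) {u \<in> topspace (subtopology (H_top D) U). \<phi> u \<in> \<phi> ` U \<inter> inv_into U \<phi> -` V}"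
      by (rule openin_continuous_map_preimage[OF homeomorphic_imp_continuous_map[OF ch(3)] W])
    also have "{u \<in> topspace (subtopology (H_top D) U). \<phi> u \<in> \<phi> ` U \<inter> inv_into U \<phi> -` V} = U \<inter> V"
    proof (rule set_eqI)
      fix u
      have "u \<in> U \<Longrightarrow> inv_into U \<phi> (\<phi> u) = u" by (rule inv_into_f_f[OF inj])
      then show "u \<in> {u \<in> topspace (subtopology (H_top D) U). \<phi> u \<in> \<phi> ` U \<inter> inv_into U \<phi> -` V} \<longleftrightarrow> u \<in> U \<inter> V"
        unfolding top by (cases "u \<in> U") simp_all
    qed
    finally have "openin (H_top D) (U \<inter> V)"
      using ch(1) openin_open_subtopology by blast
    then show "\<exists>T. openin (H_top D) T \<and> h \<in> T \<and> T \<subseteq> H \<inter> V"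
      using c(2) h UH by blast
  qed
  then show ?thesis
    by (simp add: continuous_map_def Int_def)
qed

lemma space_haar: "space (H_haar D) = H"
  and sets_haar: "sets (H_haar D) = sigma_sets H {U. openin (H_top D) U}"
  using haar unfolding left_haar_measure_def by blast+

lemma open_sets_haar: "openin (H_top D) U \<Longrightarrow> U \<in> sets (H_haar D)"
  unfolding sets_haar by (rule sigma_sets.Basic) simp

lemma measurable_continuous_map:
  fixes f :: "_ \<Rightarrow> 'z::topological_space"
  assumes "continuous_map (H_top D) euclidean f"
  shows "f \<in> borel_measurable (H_haar D)"
proof (rule borel_measurableI)
  fix V :: "'z set" assume V: "open V"
  then have "openin (H_top D) {h \<in> H. f h \<in> V}"
    using assms V unfolding continuous_map_def by simp
  then show "f -` V \<inter> space (H_haar D) \<in> sets (H_haar D)"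
    using open_sets_haar by (simp add: space_haar vimage_def Int_def conj_commute)
qed

lemma measurable_inclusion [measurable]: "(\<lambda>h. h) \<in> borel_measurable (H_haar D)"
  by (rule measurable_continuous_map[OF continuous_inclusion])

lemma measurable_matrix_inv [measurable]: "matrix_inv \<in> borel_measurable (H_haar D)"
proof -
  have "continuous_map (H_top D) (H_top D) matrix_inv"
    using lie unfolding lie_subgroup_def smooth_map_def by blast
  from continuous_map_compose[OF this continuous_inclusion] show ?thesis
    by (intro measurable_continuous_map) (simp add: o_def)
qed

text \<open>A closed ball inside the image of a chart pulls back to a compact set.\<close>

lemma chart_neighbourhood:
  assumes "h \<in> H"
  shows "\<exists>V K. openin (H_top D) V \<and> h \<in> V \<and> V \<subseteq> K \<and> compactin (H_top D) K"
proof -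
  obtain U \<phi> where c: "(U, \<phi>) \<in> H_atlas D" "h \<in> U" using chart_cover[OF assms] by blast
  note ch = chart[OF c(1)]
  have UH: "U \<subseteq> H" using openin_subset[OF ch(1)] .
  then have top: "topspace (subtopology (H_top D) U) = U" by auto
  obtain g where g: "homeomorphic_maps (subtopology (H_top D) U) (top_of_set (\<phi> ` U)) \<phi> g"
    using ch(3) homeomorphic_map_maps by blast
  obtain r where r: "r > 0" "cball (\<phi> h) r \<subseteq> \<phi> ` U"
    using ch(2) c(2) open_contains_cball by blast
  define V where "V = {u \<in> U. \<phi> u \<in> ball (\<phi> h) r}"
  define K where "K = g ` cball (\<phi> h) r"
  have "openin (top_of_set (\<phi> ` U)) (\<phi> ` U \<inter> ball (\<phi> h) r)" by (simp add: openin_open_Int)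
  with homeomorphic_imp_continuous_map[OF ch(3)]
  have "openin (subtopology (H_top D) U) {u \<in> topspace (subtopology (H_top D) U). \<phi> u \<in> \<phi> ` U \<inter> ball (\<phi> h) r}"
    by (rule openin_continuous_map_preimage)
  also have "{u \<in> topspace (subtopology (H_top D) U). \<phi> u \<in> \<phi> ` U \<inter> ball (\<phi> h) r} = V"
    unfolding top V_def by auto
  finally have "openin (H_top D) V"
    using ch(1) openin_open_subtopology by blast
  moreover have "h \<in> V" using r c(2) by (simp add: V_def)
  moreover have "V \<subseteq> K"
  proof
    fix u assume u: "u \<in> V"
    then have "g (\<phi> u) = u" using g UH unfolding homeomorphic_maps_def V_def by auto
    moreover have "\<phi> u \<in> cball (\<phi> h) r" using u by (simp add: V_def)
    ultimately show "u \<in> K" unfolding K_def by (metis imageI)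
  qed
  moreover have "compactin (H_top D) K"
  proof -
    have "continuous_map (top_of_set (\<phi> ` U)) (subtopology (H_top D) U) g"
      using g unfolding homeomorphic_maps_def by blast
    moreover have "compactin (top_of_set (\<phi> ` U)) (cball (\<phi> h) r)"
      using r by (simp add: compactin_subtopology)
    ultimately have "compactin (subtopology (H_top D) U) K"
      unfolding K_def by (metis image_compactin)
    then show ?thesis by (simp add: compactin_subtopology)
  qed
  ultimately show ?thesis by blast
qed

text \<open>Every point has an open neighbourhood inside a compact set, which has finite measure; by second
  countability, countably many of these neighbourhoods cover the group. This makes Tonelli applicable to
  \<open>haar_G D\<close>.\<close>

lemma sigma_finite_haar: "sigma_finite_measure (H_haar D)"
proof
  have Haus: "Hausdorff_space (H_top D)" and sc: "second_countable (H_top D)"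
    using manifold unfolding smooth_manifold_def by blast+
  have fin: "emeasure (H_haar D) K < \<infinity>" if "compactin (H_top D) K" for K
    using haar that unfolding left_haar_measure_def by blast
  define \<V> where "\<V> = {V. openin (H_top D) V \<and> (\<exists>K. V \<subseteq> K \<and> compactin (H_top D) K)}"
  have "\<Union>\<V> = H"
    using chart_neighbourhood unfolding \<V>_def by (auto dest: openin_subset) blast
  then obtain \<W> where W: "countable \<W>" "\<W> \<subseteq> \<V>" "\<Union>\<W> = H"
    using second_countable_imp_Lindelof_space[OF sc] unfolding Lindelof_space_def \<V>_def by (metis (no_types, lifting) mem_Collect_eq)
  show "\<exists>A. countable A \<and> A \<subseteq> sets (H_haar D) \<and> \<Union> A = space (H_haar D) \<and> (\<forall>a\<in>A. emeasure (H_haar D) a \<noteq> \<infinity>)"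
  proof (intro exI[of _ \<W>] conjI ballI)
    show "\<W> \<subseteq> sets (H_haar D)" using W(2) open_sets_haar unfolding \<V>_def by blast
    show "\<Union> \<W> = space (H_haar D)" using W(3) space_haar by simp
    fix V assume "V \<in> \<W>"
    then obtain K where K: "V \<subseteq> K" "compactin (H_top D) K" using W(2) unfolding \<V>_def by blast
    have "closedin (H_top D) K" using Haus K(2) by (rule compactin_imp_closedin)
    then have "K = space (H_haar D) - (H - K)" "openin (H_top D) (H - K)"
      unfolding closedin_def space_haar by auto
    then have "K \<in> sets (H_haar D)" by (metis open_sets_haar sets.compl_sets)
    then have "emeasure (H_haar D) V \<le> emeasure (H_haar D) K" using K(1) by (rule emeasure_mono[rotated])
    also have "\<dots> < \<infinity>" using fin[OF K(2)] .
    finally show "emeasure (H_haar D) V \<noteq> \<infinity>" by simp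
  qed (rule W(1))
qed

end

section \<open>Matrix coefficients and admissibility\<close>

lemma L2_onD:
  assumes "f \<in> L2_on S"
  shows "f \<in> borel_measurable borel" "integrable lborel (\<lambda>x. (cmod (f x))\<^sup>2)" "x \<notin> S \<Longrightarrow> f x = 0"
  using assms unfolding L2_on_def by blast+

lemma L2_on_mono: "S \<subseteq> T \<Longrightarrow> f \<in> L2_on S \<Longrightarrow> f \<in> L2_on T"
  unfolding L2_on_def by blast

lemma L2_on_cmult: "f \<in> L2_on S \<Longrightarrow> (\<lambda>x. a * f x) \<in> L2_on S"
  unfolding L2_on_def by (auto simp: norm_mult power_mult_distrib intro: borel_measurable_times)

context symplectic_data begin

definition coord :: "real^'n \<Rightarrow> real^'d^'d" where
  "coord c = (\<Sum>i\<in>UNIV. (c $ i) *\<^sub>R basis D i)"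

lemma coord_in: "coord c \<in> Sig D"
  unfolding coord_def basis_facts(3)[symmetric] by (intro span_sum span_scale span_base) simp

lemma coord_quadratic: "(coord c *v x) \<bullet> x = - 2 * (c \<bullet> Phi D x)"
  unfolding coord_def
  by (simp add: linear_sum[OF linear_quadratic_form] linear_scale[OF linear_quadratic_form]
      inner_vec_def[of c] Phi_def sum_distrib_left)

lemma measurable_coord [measurable]: "coord \<in> lborel \<rightarrow>\<^sub>M restrict_space borel (Sig D)"
proof (rule measurable_restrict_space2)
  show "coord \<in> borel_measurable lborel"
    unfolding coord_def[abs_def] by measurable
qed (simp add: coord_in)

lemma haar_Sig_eq: "haar_Sig D = distr lborel (restrict_space borel (Sig D)) coord"
  by (simp add: haar_Sig_def coord_def[abs_def])

text \<open>The coordinate of \<open>dagger h \<sigma>\<close> along a basis vector is the restriction to \<open>Sig D\<close> of a linear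
  functional \<open>g\<close> on all matrices, and linear functionals are continuous.\<close>

lemma measurable_chi_mod [measurable]: "chi_mod D \<in> borel_measurable (H_haar D)"
proof -
  have "(\<lambda>h. M_mat D h $ i $ j) \<in> borel_measurable (H_haar D)" for i j
  proof -
    obtain g :: "real^'d^'d \<Rightarrow> real" where g: "linear g"
      "\<forall>v\<in>range (basis D). g v = (if v = basis D i then 1 else 0)"
      using linear_independent_extend[OF basis_facts(2), of "\<lambda>v. if v = basis D i then 1 else (0::real)"]
      by (elim exE conjE)
    have eq: "M_mat D h $ i $ j = g (dagger h (basis D j))" if "h \<in> space (H_haar D)" for h
    proof -
      have "g (basis D k) = (if k = i then 1 else 0)" for k
        using bspec[OF g(2), of "basis D k"] by (simp add: inj_eq[OF basis_facts(1)])
      then have "g (dagger h (basis D j)) = (\<Sum>k\<in>UNIV. M_mat D h $ k $ j * (if k = i then 1 else 0))"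
        using dagger_basis[of h j] that unfolding space_haar
        by (simp only: linear_sum[OF g(1)] linear_scale[OF g(1)] real_scaleR_def)
      also have "\<dots> = (\<Sum>k\<in>UNIV. if k = i then M_mat D h $ k $ j else 0)"
        by (intro sum.cong) auto
      finally show ?thesis by simp
    qed
    have cA: "continuous_on UNIV (\<lambda>A. transpose A ** basis D j ** A)"
      unfolding matrix_matrix_mult_def transpose_def by (auto intro!: continuous_intros continuous_on_vec_lambda)
    have cg: "continuous_on UNIV g"
      using g(1) by (rule linear_continuous_on[OF linear_conv_bounded_linear[THEN iffD1]])
    have "(\<lambda>A. g (transpose A ** basis D j ** A)) \<in> borel_measurable borel"
      by (rule borel_measurable_continuous_onI) (rule continuous_on_compose2[OF cg cA subset_UNIV])
    from measurable_compose[OF measurable_matrix_inv this]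
    have "(\<lambda>h. g (dagger h (basis D j))) \<in> borel_measurable (H_haar D)"
      by (simp add: dagger_def)
    then show ?thesis by (rule measurable_cong[THEN iffD1, rotated]) (simp only: eq)
  qed
  note entries = this
  have "(\<lambda>h. \<bar>det (M_mat D h)\<bar>) \<in> borel_measurable (H_haar D)"
    unfolding det_def
    by (intro borel_measurable_abs borel_measurable_sum borel_measurable_times borel_measurable_prod borel_measurable_const entries)
  then show ?thesis by (simp add: chi_mod_def[abs_def])
qed

lemma measurable_Phi [measurable]: "Phi D \<in> borel_measurable borel"
  unfolding Phi_def[abs_def] matrix_vector_mult_def inner_vec_def
  by (auto intro!: borel_measurable_continuous_onI continuous_intros continuous_on_vec_lambda)

text \<open>The function whose image under \<open>\<Phi>\<close> is to be Fourier transformed. The square of the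
  normalising factor combines the density \<open>\<chi>(h)\<^bsup>-1\<^esup>\<close> of Haar measure with the square of the factor
  \<open>\<beta>(h)\<^bsup>-1/2\<^esup>\<close> of the representation.\<close>

definition matrix_coefficient :: "(real^'d \<Rightarrow> complex) \<Rightarrow> (real^'d \<Rightarrow> complex) \<Rightarrow> real^'d^'d \<Rightarrow> real^'d \<Rightarrow> complex" where
  "matrix_coefficient f \<eta> h x = complex_of_real (1 / sqrt (chi_mod D h * beta_mod h)) * (f x * cnj (\<eta> (matrix_inv h *v x)))"

lemma inner_metaplectic:
  assumes h: "h \<in> H"
  shows "inner_L2 f (metaplectic (sp_block (coord c) h) \<eta>)
    = complex_of_real (sqrt (chi_mod D h)) * fourier lborel (Phi D) (matrix_coefficient f \<eta> h) c"
proof -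
  have b: "beta_mod h > 0" and chi: "chi_mod D h > 0" using h by (simp_all add: beta_mod_pos chi_mod_inverse)
  have e: "beta_mod h powr (- (1/2)) = sqrt (chi_mod D h) * (1 / sqrt (chi_mod D h * beta_mod h))"
    using b chi by (simp add: powr_minus powr_half_sqrt real_sqrt_mult field_simps)
  have "inner_L2 f (metaplectic (sp_block (coord c) h) \<eta>)
    = (LINT x|lborel. complex_of_real (sqrt (chi_mod D h)) * (matrix_coefficient f \<eta> h x * iexp (2 * pi * (c \<bullet> Phi D x))))"
    unfolding inner_L2_def
  proof (intro Bochner_Integration.integral_cong refl)
    fix x
    have "cnj (iexp (pi * ((coord c *v x) \<bullet> x))) = iexp (2 * pi * (c \<bullet> Phi D x))"
    proof -
      have "cnj (iexp a) = iexp (- a)" for a by (simp add: exp_cnj)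
      moreover have "- (pi * ((coord c *v x) \<bullet> x)) = 2 * pi * (c \<bullet> Phi D x)"
        unfolding coord_quadratic by simp
      ultimately show ?thesis by (simp only:)
    qed
    then show "f x * cnj (metaplectic (sp_block (coord c) h) \<eta> x)
      = complex_of_real (sqrt (chi_mod D h)) * (matrix_coefficient f \<eta> h x * iexp (2 * pi * (c \<bullet> Phi D x)))"
      unfolding metaplectic_sp_block[OF H_invertible[OF h]] matrix_coefficient_def e
      by (simp only: complex_cnj_mult complex_cnj_complex_of_real of_real_mult mult_ac)
  qed
  then show ?thesis unfolding fourier_def by simp
qed

lemma measurable_inner_metaplectic:
  assumes [measurable]: "f \<in> borel_measurable borel" "\<eta> \<in> borel_measurable borel"
  shows "(\<lambda>(\<sigma>, h). inner_L2 f (metaplectic (sp_block \<sigma> h) \<eta>)) \<in> borel_measurable (haar_Sig D \<Otimes>\<^sub>M H_haar D)"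
proof -
  let ?N = "haar_Sig D \<Otimes>\<^sub>M H_haar D"
  have [measurable]: "(\<lambda>\<sigma>. \<sigma>) \<in> borel_measurable (haar_Sig D)"
    unfolding haar_Sig_def by (simp add: measurable_restrict_space1)
  have s [measurable]: "(\<lambda>p. fst (fst p)) \<in> borel_measurable (?N \<Otimes>\<^sub>M lborel)"
    by (rule measurable_compose[of _ _ "haar_Sig D"]) simp_all
  have h [measurable]: "(\<lambda>p. snd (fst p)) \<in> borel_measurable (?N \<Otimes>\<^sub>M lborel)"
    by (rule measurable_compose[of _ _ "H_haar D"]) simp_all
  have i [measurable]: "(\<lambda>p. matrix_inv (snd (fst p))) \<in> borel_measurable (?N \<Otimes>\<^sub>M lborel)"
    by (rule measurable_compose[of _ _ "H_haar D"]) simp_all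
  have "(\<lambda>p. f (snd p) * cnj (complex_of_real (beta_mod (snd (fst p)) powr (- (1/2))) *
     iexp (pi * ((fst (fst p) *v snd p) \<bullet> snd p)) * \<eta> (matrix_inv (snd (fst p)) *v snd p)))
     \<in> borel_measurable (?N \<Otimes>\<^sub>M lborel)"
    unfolding beta_mod_def by measurable
  then have "(\<lambda>q. LINT x|lborel. f x * cnj (complex_of_real (beta_mod (snd q) powr (- (1/2))) *
     iexp (pi * ((fst q *v x) \<bullet> x)) * \<eta> (matrix_inv (snd q) *v x))) \<in> borel_measurable ?N"
    by (intro lborel.borel_measurable_lebesgue_integral) (simp add: case_prod_beta)
  then show ?thesis
  proof (rule measurable_cong[THEN iffD1, rotated])
    fix q assume "q \<in> space ?N"
    then have "invertible (snd q)" by (auto simp: space_pair_measure space_haar H_invertible)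
    then show "(LINT x|lborel. f x * cnj (complex_of_real (beta_mod (snd q) powr (- (1/2))) *
     iexp (pi * ((fst q *v x) \<bullet> x)) * \<eta> (matrix_inv (snd q) *v x)))
      = (case q of (\<sigma>, h) \<Rightarrow> inner_L2 f (metaplectic (sp_block \<sigma> h) \<eta>))"
      by (simp only: case_prod_beta inner_L2_def metaplectic_sp_block)
  qed
qed

text \<open>Haar measure of \<open>G\<close> is the image of Lebesgue measure on coordinates times Haar measure of \<open>H\<close>, with
  density \<open>1 / \<chi>\<close>; Tonelli then isolates the integral over the coordinates.\<close>

lemma nn_integral_haar_G:
  assumes f: "f \<in> borel_measurable borel" and \<eta>: "\<eta> \<in> borel_measurable borel"
  shows "(\<lambda>h. \<integral>\<^sup>+c. ennreal ((cmod (fourier lborel (Phi D) (matrix_coefficient f \<eta> h) c))\<^sup>2) \<partial>lborel)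
      \<in> borel_measurable (H_haar D)" (is "?meas")
    and "(\<integral>\<^sup>+g. ennreal ((cmod (inner_L2 f (metaplectic g \<eta>)))\<^sup>2) \<partial>haar_G D)
    = (\<integral>\<^sup>+h. (\<integral>\<^sup>+c. ennreal ((cmod (fourier lborel (Phi D) (matrix_coefficient f \<eta> h) c))\<^sup>2) \<partial>lborel) \<partial>H_haar D)"
    (is "?eq")
proof -
  interpret HS: sigma_finite_measure "H_haar D" by (rule sigma_finite_haar)
  interpret P: pair_sigma_finite "lborel :: (real^'n) measure" "H_haar D" ..
  let ?N = "haar_Sig D \<Otimes>\<^sub>M H_haar D"
  let ?w = "\<lambda>(\<sigma> :: real^'d^'d, h). ennreal (1 / chi_mod D h)"
  let ?F = "\<lambda>g. ennreal ((cmod (inner_L2 f (metaplectic g \<eta>)))\<^sup>2)"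
  let ?s = "\<lambda>(\<sigma>, h). sp_block \<sigma> h"
  have w [measurable]: "?w \<in> borel_measurable ?N" by measurable
  have "(\<lambda>p. cmod (case p of (\<sigma>, h) \<Rightarrow> inner_L2 f (metaplectic (sp_block \<sigma> h) \<eta>))) \<in> borel_measurable ?N"
    by (rule measurable_compose[OF measurable_inner_metaplectic[OF f \<eta>]]) simp
  then have F [measurable]: "(\<lambda>p. ?F (?s p)) \<in> borel_measurable ?N"
    by (simp add: case_prod_beta)
  have inj: "inj_on ?s (space (density ?N ?w))"
  proof (rule inj_onI)
    fix p q assume pq: "p \<in> space (density ?N ?w)" "q \<in> space (density ?N ?w)" "?s p = ?s q"
    then have inv: "invertible (snd p)" "invertible (snd q)" by (auto simp: space_pair_measure space_haar H_invertible)
    have "sp_block (fst p) (snd p) = sp_block (fst q) (snd q)" using pq(3) by (simp add: case_prod_beta)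
    then show "p = q"
      using block_sp_block[OF inv(1), of "fst p"] block_sp_block[OF inv(2), of "fst q"] by (intro prod_eqI) simp_all
  qed
  \<comment> \<open>Haar measure of \<open>H\<close> is written as an image measure as well, so that the product is one.\<close>
  have HS: "H_haar D = distr (H_haar D) (H_haar D) (\<lambda>h. h)" by (simp add: distr_id2)
  have N: "?N = distr (lborel \<Otimes>\<^sub>M H_haar D) (restrict_space borel (Sig D) \<Otimes>\<^sub>M H_haar D) (\<lambda>(c, h). (coord c, h))"
    unfolding haar_Sig_eq
    by (subst (1) HS, rule pair_measure_distr) (auto simp: HS[symmetric] sigma_finite_haar)
  have sets_N: "sets ?N = sets (restrict_space borel (Sig D) \<Otimes>\<^sub>M H_haar D)"
    unfolding haar_Sig_def by (intro sets_pair_measure_cong) simp_all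
  let ?m = "\<lambda>(c, h). (coord c, h)"
  have m: "?m \<in> lborel \<Otimes>\<^sub>M H_haar D \<rightarrow>\<^sub>M restrict_space borel (Sig D) \<Otimes>\<^sub>M H_haar D"
    by measurable
  have wF': "(\<lambda>p. ?w p * ?F (?s p)) \<in> borel_measurable (restrict_space borel (Sig D) \<Otimes>\<^sub>M H_haar D)"
    using borel_measurable_times_ennreal[OF w F] by (simp only: measurable_cong_sets[OF sets_N refl])
  have coeff: "?w (coord c, h) * ?F (?s (coord c, h)) = ennreal ((cmod (fourier lborel (Phi D) (matrix_coefficient f \<eta> h) c))\<^sup>2)"
    if "h \<in> space (H_haar D)" for h c
  proof -
    have h: "h \<in> H" using that by (simp add: space_haar)
    have chi: "chi_mod D h > 0" using h by (simp add: chi_mod_inverse)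
    then show ?thesis
      by (simp add: inner_metaplectic[OF h] norm_mult power_mult_distrib ennreal_mult'[symmetric])
  qed
  have "(\<integral>\<^sup>+g. ?F g \<partial>haar_G D) = (\<integral>\<^sup>+p. ?F (?s p) \<partial>density ?N ?w)"
    unfolding haar_G_def
    by (rule nn_integral_embed_measure'[OF inj]) (rule measurable_embed_measure1,
      use F in \<open>simp only: measurable_cong_sets[OF sets_density refl]\<close>)
  also have "\<dots> = (\<integral>\<^sup>+p. ?w p * ?F (?s p) \<partial>?N)"
    by (rule nn_integral_density[OF w F])
  also have "\<dots> = (\<integral>\<^sup>+q. ?w (coord (fst q), snd q) * ?F (?s (coord (fst q), snd q)) \<partial>(lborel \<Otimes>\<^sub>M H_haar D))"
  proof -
    have "(\<integral>\<^sup>+p. ?w p * ?F (?s p) \<partial>?N) = (\<integral>\<^sup>+q. (\<lambda>p. ?w p * ?F (?s p)) (?m q) \<partial>(lborel \<Otimes>\<^sub>M H_haar D))"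
      unfolding N by (rule nn_integral_distr[OF m]) (simp add: wF')
    then show ?thesis by (simp only: case_prod_beta fst_conv snd_conv)
  qed
  also have "\<dots> = (\<integral>\<^sup>+h. (\<integral>\<^sup>+c. ?w (coord c, h) * ?F (?s (coord c, h)) \<partial>lborel) \<partial>H_haar D)"
  proof (subst P.nn_integral_snd[symmetric])
    from measurable_compose[OF m wF']
    show "(\<lambda>q. ?w (coord (fst q), snd q) * ?F (?s (coord (fst q), snd q))) \<in> borel_measurable (lborel \<Otimes>\<^sub>M H_haar D)"
      by (simp only: case_prod_beta fst_conv snd_conv)
  qed (simp only: fst_conv snd_conv)
  also have "\<dots> = (\<integral>\<^sup>+h. (\<integral>\<^sup>+c. ennreal ((cmod (fourier lborel (Phi D) (matrix_coefficient f \<eta> h) c))\<^sup>2) \<partial>lborel) \<partial>H_haar D)"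
    by (intro nn_integral_cong coeff)
  finally show ?eq .
  have "(\<lambda>(h, c). (coord c, h)) \<in> H_haar D \<Otimes>\<^sub>M lborel \<rightarrow>\<^sub>M restrict_space borel (Sig D) \<Otimes>\<^sub>M H_haar D"
    by measurable
  from measurable_compose[OF this wF']
  have "(\<lambda>(h, c). ?w (coord c, h) * ?F (?s (coord c, h))) \<in> borel_measurable (H_haar D \<Otimes>\<^sub>M lborel)"
    by (simp only: case_prod_unfold fst_conv snd_conv)
  from lborel.borel_measurable_nn_integral[OF this] show ?meas
    by (rule measurable_cong[THEN iffD1, rotated]) (intro nn_integral_cong, rule coeff, simp_all)
qed

end

context symplectic_data begin

text \<open>Cauchy-Schwarz for \<open>f\<close> and \<open>\<eta> \<circ> h\<^bsup>-1\<^esup>\<close>; the latter is square integrable by the linear change of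
  variables.\<close>

lemma integrable_matrix_coefficient:
  assumes f: "f \<in> L2_on S" and \<eta>: "\<eta> \<in> L2_on S'" and h: "h \<in> H"
  shows "integrable lborel (matrix_coefficient f \<eta> h)"
proof -
  note F = L2_onD(1,2)[OF f] and E = L2_onD(1,2)[OF \<eta>]
  note [measurable] = F(1) E(1)
  let ?k = "matrix_inv h"
  let ?e = "\<lambda>x. cnj (\<eta> (?k *v x))"
  have k: "invertible ?k" using H_invertible H_inv h by blast
  have "integrable lborel (\<lambda>x. (indicator UNIV x * jacobian (\<lambda>x. ?k *v x) x) *\<^sub>R (cmod (\<eta> (?k *v x)))\<^sup>2)"
    using integral_jacobian(1)[OF diffeomorphism_matrix[OF k], of "\<lambda>x. (cmod (\<eta> x))\<^sup>2"] E(2) by simp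
  then have "integrable lborel (\<lambda>x. \<bar>det ?k\<bar> * (cmod (\<eta> (?k *v x)))\<^sup>2)"
    by (simp add: jacobian_matrix)
  moreover have "\<bar>det ?k\<bar> \<noteq> 0" using k invertible_det_nz by auto
  ultimately have e2: "integrable lborel (\<lambda>x. (cmod (?e x))\<^sup>2)" by simp
  have [measurable]: "?e \<in> borel_measurable borel" by measurable
  have "integrable lborel (\<lambda>x. f x * ?e x)"
  proof (rule cauchy_schwarz_integral(1)[OF _ _ F(2) e2])
    show "(LINT x|lborel. (cmod (f x))\<^sup>2) \<le> (sqrt (LINT x|lborel. (cmod (f x))\<^sup>2))\<^sup>2"
      "(LINT x|lborel. (cmod (?e x))\<^sup>2) \<le> (sqrt (LINT x|lborel. (cmod (?e x))\<^sup>2))\<^sup>2" by simp_all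
  qed simp_all
  then show ?thesis
    unfolding matrix_coefficient_def[abs_def] by (rule integrable_mult_right)
qed

definition restrict_X :: "(real^'d \<Rightarrow> complex) \<Rightarrow> real^'d \<Rightarrow> complex" where
  "restrict_X f x = (if x \<in> X then f x else 0)"

lemma restrict_X_L2:
  assumes "f \<in> L2_on S"
  shows "restrict_X f \<in> L2_on X" "(LINT x|lborel. (cmod (restrict_X f x))\<^sup>2) = (LINT x|lborel. (cmod (f x))\<^sup>2)"
    "AE x in lborel. restrict_X f x = f x"
proof -
  note F = L2_onD(1,2)[OF assms]
  note [measurable] = F(1) borel_open[OF open_X]
  show ae: "AE x in lborel. restrict_X f x = f x"
    using AE_X by eventually_elim (simp add: restrict_X_def)
  have [measurable]: "restrict_X f \<in> borel_measurable borel"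
    unfolding restrict_X_def[abs_def] by measurable
  have ae2: "AE x in lborel. (cmod (restrict_X f x))\<^sup>2 = (cmod (f x))\<^sup>2"
    using ae by eventually_elim simp
  show "(LINT x|lborel. (cmod (restrict_X f x))\<^sup>2) = (LINT x|lborel. (cmod (f x))\<^sup>2)"
    by (rule integral_cong_AE[OF _ _ ae2]) measurable
  have "integrable lborel (\<lambda>x. (cmod (restrict_X f x))\<^sup>2)"
    using F(2) by (subst integrable_cong_AE[OF _ _ ae2]) measurable
  then show "restrict_X f \<in> L2_on X"
    unfolding L2_on_def by (simp add: restrict_X_def)
qed

text \<open>The complement of \<open>X\<close> is a null set, so it suffices to test admissibility with functions that
  vanish off \<open>X\<close>.\<close>

lemma admissible_iff:
  "admissible D \<eta> \<longleftrightarrow> \<eta> \<in> L2_on UNIV \<and> (\<forall>f\<in>L2_on X. ennreal (LINT x|lborel. (cmod (f x))\<^sup>2) =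
    (\<integral>\<^sup>+h. (\<integral>\<^sup>+c. ennreal ((cmod (fourier lborel (Phi D) (matrix_coefficient f \<eta> h) c))\<^sup>2) \<partial>lborel) \<partial>H_haar D))"
  (is "_ \<longleftrightarrow> _ \<and> (\<forall>f\<in>L2_on X. ?n f = ?G f)")
proof (cases "\<eta> \<in> L2_on UNIV")
  case True
  note [measurable] = L2_onD(1)[OF True]
  have G: "(\<integral>\<^sup>+g. ennreal ((cmod (inner_L2 f (metaplectic g \<eta>)))\<^sup>2) \<partial>haar_G D) = ?G f" if "f \<in> L2_on S" for f S
    by (rule nn_integral_haar_G) (use that True in \<open>auto dest: L2_onD(1)\<close>)
  have "?G (restrict_X f) = ?G f" if f: "f \<in> L2_on UNIV" for f
  proof -
    note [measurable] = L2_onD(1)[OF f] L2_onD(1)[OF restrict_X_L2(1)[OF f]]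
    have "fourier lborel (Phi D) (matrix_coefficient (restrict_X f) \<eta> h) c = fourier lborel (Phi D) (matrix_coefficient f \<eta> h) c" for h c
      unfolding fourier_def
    proof (rule integral_cong_AE)
      show "AE x in lborel. matrix_coefficient (restrict_X f) \<eta> h x * iexp (2 * pi * (c \<bullet> Phi D x))
        = matrix_coefficient f \<eta> h x * iexp (2 * pi * (c \<bullet> Phi D x))"
        using restrict_X_L2(3)[OF f] by eventually_elim (simp add: matrix_coefficient_def)
    qed (unfold matrix_coefficient_def, measurable)
    then show ?thesis by (simp only:)
  qed
  with restrict_X_L2(1,2) have "(\<forall>f\<in>L2_on UNIV. ?n f = ?G f) \<longleftrightarrow> (\<forall>f\<in>L2_on X. ?n f = ?G f)"
    using L2_on_mono[OF subset_UNIV] by metis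
  moreover have "admissible D \<eta> \<longleftrightarrow> (\<forall>f\<in>L2_on UNIV. ?n f = ?G f)"
    unfolding admissible_def using True G[of _ UNIV] by simp
  ultimately show ?thesis using True by blast
qed (simp add: admissible_def)

lemma matrix_coefficient_outside: "f \<in> L2_on X \<Longrightarrow> x \<notin> X \<Longrightarrow> matrix_coefficient f \<eta> h x = 0"
  by (simp add: matrix_coefficient_def L2_onD(3))

text \<open>A function that vanishes off \<open>X\<close> sees only the values of \<open>\<eta>\<close> on \<open>h\<^bsup>-1\<^esup> X\<close>, which is contained in
  \<open>X\<close>.\<close>

lemma admissible_restrict_X:
  assumes "\<eta> \<in> L2_on UNIV"
  shows "admissible D (restrict_X \<eta>) \<longleftrightarrow> admissible D \<eta>"
proof -
  have "matrix_coefficient f (restrict_X \<eta>) h = matrix_coefficient f \<eta> h" if f: "f \<in> L2_on X" and h: "h \<in> space (H_haar D)" for f h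
  proof
    fix x
    show "matrix_coefficient f (restrict_X \<eta>) h x = matrix_coefficient f \<eta> h x"
    proof (cases "x \<in> X")
      case True
      then have "matrix_inv h *v x \<in> X" using h by (simp add: space_haar X_inv H_inv)
      then show ?thesis by (simp add: matrix_coefficient_def restrict_X_def)
    qed (simp add: matrix_coefficient_outside[OF f])
  qed
  then have "(\<integral>\<^sup>+h. (\<integral>\<^sup>+c. ennreal ((cmod (fourier lborel (Phi D) (matrix_coefficient f (restrict_X \<eta>) h) c))\<^sup>2) \<partial>lborel) \<partial>H_haar D)
    = (\<integral>\<^sup>+h. (\<integral>\<^sup>+c. ennreal ((cmod (fourier lborel (Phi D) (matrix_coefficient f \<eta> h) c))\<^sup>2) \<partial>lborel) \<partial>H_haar D)"
    if "f \<in> L2_on X" for f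
    using that by (intro nn_integral_cong) simp
  moreover have "restrict_X \<eta> \<in> L2_on UNIV"
    using L2_on_mono[OF subset_UNIV restrict_X_L2(1)[OF assms]] .
  ultimately show ?thesis
    unfolding admissible_iff using assms by simp
qed

end

section \<open>Orbit maps\<close>

text \<open>Turns the equivalence of bounds delivered by \<open>fourier_L2_dual\<close> into an equality of integrals,
  the infinite value included.\<close>

lemma ennreal_eq_of_squares:
  fixes a b :: ennreal
  assumes "\<And>B. B \<ge> 0 \<Longrightarrow> a \<le> ennreal (B\<^sup>2) \<longleftrightarrow> b \<le> ennreal (B\<^sup>2)"
  shows "a = b"
proof -
  have le: "x \<le> y" if "\<And>B. B \<ge> 0 \<Longrightarrow> y \<le> ennreal (B\<^sup>2) \<Longrightarrow> x \<le> ennreal (B\<^sup>2)" for x y :: ennreal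
  proof (cases y)
    case (real r)
    then show ?thesis using that[of "sqrt r"] by simp
  qed simp
  show ?thesis by (rule antisym) (rule le, simp add: assms)+
qed

text \<open>The arithmetic behind the transfer of matrix coefficients. At a point \<open>x = h z\<close> it is used with
  \<open>a\<close>, \<open>b\<close> the Jacobians of \<open>\<psi>\<close> at \<open>x\<close>, \<open>z\<close>, with \<open>p\<close>, \<open>q\<close> the Jacobians of \<open>\<xi>\<close> at the images of \<open>x\<close>, \<open>z\<close>
  under \<open>\<Phi>\<close>, and with \<open>c\<close>, \<open>c'\<close>, \<open>\<beta>\<close>, \<open>\<beta>'\<close> the moduli of \<open>h\<close> and \<open>\<theta> h\<close>.\<close>

lemma weight_identity:
  fixes a b p q c c' \<beta> \<beta>' :: real
  assumes "a > 0" "b > 0" "p > 0" "q > 0" "c > 0" "c' > 0" "\<beta> > 0" "\<beta>' > 0"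
    and "a * \<beta> = \<beta>' * b" "p * c' = q * c"
  shows "a / sqrt (c' * \<beta>') * sqrt q = sqrt a * sqrt p * sqrt b / sqrt (c * \<beta>)"
proof -
  have b: "b = a * \<beta> / \<beta>'" and q: "q = p * c' / c" using assms by (simp_all add: field_simps)
  have "a = sqrt a * sqrt a" using assms by simp
  then show ?thesis
    unfolding b q real_sqrt_mult real_sqrt_divide using assms by (simp add: field_simps)
qed

locale orbit_setting = src: symplectic_data D + tgt: symplectic_data D'
  for D :: "('d::finite, 'n::finite, 'e::euclidean_space) data_rec"
    and D' :: "('d, 'n, 'f::euclidean_space) data_rec" +
  fixes \<theta> :: "real^'d^'d \<Rightarrow> real^'d^'d" and \<psi> :: "real^'d \<Rightarrow> real^'d" and \<xi> :: "real^'n \<Rightarrow> real^'n"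
  assumes orbit_map: "orbit_map D D' \<theta> \<psi> \<xi>"
begin

lemma \<psi>: "diffeomorphism src.X tgt.X \<psi>"
  and \<xi>: "diffeomorphism (im_Y D) (im_Y D') \<xi>"
  and \<theta>_iso: "lie_group_iso (H_top D) (H_atlas D) (H_top D') (H_atlas D') \<theta>"
  and \<theta>_haar: "H_haar D' = distr (H_haar D) (H_haar D') \<theta>"
  using orbit_map unfolding orbit_map_def by blast+

lemma equivariant: "h \<in> src.H \<Longrightarrow> x \<in> src.X \<Longrightarrow> \<psi> (h *v x) = \<theta> h *v \<psi> x"
  and intertwine: "x \<in> src.X \<Longrightarrow> \<xi> (Phi D x) = Phi D' (\<psi> x)"
  using orbit_map unfolding orbit_map_def by blast+

lemmas \<psi>_facts = diffeomorphism_inv[OF \<psi>]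
lemmas \<xi>_facts = diffeomorphism_inv[OF \<xi>]

lemma Phi_Y: "x \<in> src.X \<Longrightarrow> Phi D x \<in> im_Y D" "x' \<in> tgt.X \<Longrightarrow> Phi D' x' \<in> im_Y D'"
  by (simp_all add: im_Y_def)

lemma \<theta>_in: "h \<in> src.H \<Longrightarrow> \<theta> h \<in> tgt.H"
  using \<theta>_iso unfolding lie_group_iso_def by (meson bij_betwE)

lemma measurable_\<theta>: "\<theta> \<in> H_haar D \<rightarrow>\<^sub>M H_haar D'"
proof (rule measurable_sigma_sets[OF tgt.sets_haar])
  show "{U. openin (H_top D') U} \<subseteq> Pow tgt.H" using openin_subset by blast
  show "\<theta> \<in> space (H_haar D) \<rightarrow> tgt.H" using \<theta>_in by (simp add: src.space_haar)
  fix U assume "U \<in> {U. openin (H_top D') U}"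
  moreover have "continuous_map (H_top D) (H_top D') \<theta>"
    using \<theta>_iso unfolding lie_group_iso_def smooth_map_def by blast
  ultimately have "openin (H_top D) {h \<in> src.H. \<theta> h \<in> U}"
    by (simp add: openin_continuous_map_preimage)
  then show "\<theta> -` U \<inter> space (H_haar D) \<in> sets (H_haar D)"
    using src.open_sets_haar by (simp add: src.space_haar vimage_def Int_def conj_commute)
qed

text \<open>Differentiate \<open>\<psi> (h *v x) = \<theta> h *v \<psi> x\<close> at \<open>z\<close>.\<close>

lemma jacobian_\<psi>:
  assumes h: "h \<in> src.H" and z: "z \<in> src.X"
  shows "jacobian \<psi> (h *v z) * beta_mod h = beta_mod (\<theta> h) * jacobian \<psi> z"
proof -
  have d: "((\<lambda>x. A *v x) has_derivative (\<lambda>x. A *v x)) (at x)" for A :: "real^'d^'d" and x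
    by (rule linear_imp_has_derivative) simp
  note d1 = smooth_on_derivative[OF \<psi>_facts(9) src.X_inv[OF h z]] and d2 = smooth_on_derivative[OF \<psi>_facts(9) z]
  have "jacobian \<psi> (h *v z) * beta_mod h = jacobian (\<lambda>x. \<psi> (h *v x)) z"
    using jacobian_chain[OF d d1] by (simp add: jacobian_matrix beta_mod_def)
  also have "\<dots> = jacobian (\<lambda>x. \<theta> h *v \<psi> x) z"
    by (rule jacobian_cong_open[OF src.open_X z])
      (auto simp: equivariant h intro: differentiableI diff_chain_at[OF d d1, unfolded o_def])
  also have "\<dots> = beta_mod (\<theta> h) * jacobian \<psi> z"
    using jacobian_chain[OF d2 d] by (simp add: jacobian_matrix beta_mod_def)
  finally show ?thesis .
qed

text \<open>On the open set \<open>im_Y D\<close> the map \<open>\<xi>\<close> intertwines the matrices \<open>N\<close> and \<open>N'\<close> by which \<open>h\<close> and \<open>\<theta> h\<close> act on the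
  values of \<open>\<Phi>\<close> and \<open>\<Phi>'\<close>; differentiate this relation and use that \<open>det N\<close> and \<open>det N'\<close> are the inverses of
  the moduli, up to sign.\<close>

lemma jacobian_\<xi>:
  assumes h: "h \<in> src.H" and z: "z \<in> src.X"
  shows "jacobian \<xi> (Phi D (h *v z)) * chi_mod D' (\<theta> h) = jacobian \<xi> (Phi D z) * chi_mod D h"
proof -
  let ?N = "transpose (M_mat D (matrix_inv h))" and ?N' = "transpose (M_mat D' (matrix_inv (\<theta> h)))"
  note h' = \<theta>_in[OF h]
  have Ny: "?N *v y \<in> im_Y D" "\<xi> (?N *v y) = ?N' *v \<xi> y" if y: "y \<in> im_Y D" for y
  proof -
    obtain x where x: "x \<in> src.X" "y = Phi D x" using y by (auto simp: im_Y_def)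
    have eq: "?N *v y = Phi D (h *v x)" unfolding x(2) by (rule src.Phi_equivariant[OF h, symmetric])
    show "?N *v y \<in> im_Y D" unfolding eq by (intro Phi_Y src.X_inv h x)
    have "\<xi> (?N *v y) = Phi D' (\<psi> (h *v x))" unfolding eq by (intro intertwine src.X_inv h x)
    also have "\<dots> = Phi D' (\<theta> h *v \<psi> x)" by (simp only: equivariant[OF h x(1)])
    also have "\<dots> = ?N' *v \<xi> y" unfolding x(2) intertwine[OF x(1)] by (rule tgt.Phi_equivariant[OF h'])
    finally show "\<xi> (?N *v y) = ?N' *v \<xi> y" .
  qed
  define y where "y = Phi D z"
  have y: "y \<in> im_Y D" unfolding y_def by (rule Phi_Y(1)[OF z])
  have d: "((\<lambda>x. A *v x) has_derivative (\<lambda>x. A *v x)) (at x)" for A :: "real^'n^'n" and x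
    by (rule linear_imp_has_derivative) simp
  note d1 = smooth_on_derivative[OF \<xi>_facts(9) Ny(1)[OF y]] and d2 = smooth_on_derivative[OF \<xi>_facts(9) y]
  have dN: "\<bar>det ?N\<bar> * chi_mod D h = 1" "\<bar>det ?N'\<bar> * chi_mod D' (\<theta> h) = 1"
    using src.chi_mod_inverse(1)[OF h] tgt.chi_mod_inverse(1)[OF h'] by (simp_all add: chi_mod_def det_transpose)
  have "jacobian \<xi> (?N *v y) * \<bar>det ?N\<bar> = jacobian (\<lambda>y. \<xi> (?N *v y)) y"
    by (simp only: jacobian_chain[OF d d1] jacobian_matrix)
  also have "\<dots> = jacobian (\<lambda>y. ?N' *v \<xi> y) y"
  proof (rule jacobian_cong_open[OF \<xi>_facts(7) y])
    show "(\<lambda>y. \<xi> (?N *v y)) differentiable at y"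
      by (rule differentiableI, rule diff_chain_at[OF d d1, unfolded o_def])
  qed (rule Ny(2))
  also have "\<dots> = \<bar>det ?N'\<bar> * jacobian \<xi> y"
    by (simp only: jacobian_chain[OF d2 d] jacobian_matrix)
  finally have "jacobian \<xi> (?N *v y) * \<bar>det ?N\<bar> * (chi_mod D h * chi_mod D' (\<theta> h))
    = \<bar>det ?N'\<bar> * jacobian \<xi> y * (chi_mod D h * chi_mod D' (\<theta> h))"
    by simp
  then have "jacobian \<xi> (?N *v y) * chi_mod D' (\<theta> h) * (\<bar>det ?N\<bar> * chi_mod D h)
    = jacobian \<xi> y * chi_mod D h * (\<bar>det ?N'\<bar> * chi_mod D' (\<theta> h))"
    by (simp only: mult_ac)
  then have "jacobian \<xi> (?N *v y) * chi_mod D' (\<theta> h) = jacobian \<xi> y * chi_mod D h"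
    by (simp only: dN mult_1_right)
  then show ?thesis
    unfolding y_def by (simp only: src.Phi_equivariant[OF h])
qed

lemma W_op_L2:
  assumes f: "f' \<in> L2_on tgt.X"
  shows "W_op D \<psi> f' \<in> L2_on src.X"
    "(LINT x|lborel. (cmod (W_op D \<psi> f' x))\<^sup>2) = (LINT x|lborel. (cmod (f' x))\<^sup>2)"
proof -
  note F = L2_onD[OF f]
  note [measurable] = F(1) borel_measurable_indicator_jacobian[OF \<psi>] borel_measurable_indicator_diffeomorphism[OF \<psi>]
  have eq: "W_op D \<psi> f' = (\<lambda>x. complex_of_real (sqrt (indicator src.X x * jacobian \<psi> x)) * f' (indicator src.X x *\<^sub>R \<psi> x))"
    by (auto simp: W_op_def indicator_def fun_eq_iff)
  have m: "W_op D \<psi> f' \<in> borel_measurable borel" unfolding eq by measurable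
  have sq: "(cmod (W_op D \<psi> f' x))\<^sup>2 = (indicator src.X x * jacobian \<psi> x) *\<^sub>R (cmod (f' (\<psi> x)))\<^sup>2" for x
    using jacobian_pos[OF \<psi>, of x] by (auto simp: W_op_def norm_mult power_mult_distrib)
  note I = integral_jacobian[OF \<psi>, of "\<lambda>x. (cmod (f' x))\<^sup>2"]
  have "integrable lborel (\<lambda>x. (cmod (W_op D \<psi> f' x))\<^sup>2)"
    unfolding sq using I(1) F by simp
  then show "W_op D \<psi> f' \<in> L2_on src.X"
    unfolding L2_on_def using m by (simp add: W_op_def)
  show "(LINT x|lborel. (cmod (W_op D \<psi> f' x))\<^sup>2) = (LINT x|lborel. (cmod (f' x))\<^sup>2)"
    unfolding sq using I(2) F by simp
qed

lemma W_op_inj: "inj_on (W_op D \<psi>) (L2_on tgt.X)"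
proof (rule inj_onI, rule ext)
  fix f g y assume f: "f \<in> L2_on tgt.X" and g: "g \<in> L2_on tgt.X" and eq: "W_op D \<psi> f = W_op D \<psi> g"
  show "f y = g y"
  proof (cases "y \<in> tgt.X")
    case True
    let ?x = "inv_into src.X \<psi> y"
    have x: "?x \<in> src.X" "\<psi> ?x = y" using \<psi>_facts(3,4) True by blast+
    have "W_op D \<psi> f ?x = W_op D \<psi> g ?x" using eq by simp
    then show ?thesis using x jacobian_pos[OF \<psi> x(1)] by (simp add: W_op_def)
  qed (simp add: L2_onD(3)[OF f] L2_onD(3)[OF g])
qed

text \<open>The witness is \<open>(g / sqrt (J\<psi>)) \<circ> \<psi>\<^bsup>-1\<^esup>\<close>, extended by 0.\<close>

lemma W_op_surj:
  assumes g: "g \<in> L2_on src.X"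
  obtains f' where "f' \<in> L2_on tgt.X" "W_op D \<psi> f' = g"
proof
  note G = L2_onD[OF g]
  let ?i = "inv_into src.X \<psi>"
  define f' where "f' = (\<lambda>y. if y \<in> tgt.X then g (?i y) / complex_of_real (sqrt (jacobian \<psi> (?i y))) else 0)"
  have ci: "continuous_on tgt.X ?i" by (rule smooth_on_continuous[OF \<psi>_facts(10)])
  have "continuous_on tgt.X (\<lambda>y. jacobian \<psi> (?i y))"
    by (rule continuous_on_compose2[OF continuous_on_jacobian[OF \<psi>_facts(9)] ci]) (use \<psi>_facts(3) in blast)
  then have [measurable]: "(\<lambda>y. indicator tgt.X y * jacobian \<psi> (?i y)) \<in> borel_measurable borel"
    using \<psi>_facts(8) borel_measurable_continuous_on_indicator[of tgt.X "\<lambda>y. jacobian \<psi> (?i y)"] by simp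
  have [measurable]: "(\<lambda>y. indicator tgt.X y *\<^sub>R ?i y) \<in> borel_measurable borel"
    using \<psi>_facts(8) ci by (intro borel_measurable_continuous_on_indicator) auto
  note [measurable] = G(1) borel_open[OF \<psi>_facts(8)]
  have "f' = (\<lambda>y. indicator tgt.X y *\<^sub>R (g (indicator tgt.X y *\<^sub>R ?i y) / complex_of_real (sqrt (indicator tgt.X y * jacobian \<psi> (?i y)))))"
    by (auto simp: f'_def indicator_def fun_eq_iff)
  then have m: "f' \<in> borel_measurable borel" by simp
  show W: "W_op D \<psi> f' = g"
  proof
    fix x show "W_op D \<psi> f' x = g x"
    proof (cases "x \<in> src.X")
      case True
      then show ?thesis
        using jacobian_pos[OF \<psi> True] \<psi>_facts(1)[OF True] \<psi>_facts(2)[OF True] by (simp add: W_op_def f'_def)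
    qed (simp add: W_op_def G(3))
  qed
  have sq: "(cmod (g x))\<^sup>2 = (indicator src.X x * jacobian \<psi> x) *\<^sub>R (cmod (f' (\<psi> x)))\<^sup>2" for x
    unfolding W[symmetric] using jacobian_pos[OF \<psi>, of x] by (auto simp: W_op_def norm_mult power_mult_distrib)
  have "integrable lborel (\<lambda>x. (cmod (f' x))\<^sup>2)"
    using integral_jacobian(1)[OF \<psi>, of "\<lambda>x. (cmod (f' x))\<^sup>2"] m G(2) unfolding sq by (simp add: f'_def)
  then show "f' \<in> L2_on tgt.X"
    unfolding L2_on_def using m by (simp add: f'_def)
qed

text \<open>The isometry of \<open>L\<^sup>2(Y')\<close> onto \<open>L\<^sup>2(Y)\<close> given by \<open>\<xi>\<close>, on test functions.\<close>

definition test_pullback :: "(real^'n \<Rightarrow> complex) \<Rightarrow> real^'n \<Rightarrow> complex" where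
  "test_pullback \<phi> y = (if y \<in> im_Y D then complex_of_real (sqrt (jacobian \<xi> y)) * \<phi> (\<xi> y) else 0)"

lemma test_pullback:
  assumes \<phi>: "compact_test (im_Y D') \<phi>"
  shows "compact_test (im_Y D) (test_pullback \<phi>)"
    "(LINT y|lborel. (cmod (test_pullback \<phi> y))\<^sup>2) = (LINT y|lborel. (cmod (\<phi> y))\<^sup>2)"
proof -
  show "compact_test (im_Y D) (test_pullback \<phi>)"
    unfolding test_pullback_def[abs_def]
    by (rule compact_test_pullback[OF \<xi>_facts(7) smooth_on_continuous[OF \<xi>_facts(9)] \<xi>_facts(1) \<xi>_facts(2)
        smooth_on_continuous[OF \<xi>_facts(10)] \<xi>_facts(3) continuous_on_real_sqrt[OF continuous_on_jacobian[OF \<xi>_facts(9)]] \<phi>])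
  have 0: "\<phi> y = 0" if "y \<notin> im_Y D'" for y
    using \<phi> that unfolding compact_test_def by blast
  have "(cmod (test_pullback \<phi> y))\<^sup>2 = (indicator (im_Y D) y * jacobian \<xi> y) *\<^sub>R (cmod (\<phi> (\<xi> y)))\<^sup>2" for y
    using jacobian_pos[OF \<xi>, of y] by (auto simp: test_pullback_def norm_mult power_mult_distrib)
  then show "(LINT y|lborel. (cmod (test_pullback \<phi> y))\<^sup>2) = (LINT y|lborel. (cmod (\<phi> y))\<^sup>2)"
    using integral_jacobian(2)[OF \<xi>, of "\<lambda>y. (cmod (\<phi> y))\<^sup>2"] compact_test_integrable(1)[OF \<phi>] 0 by simp
qed

text \<open>The witness is \<open>(\<phi> / sqrt (J\<xi>)) \<circ> \<xi>\<^bsup>-1\<^esup>\<close>, extended by 0.\<close>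

lemma test_pullback_surj:
  assumes \<phi>: "compact_test (im_Y D) \<phi>"
  obtains \<phi>' where "compact_test (im_Y D') \<phi>'" "test_pullback \<phi>' = \<phi>"
proof
  let ?i = "inv_into (im_Y D) \<xi>"
  let ?m = "\<lambda>y. inverse (sqrt (jacobian \<xi> (?i y)))"
  define \<phi>' where "\<phi>' = (\<lambda>y. if y \<in> im_Y D' then complex_of_real (?m y) * \<phi> (?i y) else 0)"
  have ci: "continuous_on (im_Y D') ?i" by (rule smooth_on_continuous[OF \<xi>_facts(10)])
  have cJ: "continuous_on (im_Y D') (\<lambda>y. jacobian \<xi> (?i y))"
    by (rule continuous_on_compose2[OF continuous_on_jacobian[OF \<xi>_facts(9)] ci]) (use \<xi>_facts(3) in blast)
  have J0: "sqrt (jacobian \<xi> (?i y)) \<noteq> 0" if "y \<in> im_Y D'" for y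
    using jacobian_pos[OF \<xi> \<xi>_facts(3)[OF that]] by simp
  have cm: "continuous_on (im_Y D') ?m"
    by (intro continuous_on_inverse continuous_on_real_sqrt cJ) (use J0 in blast)
  show "compact_test (im_Y D') \<phi>'"
    unfolding \<phi>'_def
    by (rule compact_test_pullback[OF \<xi>_facts(8) ci \<xi>_facts(3) \<xi>_facts(4) smooth_on_continuous[OF \<xi>_facts(9)] \<xi>_facts(1) cm \<phi>])
  show "test_pullback \<phi>' = \<phi>"
  proof
    fix y show "test_pullback \<phi>' y = \<phi> y"
    proof (cases "y \<in> im_Y D")
      case True
      then show ?thesis
        using jacobian_pos[OF \<xi> True] \<xi>_facts(1)[OF True] \<xi>_facts(2)[OF True]
        by (simp add: test_pullback_def \<phi>'_def flip: of_real_mult)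
    next
      case False
      then show ?thesis using \<phi> unfolding compact_test_def test_pullback_def by (metis subsetD)
    qed
  qed
qed

context
  fixes \<eta> \<eta>' f' :: "real^'d \<Rightarrow> complex"
  assumes \<eta>: "\<eta> \<in> L2_on src.X" and \<eta>': "\<eta>' \<in> L2_on tgt.X" and f': "f' \<in> L2_on tgt.X"
    and W\<eta>: "W_op D \<psi> \<eta>' = star D \<xi> \<eta>"
begin

text \<open>The heart of the argument. Put \<open>x = h z\<close>; then \<open>(\<theta> h)\<^bsup>-1\<^esup> \<psi>(x) = \<psi>(z)\<close>, and \<open>\<eta>'\<close> at \<open>\<psi>(z)\<close> is \<open>\<eta>\<close> at \<open>z\<close> times
  \<open>sqrt (J\<xi>(\<Phi> z) / J\<psi>(z))\<close>. The transformation laws of the Jacobians trade these values at \<open>z\<close> for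
  values at \<open>x\<close> and moduli of \<open>h\<close>. What is left is a function of \<open>\<Phi> x\<close>, which can be moved to the test
  function.\<close>

lemma matrix_coefficient_transfer:
  assumes h: "h \<in> src.H" and x: "x \<in> src.X"
  shows "jacobian \<psi> x *\<^sub>R tgt.matrix_coefficient f' \<eta>' (\<theta> h) (\<psi> x)
    = src.matrix_coefficient (W_op D \<psi> f') \<eta> h x * complex_of_real (sqrt (jacobian \<xi> (Phi D x)))"
proof -
  define z where "z = matrix_inv h *v x"
  have z: "z \<in> src.X" and hz: "h *v z = x"
    unfolding z_def using src.X_inv[OF src.H_inv[OF h] x] src.H_cancel(3)[OF h] by auto
  have \<psi>z: "matrix_inv (\<theta> h) *v \<psi> x = \<psi> z"
    unfolding hz[symmetric] equivariant[OF h z] by (rule tgt.H_cancel(4)[OF \<theta>_in[OF h]])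
  note pos = jacobian_pos[OF \<psi> x] jacobian_pos[OF \<psi> z] jacobian_pos[OF \<xi> Phi_Y(1)[OF x]] jacobian_pos[OF \<xi> Phi_Y(1)[OF z]]
    src.chi_mod_inverse(2)[OF h] tgt.chi_mod_inverse(2)[OF \<theta>_in[OF h]] src.beta_mod_pos[OF h] tgt.beta_mod_pos[OF \<theta>_in[OF h]]
  let ?a = "jacobian \<psi> x" and ?b = "jacobian \<psi> z" and ?p = "jacobian \<xi> (Phi D x)" and ?q = "jacobian \<xi> (Phi D z)"
  let ?k = "chi_mod D h * beta_mod h" and ?k' = "chi_mod D' (\<theta> h) * beta_mod (\<theta> h)"
  have real: "?a / sqrt ?k' * sqrt ?q = sqrt ?a * sqrt ?p * sqrt ?b / sqrt ?k"
    by (rule weight_identity[OF pos]) (use jacobian_\<psi>[OF h z] jacobian_\<xi>[OF h z] in \<open>simp_all add: hz\<close>)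
  have "W_op D \<psi> \<eta>' z = star D \<xi> \<eta> z" using W\<eta> by simp
  then have "complex_of_real (sqrt ?b) * \<eta>' (\<psi> z) = complex_of_real (sqrt ?q) * \<eta> z"
    using z by (simp add: W_op_def star_def)
  then have "\<eta> z = complex_of_real (sqrt ?b / sqrt ?q) * \<eta>' (\<psi> z)"
    using pos by (simp add: field_simps)
  then have "src.matrix_coefficient (W_op D \<psi> f') \<eta> h x * complex_of_real (sqrt ?p)
    = complex_of_real (sqrt ?a * sqrt ?p * sqrt ?b / sqrt ?k / sqrt ?q) * (f' (\<psi> x) * cnj (\<eta>' (\<psi> z)))"
    unfolding src.matrix_coefficient_def z_def[symmetric] using x by (simp add: W_op_def)
  also have "sqrt ?a * sqrt ?p * sqrt ?b / sqrt ?k / sqrt ?q = ?a / sqrt ?k'"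
    unfolding real[symmetric] using pos by simp
  finally show ?thesis
    unfolding tgt.matrix_coefficient_def \<psi>z by (simp add: scaleR_conv_of_real)
qed

lemma integral_test_transfer:
  assumes h: "h \<in> src.H" and \<phi>: "compact_test (im_Y D') \<phi>"
  shows "(LINT x|lborel. tgt.matrix_coefficient f' \<eta>' (\<theta> h) x * \<phi> (Phi D' x))
    = (LINT x|lborel. src.matrix_coefficient (W_op D \<psi> f') \<eta> h x * test_pullback \<phi> (Phi D x))"
proof -
  let ?c' = "tgt.matrix_coefficient f' \<eta>' (\<theta> h)" and ?c = "src.matrix_coefficient (W_op D \<psi> f') \<eta> h"
  have [measurable]: "?c' \<in> borel_measurable borel"
    using tgt.integrable_matrix_coefficient[OF f' \<eta>' \<theta>_in[OF h]] by (simp add: borel_measurable_integrable)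
  note [measurable] = compact_test_integrable(1)[OF \<phi>] tgt.measurable_Phi
  have "(LINT x|lborel. ?c' x * \<phi> (Phi D' x))
    = (LINT x|lborel. (indicator src.X x * jacobian \<psi> x) *\<^sub>R (?c' (\<psi> x) * \<phi> (Phi D' (\<psi> x))))"
    by (rule integral_jacobian(2)[OF \<psi>]) (simp_all add: tgt.matrix_coefficient_outside[OF f'])
  also have "\<dots> = (LINT x|lborel. ?c x * test_pullback \<phi> (Phi D x))"
  proof (intro Bochner_Integration.integral_cong refl)
    fix x
    show "(indicator src.X x * jacobian \<psi> x) *\<^sub>R (?c' (\<psi> x) * \<phi> (Phi D' (\<psi> x))) = ?c x * test_pullback \<phi> (Phi D x)"
    proof (cases "x \<in> src.X")
      case True
      have "jacobian \<psi> x *\<^sub>R (?c' (\<psi> x) * \<phi> (Phi D' (\<psi> x))) = (jacobian \<psi> x *\<^sub>R ?c' (\<psi> x)) * \<phi> (Phi D' (\<psi> x))"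
        by simp
      also have "\<dots> = ?c x * test_pullback \<phi> (Phi D x)"
        unfolding matrix_coefficient_transfer[OF h True]
        by (simp add: test_pullback_def Phi_Y(1)[OF True] intertwine[OF True])
      finally show ?thesis using True by simp
    qed (simp add: src.matrix_coefficient_outside[OF W_op_L2(1)[OF f']])
  qed
  finally show ?thesis .
qed

text \<open>By duality both sides are norms of functionals on test functions, and \<open>test_pullback\<close> is an
  isometric bijection that exchanges the two functionals.\<close>

lemma fourier_norm_transfer:
  assumes h: "h \<in> src.H"
  shows "(\<integral>\<^sup>+c. ennreal ((cmod (fourier lborel (Phi D') (tgt.matrix_coefficient f' \<eta>' (\<theta> h)) c))\<^sup>2) \<partial>lborel)
    = (\<integral>\<^sup>+c. ennreal ((cmod (fourier lborel (Phi D) (src.matrix_coefficient (W_op D \<psi> f') \<eta> h) c))\<^sup>2) \<partial>lborel)"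
proof (rule ennreal_eq_of_squares)
  fix B :: real assume B: "B \<ge> 0"
  let ?c' = "tgt.matrix_coefficient f' \<eta>' (\<theta> h)" and ?c = "src.matrix_coefficient (W_op D \<psi> f') \<eta> h"
  have "(\<integral>\<^sup>+c. ennreal ((cmod (fourier lborel (Phi D') ?c' c))\<^sup>2) \<partial>lborel) \<le> ennreal (B\<^sup>2) \<longleftrightarrow>
    (\<forall>\<phi>. compact_test (im_Y D') \<phi> \<longrightarrow>
      cmod (LINT x|lborel. ?c' x * \<phi> (Phi D' x)) \<le> B * sqrt (LINT y|lborel. (cmod (\<phi> y))\<^sup>2))"
    using tgt.matrix_coefficient_outside[OF f'] Phi_Y(2)
    by (intro fourier_L2_dual[OF lborel.sigma_finite_measure_axioms _ tgt.integrable_matrix_coefficient[OF f' \<eta>' \<theta>_in[OF h]] \<xi>_facts(8) _ B])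
      auto
  also have "\<dots> \<longleftrightarrow> (\<forall>\<phi>. compact_test (im_Y D) \<phi> \<longrightarrow>
      cmod (LINT x|lborel. ?c x * \<phi> (Phi D x)) \<le> B * sqrt (LINT y|lborel. (cmod (\<phi> y))\<^sup>2))" (is "?L \<longleftrightarrow> ?R")
  proof
    assume L: ?L
    show ?R
    proof (intro allI impI)
      fix \<phi> assume "compact_test (im_Y D) \<phi>"
      then obtain \<phi>' where \<phi>': "compact_test (im_Y D') \<phi>'" "test_pullback \<phi>' = \<phi>" by (rule test_pullback_surj)
      show "cmod (LINT x|lborel. ?c x * \<phi> (Phi D x)) \<le> B * sqrt (LINT y|lborel. (cmod (\<phi> y))\<^sup>2)"
        using L[rule_format, OF \<phi>'(1)] unfolding integral_test_transfer[OF h \<phi>'(1)] test_pullback(2)[OF \<phi>'(1), symmetric] \<phi>'(2) .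
    qed
  next
    assume R: ?R
    show ?L
    proof (intro allI impI)
      fix \<phi> assume \<phi>: "compact_test (im_Y D') \<phi>"
      show "cmod (LINT x|lborel. ?c' x * \<phi> (Phi D' x)) \<le> B * sqrt (LINT y|lborel. (cmod (\<phi> y))\<^sup>2)"
        using R[rule_format, OF test_pullback(1)[OF \<phi>]] unfolding integral_test_transfer[OF h \<phi>] test_pullback(2)[OF \<phi>] .
    qed
  qed
  also have "\<dots> \<longleftrightarrow> (\<integral>\<^sup>+c. ennreal ((cmod (fourier lborel (Phi D) ?c c))\<^sup>2) \<partial>lborel) \<le> ennreal (B\<^sup>2)"
    using src.matrix_coefficient_outside[OF W_op_L2(1)[OF f']] Phi_Y(1)
    by (intro fourier_L2_dual[OF lborel.sigma_finite_measure_axioms _ src.integrable_matrix_coefficient[OF W_op_L2(1)[OF f'] \<eta> h] \<xi>_facts(7) _ B, symmetric])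
      auto
  finally show "(\<integral>\<^sup>+c. ennreal ((cmod (fourier lborel (Phi D') ?c' c))\<^sup>2) \<partial>lborel) \<le> ennreal (B\<^sup>2) \<longleftrightarrow>
    (\<integral>\<^sup>+c. ennreal ((cmod (fourier lborel (Phi D) ?c c))\<^sup>2) \<partial>lborel) \<le> ennreal (B\<^sup>2)" .
qed

lemma group_integral_transfer:
  "(\<integral>\<^sup>+h. (\<integral>\<^sup>+c. ennreal ((cmod (fourier lborel (Phi D') (tgt.matrix_coefficient f' \<eta>' h) c))\<^sup>2) \<partial>lborel) \<partial>H_haar D')
    = (\<integral>\<^sup>+h. (\<integral>\<^sup>+c. ennreal ((cmod (fourier lborel (Phi D) (src.matrix_coefficient (W_op D \<psi> f') \<eta> h) c))\<^sup>2) \<partial>lborel) \<partial>H_haar D)"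
proof -
  let ?G = "\<lambda>h. \<integral>\<^sup>+c. ennreal ((cmod (fourier lborel (Phi D') (tgt.matrix_coefficient f' \<eta>' h) c))\<^sup>2) \<partial>lborel"
  have G: "?G \<in> borel_measurable (H_haar D')"
    by (rule tgt.nn_integral_haar_G(1)[OF L2_onD(1)[OF f'] L2_onD(1)[OF \<eta>']])
  have "integral\<^sup>N (H_haar D') ?G = integral\<^sup>N (distr (H_haar D) (H_haar D') \<theta>) ?G"
    using \<theta>_haar by (rule arg_cong)
  also have "\<dots> = (\<integral>\<^sup>+h. ?G (\<theta> h) \<partial>H_haar D)"
    by (rule nn_integral_distr[OF measurable_\<theta>]) (simp add: G)
  also have "\<dots> = (\<integral>\<^sup>+h. (\<integral>\<^sup>+c. ennreal ((cmod (fourier lborel (Phi D) (src.matrix_coefficient (W_op D \<psi> f') \<eta> h) c))\<^sup>2) \<partial>lborel) \<partial>H_haar D)"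
    by (intro nn_integral_cong fourier_norm_transfer) (simp add: src.space_haar)
  finally show ?thesis .
qed

end

text \<open>The vectors that test admissibility correspond to each other under the unitary \<open>W\<close>, and
  \<open>\<theta>\<close> carries one Haar measure to the other.\<close>

lemma admissible_transfer:
  assumes \<eta>: "\<eta> \<in> L2_on src.X" and \<eta>': "\<eta>' \<in> L2_on tgt.X" and W\<eta>: "W_op D \<psi> \<eta>' = star D \<xi> \<eta>"
  shows "admissible D \<eta> \<longleftrightarrow> admissible D' \<eta>'"
proof -
  let ?n = "\<lambda>f. ennreal (LINT x|lborel. (cmod (f x))\<^sup>2)"
  let ?G = "\<lambda>f. \<integral>\<^sup>+h. (\<integral>\<^sup>+c. ennreal ((cmod (fourier lborel (Phi D) (src.matrix_coefficient f \<eta> h) c))\<^sup>2) \<partial>lborel) \<partial>H_haar D"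
  let ?G' = "\<lambda>f. \<integral>\<^sup>+h. (\<integral>\<^sup>+c. ennreal ((cmod (fourier lborel (Phi D') (tgt.matrix_coefficient f \<eta>' h) c))\<^sup>2) \<partial>lborel) \<partial>H_haar D'"
  have eq: "?n f' = ?n (W_op D \<psi> f')" "?G' f' = ?G (W_op D \<psi> f')" if "f' \<in> L2_on tgt.X" for f'
    using group_integral_transfer[OF \<eta> \<eta>' that W\<eta>] W_op_L2(2)[OF that] by simp_all
  have "(\<forall>f\<in>L2_on src.X. ?n f = ?G f) \<longleftrightarrow> (\<forall>f'\<in>L2_on tgt.X. ?n f' = ?G' f')"
  proof
    assume L: "\<forall>f\<in>L2_on src.X. ?n f = ?G f"
    show "\<forall>f'\<in>L2_on tgt.X. ?n f' = ?G' f'"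
      using L W_op_L2(1) eq by simp
  next
    assume R: "\<forall>f'\<in>L2_on tgt.X. ?n f' = ?G' f'"
    show "\<forall>f\<in>L2_on src.X. ?n f = ?G f"
    proof
      fix f assume "f \<in> L2_on src.X"
      then obtain f' where f': "f' \<in> L2_on tgt.X" "W_op D \<psi> f' = f" by (rule W_op_surj)
      show "?n f = ?G f" using R[rule_format, OF f'(1)] unfolding eq[OF f'(1)] f'(2) .
    qed
  qed
  moreover have "\<eta> \<in> L2_on UNIV" "\<eta>' \<in> L2_on UNIV"
    using L2_on_mono[OF subset_UNIV] \<eta> \<eta>' by blast+
  ultimately show ?thesis
    unfolding src.admissible_iff tgt.admissible_iff by simp
qed

lemma W_inv_star:
  assumes "star D \<xi> \<eta> \<in> L2_on src.X"
  shows "W_inv D D' \<psi> (star D \<xi> \<eta>) \<in> L2_on tgt.X" "W_op D \<psi> (W_inv D D' \<psi> (star D \<xi> \<eta>)) = star D \<xi> \<eta>"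
proof -
  have "star D \<xi> \<eta> \<in> W_op D \<psi> ` L2_on tgt.X"
    using W_op_surj[OF assms] by (metis imageI)
  then show "W_inv D D' \<psi> (star D \<xi> \<eta>) \<in> L2_on tgt.X" "W_op D \<psi> (W_inv D D' \<psi> (star D \<xi> \<eta>)) = star D \<xi> \<eta>"
    unfolding W_inv_def by (rule inv_into_into, rule f_inv_into_f)
qed

text \<open>The witness is \<open>c\<^bsup>-1/2\<^esup> W \<eta>'\<close>, after \<open>\<eta>'\<close> has been set to 0 on the null set off \<open>X'\<close>; this change is why
  the conclusion holds only almost everywhere.\<close>

lemma admissible_preimage:
  assumes c: "c > 0" "\<And>y. y \<in> im_Y D \<Longrightarrow> jacobian \<xi> y = c" and \<eta>': "admissible D' \<eta>'"
  obtains \<eta> where "\<eta> \<in> L2_on src.X" "admissible D \<eta>" "AE x in lborel. \<eta>' x = W_inv D D' \<psi> (star D \<xi> \<eta>) x"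
proof
  let ?r = "tgt.restrict_X \<eta>'"
  have L: "\<eta>' \<in> L2_on UNIV" using \<eta>' by (simp add: admissible_def)
  note r = tgt.restrict_X_L2[OF L]
  define \<eta> where "\<eta> = (\<lambda>x. complex_of_real (1 / sqrt c) * W_op D \<psi> ?r x)"
  show 1: "\<eta> \<in> L2_on src.X"
    unfolding \<eta>_def by (rule L2_on_cmult[OF W_op_L2(1)[OF r(1)]])
  have W: "W_op D \<psi> ?r = star D \<xi> \<eta>"
  proof
    fix x show "W_op D \<psi> ?r x = star D \<xi> \<eta> x"
    proof (cases "x \<in> src.X")
      case True
      then show ?thesis using c(1) by (simp add: star_def \<eta>_def c(2)[OF Phi_Y(1)[OF True]])
    qed (simp add: star_def W_op_def)
  qed
  show "admissible D \<eta>"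
    using admissible_transfer[OF 1 r(1) W] tgt.admissible_restrict_X[OF L] \<eta>' by simp
  have "W_inv D D' \<psi> (star D \<xi> \<eta>) = ?r"
    unfolding W[symmetric] W_inv_def by (rule inv_into_f_f[OF W_op_inj r(1)])
  then show "AE x in lborel. \<eta>' x = W_inv D D' \<psi> (star D \<xi> \<eta>) x"
    using r(3) by (simp add: eq_commute)
qed

end

theorem theorem12:
  fixes D :: "('d::finite, 'n::finite, 'e::euclidean_space) data_rec"
    and D' :: "('d, 'n, 'f::euclidean_space) data_rec"
    and \<theta> :: "real^'d^'d \<Rightarrow> real^'d^'d"
    and \<psi> :: "real^'d \<Rightarrow> real^'d"
    and \<xi> :: "real^'n \<Rightarrow> real^'n"
  assumes "data_set D" and "data_set D'" and "orbit_map D D' \<theta> \<psi> \<xi>"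
  shows "(\<forall>\<eta>\<in>L2_on (dom_X D). admissible D \<eta> \<longrightarrow> star D \<xi> \<eta> \<in> L2_on (dom_X D) \<longrightarrow>
            admissible D' (W_inv D D' \<psi> (star D \<xi> \<eta>))) \<and>
         (orbit_equivalence D D' \<theta> \<psi> \<xi> \<longrightarrow>
            (\<forall>\<eta>'. admissible D' \<eta>' \<longrightarrow>
               (\<exists>\<eta>\<in>L2_on (dom_X D). admissible D \<eta> \<and>
                  (AE x in lborel. \<eta>' x = W_inv D D' \<psi> (star D \<xi> \<eta>) x))))"
proof -
  interpret orbit_setting D D' \<theta> \<psi> \<xi>
    using assms by unfold_locales
  show ?thesis
  proof (intro conjI ballI impI allI)
    fix \<eta> assume \<eta>: "\<eta> \<in> L2_on (dom_X D)" "admissible D \<eta>" "star D \<xi> \<eta> \<in> L2_on (dom_X D)"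
    show "admissible D' (W_inv D D' \<psi> (star D \<xi> \<eta>))"
      using admissible_transfer[OF \<eta>(1) W_inv_star[OF \<eta>(3)]] \<eta>(2) by simp
  next
    fix \<eta>' assume eq: "orbit_equivalence D D' \<theta> \<psi> \<xi>" and \<eta>': "admissible D' \<eta>'"
    obtain c where c: "c > 0" "\<And>y. y \<in> im_Y D \<Longrightarrow> jacobian \<xi> y = c"
      using eq unfolding orbit_equivalence_def by blast
    obtain \<eta> where "\<eta> \<in> L2_on (dom_X D)" "admissible D \<eta>" "AE x in lborel. \<eta>' x = W_inv D D' \<psi> (star D \<xi> \<eta>) x"
      by (rule admissible_preimage[OF c \<eta>'])
    then show "\<exists>\<eta>\<in>L2_on (dom_X D). admissible D \<eta> \<and> (AE x in lborel. \<eta>' x = W_inv D D' \<psi> (star D \<xi> \<eta>) x)"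
      by blast
  qed
qed

end
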